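(* Let $k$ be a field, $<$ a monomial preorder on $k[X]=k[x_1,\dots,x_n]$, and $I$ a homogeneous ideal in $k[X]$. Then $\beta_{i,j}(k[X]/I)\le\beta_{i,j}(k[X]/L_<(I))$ for all $i\in\mathbb{N}$, $j\in\mathbb{Z}$.
   Context: "Homogeneous" is with respect to the standard grading $\deg x_i=1$. For $a\in\mathbb{N}^n$ write $x^a=x_1^{\alpha_1}\cdots x_n^{\alpha_n}$. A weak order on a set is a strict partial order for which incomparability is an equivalence relation. A monomial preorder on $k[X]$ is a weak order $<$ on the monomials such that for all $a,b,c\in\mathbb{N}^n$: $x^a<x^b$ if and only if $x^ax^c<x^bx^c$. For $f=\sum c_ax^a\in k[X]$, the leading part $L_<(f)$ is the sum of those terms $c_ax^a$ ($c_a\ne0$) such that no monomial $x^b$ occurring in $f$ satisfies $x^a<x^b$. For $I\subseteq k[X]$, $L_<(I)$ is the ideal of $k[X]$ generated by all $L_<(f)$, $f\in I$; for homogeneous $I$ it is again homogeneous. For a finitely generated graded $k[X]$-module $E$, the graded Betti number $\beta_{i,j}(E)$ is the number of copies of $k[X](-j)$ in the $i$-th module of a minimal graded free resolution of $E$; equivalently $\beta_{i,j}(E)=\dim_k\operatorname{Tor}_i^{k[X]}(E,k)_j$. *)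

theory Defs
  imports "HOL-Library.Poly_Mapping" "HOL-Algebra.QuotRing" "HOL-Algebra.Module"
begin

section \<open>The polynomial ring and its standard grading\<close>

text \<open>
  A monomial \<open>x\<^sup>a\<close> is represented by its exponent vector \<open>a\<close>, a finitely supported map from
  variable indices to \<open>nat\<close>; the product of monomials is then addition of exponents.
  The variables of \<open>k[x\<^sub>1, \<dots>, x\<^sub>n]\<close> are indexed by \<open>0, \<dots>, n - 1\<close>; \<open>n = 0\<close> is allowed.
\<close>

type_synonym mon = "nat \<Rightarrow>\<^sub>0 nat"

type_synonym 'k mpoly = "mon \<Rightarrow>\<^sub>0 'k"

definition monomials :: "nat \<Rightarrow> mon set" where
  "monomials n = {a. Poly_Mapping.keys a \<subseteq> {..<n}}"

definition mpoly_ring :: "nat \<Rightarrow> 'k::field mpoly ring" where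
  "mpoly_ring n = \<lparr>carrier = {f. Poly_Mapping.keys f \<subseteq> monomials n},
     mult = (*), one = 1, zero = 0, add = (+)\<rparr>"

definition mon_deg :: "mon \<Rightarrow> nat" where
  "mon_deg a = (\<Sum>i\<in>Poly_Mapping.keys a. Poly_Mapping.lookup a i)"

definition homogeneous_polys :: "nat \<Rightarrow> int \<Rightarrow> 'k::field mpoly set" where
  "homogeneous_polys n j = {f \<in> carrier (mpoly_ring n).
     \<forall>a\<in>Poly_Mapping.keys f. int (mon_deg a) = j}"

definition homogeneous_component :: "int \<Rightarrow> 'k::field mpoly \<Rightarrow> 'k mpoly" where
  "homogeneous_component j f =
     (\<Sum>a\<in>{a \<in> Poly_Mapping.keys f. int (mon_deg a) = j}.
        Poly_Mapping.single a (Poly_Mapping.lookup f a))"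

definition homogeneous_ideal :: "nat \<Rightarrow> 'k::field mpoly set \<Rightarrow> bool" where
  "homogeneous_ideal n I \<longleftrightarrow>
     ideal I (mpoly_ring n) \<and> (\<forall>f\<in>I. \<forall>j. homogeneous_component j f \<in> I)"

definition irrelevant_ideal :: "nat \<Rightarrow> 'k::field mpoly set" where
  "irrelevant_ideal n =
     genideal (mpoly_ring n) {Poly_Mapping.single (Poly_Mapping.single i 1) 1 |i. i < n}"


section \<open>Monomial preorders and leading ideals\<close>

definition weak_order_on :: "'a set \<Rightarrow> ('a \<Rightarrow> 'a \<Rightarrow> bool) \<Rightarrow> bool" where
  "weak_order_on A lt \<longleftrightarrow> irreflp_on A lt \<and> transp_on A lt \<and>
     equiv A {(a, b). a \<in> A \<and> b \<in> A \<and> \<not> lt a b \<and> \<not> lt b a}"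

definition monomial_preorder :: "nat \<Rightarrow> (mon \<Rightarrow> mon \<Rightarrow> bool) \<Rightarrow> bool" where
  "monomial_preorder n lt \<longleftrightarrow> weak_order_on (monomials n) lt \<and>
     (\<forall>a\<in>monomials n. \<forall>b\<in>monomials n. \<forall>c\<in>monomials n. lt a b \<longleftrightarrow> lt (a + c) (b + c))"

definition leading_part :: "(mon \<Rightarrow> mon \<Rightarrow> bool) \<Rightarrow> 'k::field mpoly \<Rightarrow> 'k mpoly" where
  "leading_part lt f =
     (\<Sum>a\<in>{a \<in> Poly_Mapping.keys f. \<not> (\<exists>b\<in>Poly_Mapping.keys f. lt a b)}.
        Poly_Mapping.single a (Poly_Mapping.lookup f a))"

definition leading_ideal ::
    "nat \<Rightarrow> (mon \<Rightarrow> mon \<Rightarrow> bool) \<Rightarrow> 'k::field mpoly set \<Rightarrow> 'k mpoly set" where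
  "leading_ideal n lt I = genideal (mpoly_ring n) (leading_part lt ` I)"


section \<open>Graded modules and graded Betti numbers\<close>

record ('a, 'b) graded_module = "('a, 'b) module" +
  gcomp :: "int \<Rightarrow> 'b set"

text \<open>
  The module record extends the ring record, but only its additive part and the scalar
  multiplication are meaningful for a module; multiplication and unit are left unspecified below.
\<close>

definition quotient_module ::
    "nat \<Rightarrow> 'k::field mpoly set \<Rightarrow> ('k mpoly, 'k mpoly set) graded_module" where
  "quotient_module n I = (let R = mpoly_ring n; Q = R Quot I in
     \<lparr>carrier = carrier Q, mult = undefined, one = undefined, zero = zero Q, add = add Q,
      smult = (\<lambda>r C. (I +>\<^bsub>R\<^esub> r) \<otimes>\<^bsub>Q\<^esub> C),
      gcomp = (\<lambda>j. (\<lambda>f. I +>\<^bsub>R\<^esub> f) ` homogeneous_polys n j)\<rparr>)"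

text \<open>
  For \<open>ds = [d\<^sub>0, \<dots>, d\<^bsub>r-1\<^esub>]\<close> this is \<open>k[X](-d\<^sub>0) \<oplus> \<dots> \<oplus> k[X](-d\<^bsub>r-1\<^esub>)\<close>, where
  \<open>k[X](-d)\<close> has \<open>k[X]\<^bsub>j-d\<^esub>\<close> in degree \<open>j\<close>. A vector is a function on \<open>nat\<close> vanishing at all
  indices \<open>\<ge> r\<close>.
\<close>

definition graded_free_module ::
    "nat \<Rightarrow> int list \<Rightarrow> ('k::field mpoly, nat \<Rightarrow> 'k mpoly) graded_module" where
  "graded_free_module n ds = (let
       V = {v. (\<forall>l<length ds. v l \<in> carrier (mpoly_ring n)) \<and> (\<forall>l\<ge>length ds. v l = 0)} in
     \<lparr>carrier = V, mult = undefined, one = undefined,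
      zero = (\<lambda>l. 0), add = (\<lambda>u v l. u l + v l), smult = (\<lambda>r v l. r * v l),
      gcomp = (\<lambda>j. {v \<in> V. \<forall>l<length ds. v l \<in> homogeneous_polys n (j - ds ! l)})\<rparr>)"

text \<open>Module homomorphisms of degree zero.\<close>

definition graded_hom :: "nat \<Rightarrow> ('k::field mpoly, 'b) graded_module \<Rightarrow>
    ('k mpoly, 'c) graded_module \<Rightarrow> ('b \<Rightarrow> 'c) set" where
  "graded_hom n M N = {h \<in> hom (add_monoid M) (add_monoid N).
     (\<forall>r\<in>carrier (mpoly_ring n). \<forall>x\<in>carrier M. h (r \<odot>\<^bsub>M\<^esub> x) = r \<odot>\<^bsub>N\<^esub> h x) \<and>
     (\<forall>j. h ` gcomp M j \<subseteq> gcomp N j)}"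

text \<open>
  A graded free resolution \<open>\<dots> \<rightarrow> F\<^sub>2 \<rightarrow> F\<^sub>1 \<rightarrow> F\<^sub>0 \<rightarrow> E \<rightarrow> 0\<close>, where \<open>F\<^sub>i\<close> has finite rank and is given
  by the list \<open>ds i\<close> of its shifts, \<open>\<phi> i\<close> is the map \<open>F\<^bsub>i+1\<^esub> \<rightarrow> F\<^sub>i\<close>, and \<open>\<epsilon>\<close> is the
  augmentation. Modules \<open>F\<^sub>i\<close> may be zero, so finite resolutions are included.
\<close>

definition graded_free_resolution :: "nat \<Rightarrow> ('k::field mpoly, 'b) graded_module \<Rightarrow>
    (nat \<Rightarrow> int list) \<Rightarrow> (nat \<Rightarrow> (nat \<Rightarrow> 'k mpoly) \<Rightarrow> nat \<Rightarrow> 'k mpoly) \<Rightarrow>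
    ((nat \<Rightarrow> 'k mpoly) \<Rightarrow> 'b) \<Rightarrow> bool" where
  "graded_free_resolution n E ds \<phi> \<epsilon> \<longleftrightarrow> (let F = (\<lambda>i. graded_free_module n (ds i)) in
     \<epsilon> \<in> graded_hom n (F 0) E \<and>
     (\<forall>i. \<phi> i \<in> graded_hom n (F (Suc i)) (F i)) \<and>
     \<epsilon> ` carrier (F 0) = carrier E \<and>
     \<phi> 0 ` carrier (F 1) = a_kernel (F 0) E \<epsilon> \<and>
     (\<forall>i. \<phi> (Suc i) ` carrier (F (Suc (Suc i))) = a_kernel (F (Suc i)) (F i) (\<phi> i)))"

text \<open>
  Minimality: the image of \<open>F\<^bsub>i+1\<^esub>\<close> lies in \<open>\<mm> F\<^sub>i\<close>, that is, in the set of vectors all of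
  whose entries lie in the irrelevant ideal \<open>\<mm> = (x\<^sub>1, \<dots>, x\<^sub>n)\<close>.
\<close>

definition minimal_graded_free_resolution :: "nat \<Rightarrow> ('k::field mpoly, 'b) graded_module \<Rightarrow>
    (nat \<Rightarrow> int list) \<Rightarrow> (nat \<Rightarrow> (nat \<Rightarrow> 'k mpoly) \<Rightarrow> nat \<Rightarrow> 'k mpoly) \<Rightarrow>
    ((nat \<Rightarrow> 'k mpoly) \<Rightarrow> 'b) \<Rightarrow> bool" where
  "minimal_graded_free_resolution n E ds \<phi> \<epsilon> \<longleftrightarrow> graded_free_resolution n E ds \<phi> \<epsilon> \<and>
     (\<forall>i. \<forall>v\<in>carrier (graded_free_module n (ds (Suc i))). \<forall>l<length (ds i).
        \<phi> i v l \<in> irrelevant_ideal n)"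

text \<open>The number of copies of \<open>k[X](-j)\<close> in \<open>F\<^sub>i\<close> is the number of occurrences of \<open>j\<close> in \<open>ds i\<close>.\<close>

definition betti ::
    "nat \<Rightarrow> ('k::field mpoly, 'b) graded_module \<Rightarrow> nat \<Rightarrow> int \<Rightarrow> nat" where
  "betti n E i j =
     (THE b. \<exists>ds \<phi> \<epsilon>. minimal_graded_free_resolution n E ds \<phi> \<epsilon> \<and> b = count_list (ds i) j)"

end

theory Submission
  imports Defs Complex_Main "HOL-Library.Function_Algebras" "HOL-Library.Product_Lexorder"
begin

text \<open>
  \<open>L\<^sub><(I)\<close> is graded not only by degree but also by the classes of monomials that have equal degree
  and are incomparable, so \<open>k[X]/L\<^sub><(I)\<close> has a minimal free resolution that respects this finer
  grading. Its maps can be deformed, one after the other, by terms of the same degree and smaller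
  class, so that the result is a (not necessarily minimal) graded free resolution of \<open>k[X]/I\<close> with
  the same shifts: kernels deform because every degree contains finitely many monomials, which
  makes the correction of a cycle by smaller and smaller terms stop. Finally a minimal
  resolution embeds into any other one modulo the irrelevant ideal, because a chain map lifting the
  identity from the minimal resolution to itself is homotopic to the identity, and homotopies vanish
  modulo the irrelevant ideal. This also yields that the Betti numbers are well-defined.
\<close>

text \<open>The preorder need not be a well-order, nor a total one: \<open>1\<close> may lie above
  the variables, and whole sets of monomials may be incomparable. Comparison is therefore confined
  to monomials of equal degree. A degree of the finer grading is represented by any monomial of its
  class, so a finely graded free module is a list \<open>bs\<close> of monomials, and taking
  \<open>mon_deg\<close> recovers its integer shifts; this is why the deformed resolution has
  exactly the same shifts. Since \<open>betti\<close> is a definite description, a minimal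
  resolution must exist for \<open>k[X]/I\<close> as well. It comes from the same construction,
  applied to the preorder in which no two monomials are comparable: there the leading ideal of
  \<open>I\<close> is \<open>I\<close> itself. The unit ideal is treated apart, because the
  construction starts with \<open>F_0 = k[X]\<close>, and this is not minimal over the zero
  module.\<close>

abbreviation keys :: "('a \<Rightarrow>\<^sub>0 'b::zero) \<Rightarrow> 'a set" where "keys \<equiv> Poly_Mapping.keys"
abbreviation lookup :: "('a \<Rightarrow>\<^sub>0 'b::zero) \<Rightarrow> 'a \<Rightarrow> 'b" where "lookup \<equiv> Poly_Mapping.lookup"
abbreviation single :: "'a \<Rightarrow> 'b \<Rightarrow> 'a \<Rightarrow>\<^sub>0 'b::zero" where "single \<equiv> Poly_Mapping.single"

section \<open>Monomials\<close>

lemma keys_add_mon: "keys (a + b :: mon) = keys a \<union> keys b"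
  by (auto simp: in_keys_iff lookup_add)

lemma zero_in_monomials [simp]: "0 \<in> monomials n"
  by (simp add: monomials_def)

lemma add_in_monomials [simp]: "a + b \<in> monomials n \<longleftrightarrow> a \<in> monomials n \<and> b \<in> monomials n"
  by (simp add: monomials_def keys_add_mon)

lemma add_eq_0_mon [simp]: "(a + b :: mon) = 0 \<longleftrightarrow> a = 0 \<and> b = 0"
  by (metis keys_add_mon keys_eq_empty Un_empty)

lemma mon_deg_sum:
  assumes "finite S" "keys a \<subseteq> S"
  shows "mon_deg a = (\<Sum>i\<in>S. lookup a i)"
  unfolding mon_deg_def using assms by (intro sum.mono_neutral_left) (auto simp: in_keys_iff)

lemma mon_deg_add: "mon_deg (a + b) = mon_deg a + mon_deg b"
  by (simp add: mon_deg_sum[of "keys a \<union> keys b"] keys_add_mon lookup_add sum.distrib)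

lemma mon_deg_0 [simp]: "mon_deg 0 = 0"
  by (simp add: mon_deg_def)

lemma mon_deg_eq_0 [simp]: "mon_deg a = 0 \<longleftrightarrow> a = 0"
  by (auto simp: mon_deg_def in_keys_iff simp flip: keys_eq_empty)

text \<open>Exponents at indices below \<open>n\<close> are bounded by \<open>d\<close>, all others
  vanish. The induction in \<open>wf_low\<close> and the reduction in
  \<open>homogeneous_noetherian\<close> terminate because of this.\<close>

lemma finite_monomials_of_degree: "finite {a \<in> monomials n. mon_deg a \<le> d}"
proof -
  have "lookup ` {a \<in> monomials n. mon_deg a \<le> d} \<subseteq>
     {f. \<forall>i. (i \<in> {..<n} \<longrightarrow> f i \<in> {..d}) \<and> (i \<notin> {..<n} \<longrightarrow> f i = 0)}"
  proof clarsimp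
    fix a i assume a: "a \<in> monomials n" and d: "mon_deg a \<le> d"
    have "lookup a i \<le> d" if "i < n"
    proof -
      have "lookup a i \<le> (\<Sum>i<n. lookup a i)" using that by (intro member_le_sum) auto
      then show ?thesis using d a mon_deg_sum[of "{..<n}" a] by (simp add: monomials_def)
    qed
    moreover have "lookup a i = 0" if "\<not> i < n"
      using a that by (auto simp: monomials_def in_keys_iff)
    ultimately show "(i < n \<longrightarrow> lookup a i \<le> d) \<and> (\<not> i < n \<longrightarrow> lookup a i = 0)" by auto
  qed
  moreover have "finite {f. \<forall>i. (i \<in> {..<n} \<longrightarrow> f i \<in> {..d}) \<and> (i \<notin> {..<n} \<longrightarrow> f i = 0)}"
    by (rule finite_set_of_finite_funs) auto
  ultimately have "finite (lookup ` {a \<in> monomials n. mon_deg a \<le> d})"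
    by (rule finite_subset)
  then show ?thesis by (rule finite_imageD) (auto intro!: inj_onI poly_mapping_eqI)
qed

section \<open>Polynomials\<close>

definition polys :: "nat \<Rightarrow> 'k::field mpoly set" where
  "polys n = {f. keys f \<subseteq> monomials n}"

lemma carrier_mpoly_ring [simp]: "carrier (mpoly_ring n) = polys n"
  by (simp add: mpoly_ring_def polys_def)

lemma polysD: "f \<in> polys n \<Longrightarrow> a \<in> keys f \<Longrightarrow> a \<in> monomials n"
  by (auto simp: polys_def)

lemma keys_minus_subset: "keys (f - g :: 'a \<Rightarrow>\<^sub>0 'b::ab_group_add) \<subseteq> keys f \<union> keys g"
  by (auto simp: in_keys_iff lookup_minus)

lemma keys_mult_subset: "a \<in> keys (f * g) \<Longrightarrow> \<exists>b\<in>keys f. \<exists>c\<in>keys g. a = b + c"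
  using keys_mult[of f g] by blast

lemma polys_0 [simp]: "0 \<in> polys n" and polys_1 [simp]: "1 \<in> polys n"
  by (auto simp: polys_def)

lemma polys_add [simp]: "f \<in> polys n \<Longrightarrow> g \<in> polys n \<Longrightarrow> f + g \<in> polys n"
  using keys_add[of f g] by (auto simp: polys_def)

lemma polys_diff [simp]: "f \<in> polys n \<Longrightarrow> g \<in> polys n \<Longrightarrow> f - g \<in> polys n"
  using keys_minus_subset[of f g] by (auto simp: polys_def)

lemma polys_uminus [simp]: "f \<in> polys n \<Longrightarrow> - f \<in> polys n"
  using polys_diff[of 0 n f] by simp

lemma polys_mult [simp]: "f \<in> polys n \<Longrightarrow> g \<in> polys n \<Longrightarrow> f * g \<in> polys n"
  by (auto simp: polys_def dest!: keys_mult_subset)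

lemma polys_sum: "(\<And>i. i \<in> S \<Longrightarrow> f i \<in> polys n) \<Longrightarrow> sum f S \<in> polys n"
  by (induction S rule: infinite_finite_induct) auto

lemma polys_single [simp]: "a \<in> monomials n \<Longrightarrow> single a c \<in> polys n"
  by (auto simp: polys_def)

lemma poly_expand: "(f :: 'k::field mpoly) = (\<Sum>a\<in>keys f. single a (lookup f a))"
  by (rule poly_mapping_eqI) (simp add: lookup_sum lookup_single when_def in_keys_iff)

text \<open>The constant coefficient is reduction modulo the irrelevant ideal. It is multiplicative
  because a sum of exponent vectors is zero only if both summands are.\<close>

lemma lookup_mult_0: "lookup (f * g :: 'k::field mpoly) 0 = lookup f 0 * lookup g 0"
proof -
  have "lookup (f * g) 0 = (\<Sum>l. lookup f l * (\<Sum>q. lookup g q when 0 = l + q))"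
    by (simp add: lookup_mult)
  also have "(\<lambda>l. lookup f l * (\<Sum>q. lookup g q when 0 = l + q)) =
             (\<lambda>l. lookup f l * lookup g 0 when l = 0)"
  proof
    fix l :: mon
    have "(\<lambda>q. lookup g q when 0 = l + q) = (\<lambda>q. (lookup g 0 when l = 0) when q = 0)"
      by (auto simp: fun_eq_iff when_def eq_commute[of 0])
    then show "lookup f l * (\<Sum>q. lookup g q when 0 = l + q) = (lookup f l * lookup g 0 when l = 0)"
      by (simp add: when_def)
  qed
  finally show ?thesis by simp
qed

lemma lookup_single_mult:
  "lookup (single d c * f :: 'k::field mpoly) (d + a) = c * lookup f a"
proof -
  have "lookup (single d c * f) (d + a) =
      (\<Sum>b\<in>keys f. lookup (single (d + b) (c * lookup f b)) (d + a))"
    by (subst poly_expand[of f]) (simp only: sum_distrib_left lookup_sum mult_single)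
  also have "\<dots> = (\<Sum>b\<in>keys f. if b = a then c * lookup f a else 0)"
    by (intro sum.cong) (auto simp: lookup_single when_def)
  finally show ?thesis by (simp add: in_keys_iff)
qed

section \<open>Projections of polynomials onto sets of terms\<close>

definition restr :: "(mon \<Rightarrow> bool) \<Rightarrow> 'k::field mpoly \<Rightarrow> 'k mpoly" where
  "restr Q f = (\<Sum>a\<in>{a \<in> keys f. Q a}. single a (lookup f a))"

lemma lookup_restr: "lookup (restr Q f) a = (if Q a then lookup f a else 0)"
proof -
  have "lookup (restr Q f) a = (\<Sum>b\<in>{b \<in> keys f. Q b}. if b = a then lookup f a else 0)"
    unfolding restr_def lookup_sum by (intro sum.cong) (auto simp: lookup_single when_def)
  then show ?thesis by (simp add: in_keys_iff)
qed

lemma keys_restr: "keys (restr Q f) = {a \<in> keys f. Q a}"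
  by (auto simp: in_keys_iff lookup_restr split: if_splits)

lemma restr_0 [simp]: "restr Q 0 = 0"
  by (rule poly_mapping_eqI) (simp add: lookup_restr)

lemma restr_add: "restr Q (f + g) = restr Q f + restr Q g"
  by (rule poly_mapping_eqI) (simp add: lookup_restr lookup_add)

lemma restr_diff: "restr Q (f - g) = restr Q f - restr Q g"
  by (rule poly_mapping_eqI) (simp add: lookup_restr lookup_minus)

lemma restr_sum: "restr Q (sum f S) = (\<Sum>i\<in>S. restr Q (f i))"
  by (induction S rule: infinite_finite_induct) (auto simp: restr_add)

lemma restr_restr: "restr Q (restr Q' f) = restr (\<lambda>a. Q a \<and> Q' a) f"
  by (rule poly_mapping_eqI) (simp add: lookup_restr)

lemma restr_eq_self: "(\<And>a. a \<in> keys f \<Longrightarrow> Q a) \<Longrightarrow> restr Q f = f"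
  by (rule poly_mapping_eqI) (auto simp: lookup_restr in_keys_iff)

lemma restr_eq_0: "(\<And>a. a \<in> keys f \<Longrightarrow> \<not> Q a) \<Longrightarrow> restr Q f = 0"
  by (rule poly_mapping_eqI) (auto simp: lookup_restr in_keys_iff)

lemma restr_cong: "(\<And>a. a \<in> keys f \<Longrightarrow> Q a = Q' a) \<Longrightarrow> restr Q f = restr Q' f"
  by (rule poly_mapping_eqI) (auto simp: lookup_restr in_keys_iff)

lemma restr_polys [simp]: "f \<in> polys n \<Longrightarrow> restr Q f \<in> polys n"
  by (auto simp: polys_def keys_restr)

text \<open>If \<open>g\<close> is homogeneous for a grading, the degree of a product term depends
  only on the factor from \<open>f\<close>; so split \<open>f\<close> into its terms inside and
  outside \<open>Q\<close>. The gradings by class, by degree and by integer shift all commute with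
  graded matrices through this lemma.\<close>

lemma restr_mult:
  assumes "\<And>a b. a \<in> keys f \<Longrightarrow> b \<in> keys g \<Longrightarrow> Q' (a + b) \<longleftrightarrow> Q a"
  shows "restr Q' (f * g) = restr Q f * g"
proof -
  let ?f1 = "restr Q f" and ?f2 = "restr (\<lambda>a. \<not> Q a) f"
  have "f = ?f1 + ?f2" by (rule poly_mapping_eqI) (simp add: lookup_restr lookup_add)
  then have "restr Q' (f * g) = restr Q' (?f1 * g) + restr Q' (?f2 * g)"
    by (metis distrib_right restr_add)
  also have "restr Q' (?f1 * g) = ?f1 * g"
    using assms by (intro restr_eq_self) (auto dest!: keys_mult_subset simp: keys_restr)
  also have "restr Q' (?f2 * g) = 0"
    using assms by (intro restr_eq_0) (auto dest!: keys_mult_subset simp: keys_restr)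
  finally show ?thesis by simp
qed

section \<open>Vectors and matrices of polynomials\<close>

type_synonym 'k vec = "nat \<Rightarrow> 'k mpoly"

definition vecs :: "nat \<Rightarrow> nat \<Rightarrow> 'k::field vec set" where
  "vecs n r = {v. (\<forall>l. v l \<in> polys n) \<and> (\<forall>l\<ge>r. v l = 0)}"

definition smul :: "'k::field mpoly \<Rightarrow> 'k vec \<Rightarrow> 'k vec" where
  "smul f v = (\<lambda>l. f * v l)"

definition unit_vec :: "nat \<Rightarrow> 'k::field vec" where
  "unit_vec l = (\<lambda>m. if m = l then 1 else 0)"

text \<open>Row \<open>A l\<close> of the matrix is the image of the \<open>l\<close>-th basis vector.\<close>

definition matapp :: "nat \<Rightarrow> (nat \<Rightarrow> 'k::field vec) \<Rightarrow> 'k vec \<Rightarrow> 'k vec" where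
  "matapp r A v = (\<lambda>m. \<Sum>l<r. v l * A l m)"

lemma smul_apply [simp]: "smul f v l = f * v l"
  by (simp add: smul_def)

lemma sum_vec_apply: "(sum f S :: 'a \<Rightarrow> 'b::comm_monoid_add) x = (\<Sum>i\<in>S. f i x)"
  by (induction S rule: infinite_finite_induct) auto

lemma vecsD: "v \<in> vecs n r \<Longrightarrow> v l \<in> polys n" "v \<in> vecs n r \<Longrightarrow> r \<le> l \<Longrightarrow> v l = 0"
  by (auto simp: vecs_def)

lemma vecs_keys: "v \<in> vecs n r \<Longrightarrow> a \<in> keys (v l) \<Longrightarrow> a \<in> monomials n \<and> l < r"
  by (metis vecsD polysD keys_zero empty_iff not_less)

lemma vecs_0 [simp]: "0 \<in> vecs n r"
  by (auto simp: vecs_def)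

lemma vecs_add [simp]: "u \<in> vecs n r \<Longrightarrow> v \<in> vecs n r \<Longrightarrow> u + v \<in> vecs n r"
  by (auto simp: vecs_def)

lemma vecs_diff [simp]: "u \<in> vecs n r \<Longrightarrow> v \<in> vecs n r \<Longrightarrow> u - v \<in> vecs n r"
  by (auto simp: vecs_def)

lemma vecs_smul [simp]: "f \<in> polys n \<Longrightarrow> v \<in> vecs n r \<Longrightarrow> smul f v \<in> vecs n r"
  by (auto simp: vecs_def)

lemma vecs_unit [simp]: "l < r \<Longrightarrow> unit_vec l \<in> vecs n r"
  by (auto simp: vecs_def unit_vec_def)

lemma matapp_vecs:
  assumes "\<And>l. l < r \<Longrightarrow> A l \<in> vecs n s" "v \<in> vecs n r"
  shows "matapp r A v \<in> vecs n s"
  using assms by (auto simp: vecs_def matapp_def intro!: polys_sum polys_mult sum.neutral)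

lemma matapp_add: "matapp r A (u + v) = matapp r A u + matapp r A v"
  by (auto simp: matapp_def fun_eq_iff distrib_right sum.distrib)

lemma matapp_diff: "matapp r A (u - v) = matapp r A u - matapp r A v"
  by (auto simp: matapp_def fun_eq_iff left_diff_distrib sum_subtractf)

lemma matapp_0 [simp]: "matapp r A 0 = 0"
  by (auto simp: matapp_def fun_eq_iff)

lemma matapp_smul: "matapp r A (smul f v) = smul f (matapp r A v)"
  by (auto simp: matapp_def fun_eq_iff sum_distrib_left mult.assoc)

lemma matapp_unit [simp]: "l < r \<Longrightarrow> matapp r A (unit_vec l) = A l"
  by (auto simp: matapp_def fun_eq_iff unit_vec_def if_distrib[of "\<lambda>x. x * _"] cong: if_cong)

lemma matapp_as_sum: "matapp r A v = (\<Sum>l<r. smul (v l) (A l))"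
  by (auto simp: matapp_def fun_eq_iff sum_vec_apply)

lemma matapp_matapp:
  "matapp r A (matapp s B v) = matapp s (\<lambda>l. matapp r A (B l)) v"
proof
  fix m
  have "matapp r A (matapp s B v) m = (\<Sum>l<r. \<Sum>p<s. v p * B p l * A l m)"
    by (simp add: matapp_def sum_distrib_right)
  also have "\<dots> = (\<Sum>p<s. \<Sum>l<r. v p * B p l * A l m)" by (rule sum.swap)
  also have "\<dots> = matapp s (\<lambda>l. matapp r A (B l)) v m"
    by (simp add: matapp_def sum_distrib_left mult.assoc)
  finally show "matapp r A (matapp s B v) m = matapp s (\<lambda>l. matapp r A (B l)) v m" .
qed

lemma matapp_mat_diff: "matapp r (\<lambda>l. A l - B l) v = matapp r A v - matapp r B v"
  by (auto simp: matapp_def fun_eq_iff right_diff_distrib sum_subtractf)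

lemma matapp_mat_add: "matapp r (\<lambda>l. A l + B l) v = matapp r A v + matapp r B v"
  by (auto simp: matapp_def fun_eq_iff distrib_left sum.distrib)

lemma matapp_id:
  assumes "v \<in> vecs n r" shows "matapp r unit_vec v = v"
proof
  fix m
  have "matapp r unit_vec v m = (\<Sum>l<r. if l = m then v m else 0)"
    unfolding matapp_def by (intro sum.cong) (auto simp: unit_vec_def)
  then show "matapp r unit_vec v m = v m" using assms by (auto simp: vecs_def)
qed

text \<open>The predicate also sees the position, because each basis vector carries its own
  shift.\<close>

definition vrestr :: "(mon \<Rightarrow> nat \<Rightarrow> bool) \<Rightarrow> 'k::field vec \<Rightarrow> 'k vec" where
  "vrestr Q v = (\<lambda>l. restr (\<lambda>a. Q a l) (v l))"

lemma vrestr_apply: "vrestr Q v l = restr (\<lambda>a. Q a l) (v l)"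
  by (simp add: vrestr_def)

lemma vrestr_vecs [simp]: "v \<in> vecs n r \<Longrightarrow> vrestr Q v \<in> vecs n r"
  by (auto simp: vecs_def vrestr_def)

lemma vrestr_0 [simp]: "vrestr Q 0 = 0"
  by (auto simp: vrestr_def fun_eq_iff)

lemma vrestr_add: "vrestr Q (u + v) = vrestr Q u + vrestr Q v"
  by (auto simp: vrestr_def fun_eq_iff restr_add)

lemma vrestr_diff: "vrestr Q (u - v) = vrestr Q u - vrestr Q v"
  by (auto simp: vrestr_def fun_eq_iff restr_diff)

lemma vrestr_eq_self: "(\<And>a l. a \<in> keys (v l) \<Longrightarrow> Q a l) \<Longrightarrow> vrestr Q v = v"
  by (auto simp: vrestr_def fun_eq_iff intro!: restr_eq_self)

lemma vrestr_eq_0: "(\<And>a l. a \<in> keys (v l) \<Longrightarrow> \<not> Q a l) \<Longrightarrow> vrestr Q v = 0"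
  by (auto simp: vrestr_def fun_eq_iff intro!: restr_eq_0)

lemma vrestr_matapp:
  assumes "\<And>l m a b. l < r \<Longrightarrow> a \<in> keys (v l) \<Longrightarrow> b \<in> keys (A l m) \<Longrightarrow> Q' (a + b) m \<longleftrightarrow> Q a l"
  shows "vrestr Q' (matapp r A v) = matapp r A (vrestr Q v)"
  using assms
  by (auto simp: vrestr_def matapp_def fun_eq_iff restr_sum intro!: sum.cong restr_mult)

lemma keys_matapp: "a \<in> keys (matapp r A v m) \<Longrightarrow>
   \<exists>l<r. \<exists>b\<in>keys (v l). \<exists>c\<in>keys (A l m). a = b + c"
  using keys_sum[of "\<lambda>l. v l * A l m" "{..<r}"]
  by (fastforce simp: matapp_def dest!: subsetD keys_mult_subset)

section \<open>Submodules of free modules\<close>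

definition vec_submodule :: "nat \<Rightarrow> 'k::field vec set \<Rightarrow> bool" where
  "vec_submodule n N \<longleftrightarrow> 0 \<in> N \<and> (\<forall>u\<in>N. \<forall>v\<in>N. u + v \<in> N) \<and> (\<forall>f\<in>polys n. \<forall>v\<in>N. smul f v \<in> N)"

lemma vec_submoduleD:
  assumes "vec_submodule n N"
  shows "0 \<in> N" "u \<in> N \<Longrightarrow> v \<in> N \<Longrightarrow> u + v \<in> N" "f \<in> polys n \<Longrightarrow> v \<in> N \<Longrightarrow> smul f v \<in> N"
  using assms by (auto simp: vec_submodule_def)

lemma vec_submodule_diff:
  assumes "vec_submodule n N" "u \<in> N" "v \<in> N"
  shows "u - v \<in> N"
proof -
  have "u - v = u + smul (- 1) v" by (auto simp: fun_eq_iff)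
  then show ?thesis using assms vec_submoduleD[OF assms(1)] polys_uminus polys_1 by metis
qed

lemma vec_submodule_sum:
  assumes "vec_submodule n N" "\<And>i. i \<in> S \<Longrightarrow> f i \<in> N"
  shows "sum f S \<in> N"
  using assms(2) by (induction S rule: infinite_finite_induct) (auto intro: vec_submoduleD[OF assms(1)])

lemma vec_submodule_matapp:
  assumes "vec_submodule n N" "\<And>l. l < r \<Longrightarrow> A l \<in> N" "v \<in> vecs n r"
  shows "matapp r A v \<in> N"
  unfolding matapp_as_sum using assms
  by (intro vec_submodule_sum) (auto intro: vec_submoduleD(3) vecsD)

lemma vec_submodule_image: "vec_submodule n (matapp r A ` vecs n r)"
  unfolding vec_submodule_def
  using matapp_add[of r A] matapp_smul[of r A] matapp_0[of r A]
  by (auto simp flip: matapp_add matapp_smul intro!: imageI intro: image_eqI[of _ _ 0])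

lemma vec_submodule_kernel: "vec_submodule n {v \<in> vecs n r. matapp r A v = 0}"
  by (auto simp: vec_submodule_def matapp_add matapp_smul fun_eq_iff)

text \<open>\<open>vec_submodule\<close> is closed under intersections, so \<open>hull\<close> forms
  the submodule generated by a set.\<close>

lemma vec_submodule_hull: "vec_submodule n ((vec_submodule n) hull X)"
  by (rule hull_in) (auto simp: vec_submodule_def)

text \<open>\<open>Q c a l\<close> says that the term \<open>x\<^sup>a e\<^sub>l\<close> has degree \<open>c\<close>.\<close>

lemma component_induct:
  assumes v: "v \<in> N" "v \<in> vecs n r" and sub: "vec_submodule n N"
    and closed: "\<And>c u. u \<in> N \<Longrightarrow> vrestr (Q c) u \<in> N"
    and ex: "\<And>a l. a \<in> monomials n \<Longrightarrow> l < r \<Longrightarrow> \<exists>c. Q c a l"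
    and 0: "P 0"
    and comp: "\<And>c u. u \<in> N \<Longrightarrow> u \<in> vecs n r \<Longrightarrow> P (vrestr (Q c) u)"
    and add: "\<And>u w. u \<in> N \<Longrightarrow> w \<in> N \<Longrightarrow> P u \<Longrightarrow> P w \<Longrightarrow> P (u + w)"
  shows "P v"
  using v
proof (induction "\<Sum>l<r. card (keys (v l))" arbitrary: v rule: less_induct)
  case less
  show ?case
  proof (cases "\<exists>a l. a \<in> keys (v l)")
    case False
    then have "v = 0" by (auto simp: fun_eq_iff simp flip: keys_eq_empty)
    then show ?thesis using 0 by simp
  next
    case True
    then obtain a l where al: "a \<in> keys (v l)" by blast
    then have l: "l < r" "a \<in> monomials n" using vecs_keys[OF less.prems(2)] by auto
    then obtain c where c: "Q c a l" using ex by blast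
    \<comment> \<open>Removing every term of the degree of one occurring term lowers the total
      number of terms.\<close>
    define w where "w = v - vrestr (Q c) v"
    have w: "w \<in> N" "w \<in> vecs n r"
      using less.prems closed vec_submodule_diff[OF sub] by (auto simp: w_def)
    have kw: "keys (w m) = {b \<in> keys (v m). \<not> Q c b m}" for m
      by (auto simp: w_def vrestr_def in_keys_iff lookup_minus lookup_restr split: if_splits)
    have "(\<Sum>l<r. card (keys (w l))) < (\<Sum>l<r. card (keys (v l)))"
    proof (rule sum_strict_mono_ex1)
      show "\<forall>m\<in>{..<r}. card (keys (w m)) \<le> card (keys (v m))"
        by (auto simp: kw intro: card_mono)
      show "\<exists>m\<in>{..<r}. card (keys (w m)) < card (keys (v m))"
        using al c l by (intro bexI[of _ l] psubset_card_mono) (auto simp: kw)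
    qed simp
    then have "P w" using less.hyps w by blast
    then have "P (vrestr (Q c) v + w)"
      using less.prems comp closed w by (intro add) auto
    then show ?thesis by (simp add: w_def)
  qed
qed

section \<open>Dickson's lemma\<close>

lemma nat_seq_mono_subseq:
  fixes f :: "nat \<Rightarrow> nat"
  shows "\<exists>g :: nat \<Rightarrow> nat. strict_mono g \<and> mono (\<lambda>t. f (g t))"
proof -
  obtain g :: "nat \<Rightarrow> nat" where g: "strict_mono g" "monoseq (\<lambda>t. f (g t))"
    using seq_monosub[of f] by blast
  show ?thesis
  proof (cases "mono (\<lambda>t. f (g t))")
    case True
    then show ?thesis using g by blast
  next
    case False
    then have dec: "antimono (\<lambda>t. f (g t))"
      using g(2) by (auto simp: monoseq_iff)
    \<comment> \<open>A nonincreasing sequence of naturals is constant from the place on where it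
      attains its minimum.\<close>
    define m where "m = (LEAST x. x \<in> range (\<lambda>t. f (g t)))"
    have "m \<in> range (\<lambda>t. f (g t))" unfolding m_def by (rule LeastI) (rule rangeI)
    then obtain t0 where t0: "m = f (g t0)" by blast
    have "f (g (t0 + t)) = m" for t
    proof (rule antisym)
      show "f (g (t0 + t)) \<le> m" using antimonoD[OF dec, of t0 "t0 + t"] t0 by simp
      show "m \<le> f (g (t0 + t))" unfolding m_def by (rule Least_le) (rule rangeI)
    qed
    moreover have "strict_mono (\<lambda>t. g (t0 + t))"
      using g(1) by (auto simp: strict_mono_def)
    ultimately show ?thesis by (intro exI[of _ "\<lambda>t. g (t0 + t)"]) (auto simp: mono_def)
  qed
qed

text \<open>Passing to a subsequence once per variable makes all \<open>n\<close> exponents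
  nondecreasing; then the first member of the subsequence divides the second.\<close>

lemma dickson_sequence:
  assumes "\<And>i::nat. f i \<in> monomials n"
  shows "\<exists>i j. i < j \<and> (\<exists>d\<in>monomials n. f j = d + f i)"
proof -
  have "\<exists>g. strict_mono g \<and> (\<forall>i<k. mono (\<lambda>t::nat. lookup (f (g t)) i))" for k
  proof (induction k)
    case 0
    show ?case by (auto intro!: exI[of _ "\<lambda>t. t"] simp: strict_mono_def)
  next
    case (Suc k)
    then obtain g where g: "strict_mono g" "\<forall>i<k. mono (\<lambda>t::nat. lookup (f (g t)) i)" by blast
    obtain h :: "nat \<Rightarrow> nat" where h: "strict_mono h" "mono (\<lambda>t. lookup (f (g (h t))) k)"
      using nat_seq_mono_subseq[of "\<lambda>t. lookup (f (g t)) k"] by blast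
    have "mono (\<lambda>t. lookup (f (g (h t))) i)" if "i < k" for i
      using g(2) that strict_mono_mono[OF h(1)] by (auto simp: mono_def)
    then show ?case using g(1) h
      by (intro exI[of _ "\<lambda>t. g (h t)"]) (auto simp: less_Suc_eq strict_mono_def)
  qed
  then obtain g where g: "strict_mono g" "\<forall>i<n. mono (\<lambda>t::nat. lookup (f (g t)) i)" by blast
  define d where "d = f (g 1) - f (g 0)"
  have le: "lookup (f (g 0)) i \<le> lookup (f (g 1)) i" for i
  proof (cases "i < n")
    case True then show ?thesis using g(2) by (auto simp: mono_def)
  next
    case False then have "lookup (f (g 0)) i = 0"
      using assms[of "g 0"] by (auto simp: monomials_def in_keys_iff)
    then show ?thesis by simp
  qed
  have eq: "f (g 1) = d + f (g 0)"
    using le by (intro poly_mapping_eqI) (simp add: d_def lookup_add lookup_minus)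
  then have "d \<in> monomials n" using assms[of "g 1"] by simp
  then show ?thesis using eq g(1) by (intro exI[of _ "g 0"] exI[of _ "g 1"]) (auto simp: strict_mono_def)
qed

text \<open>\<open>D\<close> consists of the members of \<open>S\<close> that are minimal under
  divisibility. Every member lies above one of them by induction on the degree, and an infinite
  \<open>D\<close> would contain a sequence contradicting \<open>dickson_sequence\<close>.\<close>

lemma dickson:
  assumes S: "S \<subseteq> monomials n"
  shows "\<exists>D\<subseteq>S. finite D \<and> (\<forall>a\<in>S. \<exists>b\<in>D. \<exists>d\<in>monomials n. a = d + b)"
proof -
  define D where "D = {a \<in> S. \<forall>b\<in>S. (\<exists>d\<in>monomials n. a = d + b) \<longrightarrow> b = a}"
  have ex: "\<exists>b\<in>D. \<exists>d\<in>monomials n. a = d + b" if "a \<in> S" for a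
    using that
  proof (induction "mon_deg a" arbitrary: a rule: less_induct)
    case less
    show ?case
    proof (cases "a \<in> D")
      case True
      then show ?thesis by (intro bexI[of _ a] bexI[of _ 0]) auto
    next
      case False
      then obtain b d where b: "b \<in> S" "d \<in> monomials n" "a = d + b" "b \<noteq> a"
        using less.prems by (auto simp: D_def)
      then have "mon_deg d \<noteq> 0" by (metis add_0 mon_deg_eq_0)
      then have "mon_deg b < mon_deg a" unfolding b(3) mon_deg_add by linarith
      then obtain e d' where "e \<in> D" "d' \<in> monomials n" "b = d' + e"
        using less.hyps b by blast
      then show ?thesis using b by (intro bexI[of _ e] bexI[of _ "d + d'"]) (auto simp: add.assoc)
    qed
  qed
  have "finite D"
  proof (rule ccontr)
    assume "infinite D"
    then obtain f :: "nat \<Rightarrow> mon" where f: "inj f" "range f \<subseteq> D"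
      using infinite_countable_subset by blast
    then have fD: "f i \<in> D" for i by blast
    then have "f i \<in> monomials n" for i using S by (auto simp: D_def)
    then obtain i j where ij: "i < j" "\<exists>d\<in>monomials n. f j = d + f i"
      using dickson_sequence by blast
    then have "f i = f j" using fD[of j] fD[of i] unfolding D_def by blast
    then show False using f(1) ij(1) by (auto dest: injD)
  qed
  then show ?thesis using ex by (intro exI[of _ D]) (auto simp: D_def)
qed

section \<open>The grading given by a monomial preorder\<close>

locale graded_preorder =
  fixes n :: nat and lt :: "mon \<Rightarrow> mon \<Rightarrow> bool"
  assumes preorder: "monomial_preorder n lt"
begin

text \<open>Monomials of different degree are related by neither \<open>low\<close> nor
  \<open>eqv\<close>. The classes of \<open>eqv\<close> are the degrees of the finer grading, and
  \<open>low\<close> is well-founded even when \<open>lt\<close> is not.\<close>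

definition low :: "mon \<Rightarrow> mon \<Rightarrow> bool" where
  "low a c \<longleftrightarrow> a \<in> monomials n \<and> c \<in> monomials n \<and> mon_deg a = mon_deg c \<and> lt a c"

definition eqv :: "mon \<Rightarrow> mon \<Rightarrow> bool" where
  "eqv a c \<longleftrightarrow> a \<in> monomials n \<and> c \<in> monomials n \<and> mon_deg a = mon_deg c \<and> \<not> lt a c \<and> \<not> lt c a"

section \<open>Order laws for \<open>low\<close> and \<open>eqv\<close>\<close>

lemma weak: "weak_order_on (monomials n) lt"
  using preorder by (simp add: monomial_preorder_def)

lemma lt_irrefl: "a \<in> monomials n \<Longrightarrow> \<not> lt a a"
  using weak by (auto simp: weak_order_on_def irreflp_on_def)

lemma lt_trans: "a \<in> monomials n \<Longrightarrow> b \<in> monomials n \<Longrightarrow> c \<in> monomials n \<Longrightarrow> lt a b \<Longrightarrow> lt b c \<Longrightarrow> lt a c"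
  using weak unfolding weak_order_on_def transp_on_def by blast

lemma lt_add: "a \<in> monomials n \<Longrightarrow> b \<in> monomials n \<Longrightarrow> c \<in> monomials n \<Longrightarrow> lt (a + c) (b + c) \<longleftrightarrow> lt a b"
  using preorder unfolding monomial_preorder_def by blast

lemma eqv_refl: "a \<in> monomials n \<Longrightarrow> eqv a a"
  by (auto simp: eqv_def lt_irrefl)

lemma eqv_sym: "eqv a b \<Longrightarrow> eqv b a"
  by (auto simp: eqv_def)

lemma eqv_trans: "eqv a b \<Longrightarrow> eqv b c \<Longrightarrow> eqv a c"
proof -
  assume *: "eqv a b" "eqv b c"
  have "trans {(a, b). a \<in> monomials n \<and> b \<in> monomials n \<and> \<not> lt a b \<and> \<not> lt b a}"
    using weak by (auto simp: weak_order_on_def equiv_def)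
  then have "(a, c) \<in> {(a, b). a \<in> monomials n \<and> b \<in> monomials n \<and> \<not> lt a b \<and> \<not> lt b a}"
    by (rule transD[where y = b]) (use * in \<open>auto simp: eqv_def\<close>)
  then show ?thesis using * by (auto simp: eqv_def)
qed

lemma low_trans: "low a b \<Longrightarrow> low b c \<Longrightarrow> low a c"
  using lt_trans by (auto simp: low_def)

lemma low_irrefl: "\<not> low a a"
  using lt_irrefl by (auto simp: low_def)

lemma low_not_eqv: "low a b \<Longrightarrow> \<not> eqv a b"
  by (auto simp: low_def eqv_def)

lemma low_cases: "a \<in> monomials n \<Longrightarrow> b \<in> monomials n \<Longrightarrow> mon_deg a = mon_deg b \<Longrightarrow>
   low a b \<or> eqv a b \<or> low b a"
  by (auto simp: low_def eqv_def)

text \<open>The other two cases of \<open>low_cases\<close> would give \<open>eqv a b\<close> or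
  \<open>low c b\<close>, which the assumptions exclude. Transitivity of incomparability enters
  here.\<close>

lemma low_eqv_trans: "low a b \<Longrightarrow> eqv b c \<Longrightarrow> low a c"
proof -
  assume *: "low a b" "eqv b c"
  then have "low a c \<or> eqv a c \<or> low c a" by (intro low_cases) (auto simp: low_def eqv_def)
  then show ?thesis using * low_trans low_not_eqv eqv_trans eqv_sym
    by (metis low_irrefl)
qed

lemma eqv_low_trans: "eqv a b \<Longrightarrow> low b c \<Longrightarrow> low a c"
proof -
  assume *: "eqv a b" "low b c"
  then have "low a c \<or> eqv a c \<or> low c a" by (intro low_cases) (auto simp: low_def eqv_def)
  then show ?thesis using * low_trans low_not_eqv eqv_trans eqv_sym low_eqv_trans
    by (metis low_irrefl)
qed

lemma eqv_monomials: "eqv a c \<Longrightarrow> a \<in> monomials n \<and> c \<in> monomials n"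
  by (simp add: eqv_def)

text \<open>The equivalence in \<open>monomial_preorder\<close> lets classes be translated and
  cancelled: \<open>k[X]\<close> is graded by the classes of \<open>eqv\<close>.\<close>

lemma eqv_add: "d \<in> monomials n \<Longrightarrow> eqv (d + a) (d + c) \<longleftrightarrow> eqv a c"
  by (auto simp: eqv_def mon_deg_add add.commute[of d] lt_add)

lemma low_add: "d \<in> monomials n \<Longrightarrow> low (d + a) (d + c) \<longleftrightarrow> low a c"
  by (auto simp: low_def mon_deg_add add.commute[of d] lt_add)

lemma eqv_cong: "eqv a b \<Longrightarrow> eqv a c \<longleftrightarrow> eqv b c"
  using eqv_trans eqv_sym by blast

text \<open>The entries of \<open>bs\<close> are the degrees of the basis vectors, the fine analogue
  of integer shifts. The degree \<open>c\<close> is itself a monomial standing for its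
  class.\<close>

definition tdeg :: "mon list \<Rightarrow> mon \<Rightarrow> mon \<Rightarrow> nat \<Rightarrow> bool" where
  "tdeg bs c a l \<longleftrightarrow> eqv (a + bs ! l) c"

definition homog :: "mon list \<Rightarrow> mon \<Rightarrow> 'k::field vec \<Rightarrow> bool" where
  "homog bs c v \<longleftrightarrow> (\<forall>l a. a \<in> keys (v l) \<longrightarrow> tdeg bs c a l)"

text \<open>The shifts of the target come first. Row \<open>l\<close> has the class of the
  \<open>l\<close>-th basis vector of the source, so the map preserves the fine grading.\<close>

definition gmat :: "mon list \<Rightarrow> mon list \<Rightarrow> (nat \<Rightarrow> 'k::field vec) \<Rightarrow> bool" where
  "gmat bs bs' A \<longleftrightarrow>
     (\<forall>l<length bs'. A l \<in> vecs n (length bs) \<and> homog bs (bs' ! l) (A l))"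

lemma homogD: "homog bs c v \<Longrightarrow> a \<in> keys (v l) \<Longrightarrow> eqv (a + bs ! l) c"
  by (auto simp: homog_def tdeg_def)

lemma homog_vrestr: "homog bs c (vrestr (tdeg bs c) v)"
  by (auto simp: homog_def vrestr_def keys_restr)

lemma vrestr_homog: "homog bs c v \<Longrightarrow> vrestr (tdeg bs c) v = v"
  by (rule vrestr_eq_self) (auto simp: homog_def)

lemma vrestr_gmat:
  assumes "gmat bs bs' A" "v \<in> vecs n (length bs')"
  shows "vrestr (tdeg bs c) (matapp (length bs') A v) =
         matapp (length bs') A (vrestr (tdeg bs' c) v)"
proof (rule vrestr_matapp)
  fix l m a b
  assume l: "l < length bs'" and a: "a \<in> keys (v l)" and b: "b \<in> keys (A l m)"
  have "eqv (b + bs ! m) (bs' ! l)" using assms(1) l b by (auto simp: gmat_def dest: homogD)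
  moreover have "a \<in> monomials n" using vecs_keys[OF assms(2) a] by simp
  ultimately have "eqv (a + (b + bs ! m)) (a + bs' ! l)" by (simp add: eqv_add)
  then show "tdeg bs c (a + b) m \<longleftrightarrow> tdeg bs' c a l"
    by (simp add: tdeg_def add.assoc eqv_cong)
qed

lemma gmat_matapp_vecs:
  "gmat bs bs' A \<Longrightarrow> v \<in> vecs n (length bs') \<Longrightarrow> matapp (length bs') A v \<in> vecs n (length bs)"
  by (rule matapp_vecs) (auto simp: gmat_def)

section \<open>Finite homogeneous generating sets, by reduction of leading terms\<close>

definition supp :: "'k::field vec \<Rightarrow> (nat \<times> mon) set" where
  "supp v = {(l, a). a \<in> keys (v l)}"

lemma in_supp [simp]: "(l, a) \<in> supp v \<longleftrightarrow> a \<in> keys (v l)"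
  by (simp add: supp_def)

lemma finite_supp: assumes "v \<in> vecs n r" shows "finite (supp v)"
proof (rule finite_subset)
  show "supp v \<subseteq> (SIGMA l:{..<r}. keys (v l))"
    using vecs_keys[OF assms] by (auto simp: supp_def)
qed auto

lemma supp_nonempty: "v \<noteq> 0 \<Longrightarrow> supp v \<noteq> {}"
  by (auto simp: supp_def fun_eq_iff simp flip: keys_eq_empty)

text \<open>Terms are compared by position first and then by the lexicographic order on
  exponent vectors that the library provides; inside one degree only finitely many terms exist,
  so this order need not be well-founded on all terms.\<close>

lemma homogeneous_noetherian:
  fixes N :: "'k::field vec set"
  assumes N: "N \<subseteq> vecs n (length bs)" "vec_submodule n N"
    and closed: "\<And>c v. v \<in> N \<Longrightarrow> vrestr (tdeg bs c) v \<in> N"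
    and bs: "set bs \<subseteq> monomials n"
  shows "\<exists>X\<subseteq>N. finite X \<and> (\<forall>x\<in>X. \<exists>c\<in>monomials n. homog bs c x) \<and> (vec_submodule n) hull X = N"
proof -
  define r where "r = length bs"
  define H where "H = {u \<in> N. u \<noteq> 0 \<and> (\<exists>c\<in>monomials n. homog bs c u)}"
  \<comment> \<open>The leading exponents at position \<open>l\<close>. As for Groebner bases,
    homogeneous elements whose leading exponents divide all others will generate.\<close>
  define S where "S l = {a. \<exists>u\<in>H. Max (supp u) = (l, a)}" for l
  have HN: "u \<in> vecs n r" if "u \<in> H" for u using that N by (auto simp: H_def r_def)
  have Max_in: "Max (supp u) \<in> supp u" if "u \<in> vecs n r" "u \<noteq> 0" for u :: "'k vec"
    using that finite_supp supp_nonempty by (intro Max_in) auto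
  have "S l \<subseteq> monomials n" for l
    unfolding S_def using Max_in HN vecs_keys by (fastforce simp: H_def)
  then have "\<exists>D\<subseteq>S l. finite D \<and> (\<forall>a\<in>S l. \<exists>b\<in>D. \<exists>d\<in>monomials n. a = d + b)" for l
    by (rule dickson)
  then obtain D where D: "\<And>l. D l \<subseteq> S l" "\<And>l. finite (D l)"
      "\<And>l a. a \<in> S l \<Longrightarrow> \<exists>b\<in>D l. \<exists>d\<in>monomials n. a = d + b" by metis
  have "\<forall>l. \<forall>b\<in>D l. \<exists>u\<in>H. Max (supp u) = (l, b)" using D(1) by (fastforce simp: S_def)
  then obtain g where g: "\<And>l b. b \<in> D l \<Longrightarrow> g l b \<in> H"
     "\<And>l b. b \<in> D l \<Longrightarrow> Max (supp (g l b)) = (l, b)" by metis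
  define X where "X = (\<Union>l<r. g l ` D l)"
  have XH: "X \<subseteq> H" using g(1) by (auto simp: X_def)
  have fin: "finite X" using D(2) by (auto simp: X_def)
  let ?S = "(vec_submodule n) hull X"
  have sub: "vec_submodule n ?S" by (rule vec_submodule_hull)
  have hom_in: "u \<in> ?S" if "u \<in> N" "c \<in> monomials n" "homog bs c u" for u c
  proof -
    \<comment> \<open>A finite set containing all terms of every vector of class \<open>c\<close> in
      \<open>N\<close>; reduction will shrink the part of it up to the leading term.\<close>
    define T where "T = {..<r} \<times> {a \<in> monomials n. mon_deg a \<le> mon_deg c}"
    have T: "finite T" unfolding T_def using finite_monomials_of_degree by blast
    have supT: "supp u \<subseteq> T" if "u \<in> N" "homog bs c u" for u
    proof
      fix t assume "t \<in> supp u"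
      then obtain l a where t: "t = (l, a)" "a \<in> keys (u l)" by (cases t) auto
      have "l < r \<and> a \<in> monomials n" using vecs_keys t(2) that(1) N(1) r_def by blast
      moreover have "mon_deg a \<le> mon_deg c"
        using homogD[OF that(2) t(2)] by (auto simp: eqv_def mon_deg_add)
      ultimately show "t \<in> T" using t by (auto simp: T_def)
    qed
    show ?thesis using that
    \<comment> \<open>\<open>Max\<close> of the empty support is unspecified, hence the separate
      value 0. For nonzero \<open>u\<close> the count is positive, since it includes the leading
      term.\<close>
    proof (induction "if u = 0 then 0 else card {t \<in> T. t \<le> Max (supp u)}" arbitrary: u
        rule: less_induct)
      case less
      show ?case
      proof (cases "u = 0")
        case True then show ?thesis using vec_submoduleD(1)[OF sub] by simp
      next
        case False
        have uv: "u \<in> vecs n r" using less.prems N by (auto simp: r_def)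
        obtain l a where la: "Max (supp u) = (l, a)" by fastforce
        have in_u: "a \<in> keys (u l)" using Max_in[OF uv False] by (simp add: la)
        have lr: "l < r" using vecs_keys[OF uv in_u] by simp
        have "u \<in> H" using less.prems False by (auto simp: H_def)
        then have "a \<in> S l" using la by (auto simp: S_def)
        then obtain b d where bd: "b \<in> D l" "d \<in> monomials n" "a = d + b" using D(3) by blast
        define x where "x = g l b"
        have x: "x \<in> H" "Max (supp x) = (l, b)" "x \<in> X"
          using g bd lr by (auto simp: x_def X_def)
        have x0: "x \<noteq> 0" and xN: "x \<in> N" and xv: "x \<in> vecs n r" using x(1) HN by (auto simp: H_def)
        obtain c' where c': "homog bs c' x" using x by (auto simp: H_def)
        have in_x: "b \<in> keys (x l)" using Max_in[OF xv x0] by (simp add: x(2))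
        \<comment> \<open>The multiple of the generator by the monomial \<open>d\<close> has the
          class of \<open>u\<close>, so reduction does not leave the class.\<close>
        have cls: "eqv (d + c') c"
        proof -
          have "eqv (b + bs ! l) c'" using homogD[OF c' in_x] .
          then have "eqv (d + (b + bs ! l)) (d + c')" using bd by (simp add: eqv_add)
          moreover have "eqv (d + (b + bs ! l)) c" using homogD[OF less.prems(3) in_u] bd
            by (simp add: add.assoc)
          ultimately show ?thesis using eqv_cong by blast
        qed
        \<comment> \<open>The quotient of the leading coefficients makes the leading terms of
          \<open>u\<close> and \<open>y\<close> cancel.\<close>
        define k where "k = lookup (u l) a / lookup (x l) b"
        define y where "y = smul (single d k) x"
        define w where "w = u - y"
        have y_look: "lookup (y m) (d + e) = k * lookup (x m) e" for m e
          by (simp add: y_def lookup_single_mult)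
        have y_keys: "\<exists>e\<in>keys (x m). e' = d + e" if "e' \<in> keys (y m)" for e' m
          using that keys_mult_subset[of e' "single d k" "x m"]
          by (auto simp: y_def split: if_splits)
        have yS: "y \<in> ?S"
          unfolding y_def using x(3) bd by (intro vec_submoduleD(3)[OF sub] hull_inc) auto
        have yN: "y \<in> N" using xN bd by (auto simp: y_def intro!: vec_submoduleD(3)[OF N(2)])
        have wN: "w \<in> N" using less.prems(1) yN vec_submodule_diff[OF N(2)] by (simp add: w_def)
        have wv: "w \<in> vecs n r" using wN N by (auto simp: r_def)
        have wk: "e \<in> keys (u m) \<or> e \<in> keys (y m)" if "e \<in> keys (w m)" for e m
          using that keys_minus_subset[of "u m" "y m"] by (auto simp: w_def)
        have wh: "homog bs c w"
          unfolding homog_def tdeg_def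
        proof (intro allI impI)
          fix m e assume "e \<in> keys (w m)"
          then consider "e \<in> keys (u m)" | "e \<in> keys (y m)" using wk by blast
          then show "eqv (e + bs ! m) c"
          proof cases
            case 1 then show ?thesis using less.prems(3) homogD by blast
          next
            case 2
            then obtain e' where e': "e' \<in> keys (x m)" "e = d + e'" using y_keys by blast
            then have "eqv (d + (e' + bs ! m)) (d + c')"
              using homogD[OF c'] bd(2) by (simp add: eqv_add)
            then show ?thesis using cls eqv_trans e' by (auto simp: add.assoc)
          qed
        qed
        have w_less: "Max (supp w) < (l, a)" if "w \<noteq> 0"
        proof -
          obtain m e where me: "Max (supp w) = (m, e)" by fastforce
          have e: "e \<in> keys (w m)" using Max_in[OF wv that] by (simp add: me)
          have "(m, e) \<le> (l, a)"
          proof -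
            consider "e \<in> keys (u m)" | "e \<in> keys (y m)" using wk e by blast
            then show ?thesis
            proof cases
              case 1
              then show ?thesis using Max_ge[OF finite_supp[OF uv], of "(m, e)"]
                by (simp add: la)
            next
              case 2
              then obtain e' where e': "e' \<in> keys (x m)" "e = d + e'" using y_keys by blast
              then have "(m, e') \<le> (l, b)" using Max_ge[OF finite_supp[OF xv], of "(m, e')"] x(2)
                by simp
              then show ?thesis using e' bd by (auto simp: add_left_mono)
            qed
          qed
          moreover have "lookup (w l) a = 0"
            using in_x y_look[of l b] bd by (simp add: w_def lookup_minus k_def in_keys_iff)
          then have "(m, e) \<noteq> (l, a)" using e by (auto simp: in_keys_iff)
          ultimately show ?thesis unfolding me by (rule le_neq_trans)
        qed
        have "w \<in> ?S"
        proof (rule less.hyps[OF _ wN less.prems(2) wh])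
          have laT: "(l, a) \<in> T" using supT[OF less.prems(1,3)] in_u by auto
          have "card {t \<in> T. t \<le> Max (supp w)} < card {t \<in> T. t \<le> (l, a)}" if "w \<noteq> 0"
          proof (rule psubset_card_mono)
            have "{t \<in> T. t \<le> Max (supp w)} \<subseteq> {t \<in> T. t \<le> (l, a)}"
              using less_imp_le[OF w_less[OF that]] order_trans by blast
            moreover have "(l, a) \<notin> {t \<in> T. t \<le> Max (supp w)}"
              using w_less[OF that] leD by blast
            ultimately show "{t \<in> T. t \<le> Max (supp w)} \<subset> {t \<in> T. t \<le> (l, a)}"
              using laT by blast
          qed (use T in auto)
          moreover have "card {t \<in> T. t \<le> (l, a)} > 0"
            using laT T by (auto simp: card_gt_0_iff)
          ultimately show "(if w = 0 then 0 else card {t \<in> T. t \<le> Max (supp w)})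
             < (if u = 0 then 0 else card {t \<in> T. t \<le> Max (supp u)})"
            using False la by simp
        qed
        then have "w + y \<in> ?S" using yS vec_submoduleD(2)[OF sub] by blast
        then show ?thesis by (simp add: w_def)
      qed
    qed
  qed
  have "N \<subseteq> ?S"
  proof
    fix v assume v: "v \<in> N"
    then show "v \<in> ?S"
    proof (rule component_induct[where Q = "tdeg bs" and P = "\<lambda>v. v \<in> ?S"])
      show "v \<in> vecs n (length bs)" using v N by blast
      show "\<exists>c. tdeg bs c a l" if "a \<in> monomials n" "l < length bs" for a l
        using that bs by (intro exI[of _ "a + bs ! l"]) (auto simp: tdeg_def subset_iff intro!: eqv_refl)
      show "vrestr (tdeg bs c) u \<in> ?S" if "u \<in> N" for c u
      proof (cases "vrestr (tdeg bs c) u = 0")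
        case True then show ?thesis using vec_submoduleD(1)[OF sub] by simp
      next
        case False
        then obtain l a where "a \<in> keys (vrestr (tdeg bs c) u l)"
          by (auto simp: fun_eq_iff simp flip: keys_eq_empty)
        then have "c \<in> monomials n" using homog_vrestr homogD eqv_monomials by blast
        then show ?thesis using hom_in closed that homog_vrestr by blast
      qed
    qed (use N closed vec_submoduleD[OF sub] in auto)
  qed
  moreover have "?S \<subseteq> N" using XH N by (intro hull_minimal) (auto simp: H_def)
  ultimately show ?thesis using XH fin by (intro exI[of _ X]) (auto simp: H_def)
qed

text \<open>Take a homogeneous generating set of least cardinality. A relation with a nonzero
  constant entry would express one generator by the others. The last conclusion, no constants in
  relations, is what makes the resolution minimal one step later.\<close>

lemma minimal_presentation:
  fixes N :: "'k::field vec set"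
  assumes N: "N \<subseteq> vecs n (length bs)" "vec_submodule n N"
    and closed: "\<And>c v. v \<in> N \<Longrightarrow> vrestr (tdeg bs c) v \<in> N"
    and bs: "set bs \<subseteq> monomials n"
  shows "\<exists>bs' A. set bs' \<subseteq> monomials n \<and> gmat bs bs' A \<and>
     N = matapp (length bs') A ` vecs n (length bs') \<and>
     (\<forall>v\<in>vecs n (length bs'). matapp (length bs') A v = 0 \<longrightarrow> (\<forall>l. lookup (v l) 0 = 0))"
proof -
  let ?gens = "\<lambda>X. X \<subseteq> N \<and> finite X \<and> (\<forall>x\<in>X. \<exists>c\<in>monomials n. homog bs c x) \<and>
     (vec_submodule n) hull X = N"
  define s where "s = (LEAST s. \<exists>X. ?gens X \<and> card X = s)"
  have "\<exists>s X. ?gens X \<and> card X = s" using homogeneous_noetherian[OF assms] by blast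
  then have "\<exists>X. ?gens X \<and> card X = s" unfolding s_def by (rule LeastI_ex)
  then obtain X where X: "?gens X" "card X = s" by blast
  have least: "s \<le> card Y" if "?gens Y" for Y
    unfolding s_def using that by (intro Least_le) blast
  obtain xs where xs: "set xs = X" "distinct xs" using finite_distinct_list[of X] X(1) by blast
  obtain cl where cl: "\<And>x. x \<in> X \<Longrightarrow> cl x \<in> monomials n \<and> homog bs (cl x) x"
    using X(1) by metis
  define bs' where "bs' = map cl xs"
  define A where "A l = xs ! l" for l
  let ?r = "length bs'"
  have len: "?r = length xs" by (simp add: bs'_def)
  have AX: "A l \<in> X" if "l < ?r" for l using that xs by (auto simp: A_def len)
  have bs': "set bs' \<subseteq> monomials n" using cl xs by (auto simp: bs'_def)
  have gm: "gmat bs bs' A"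
    unfolding gmat_def
  proof (intro allI impI conjI)
    fix l assume l: "l < ?r"
    show "A l \<in> vecs n (length bs)" using AX[OF l] X(1) N(1) by blast
    have "bs' ! l = cl (A l)" using l by (simp add: bs'_def A_def)
    then show "homog bs (bs' ! l) (A l)" using cl[OF AX[OF l]] by simp
  qed
  have img: "N = matapp ?r A ` vecs n ?r"
  proof
    have "X \<subseteq> matapp ?r A ` vecs n ?r"
    proof
      fix x assume "x \<in> X"
      then obtain l where "l < ?r" "x = A l" using xs by (auto simp: A_def len in_set_conv_nth)
      then show "x \<in> matapp ?r A ` vecs n ?r" by (intro image_eqI[of _ _ "unit_vec l"]) auto
    qed
    then have "(vec_submodule n) hull X \<subseteq> matapp ?r A ` vecs n ?r"
      using vec_submodule_image by (rule hull_minimal)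
    then show "N \<subseteq> matapp ?r A ` vecs n ?r" using X(1) by simp
    show "matapp ?r A ` vecs n ?r \<subseteq> N"
      using vec_submodule_matapp[OF N(2)] AX X(1) by blast
  qed
  have "lookup (v l) 0 = 0" if v: "v \<in> vecs n ?r" "matapp ?r A v = 0" for v l
  proof (rule ccontr)
    assume nz: "lookup (v l) 0 \<noteq> 0"
    then have "0 \<in> keys (v l)" by (simp add: in_keys_iff)
    then have l: "l < ?r" using vecs_keys v by blast
    \<comment> \<open>In the component of the relation of class \<open>c\<close> the entry at
      \<open>l\<close> is the constant \<open>k\<close>: only \<open>a = 0\<close> satisfies
      \<open>eqv (a + c) c\<close>, by degree. A constant can be inverted, an arbitrary entry with
      nonzero constant term cannot.\<close>
    define c where "c = bs' ! l"
    have c: "c \<in> monomials n" using l bs' by (auto simp: c_def)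
    define v' where "v' = vrestr (tdeg bs' c) v"
    have v': "v' \<in> vecs n ?r" using v by (simp add: v'_def)
    have ker: "matapp ?r A v' = 0" using vrestr_gmat[OF gm v(1), of c] v(2) by (simp add: v'_def)
    define k where "k = lookup (v l) 0"
    have "v' l = single 0 k"
    proof (rule poly_mapping_eqI)
      fix a
      have "a = 0" if "eqv (a + c) c" using that by (auto simp: eqv_def mon_deg_add)
      then show "lookup (v' l) a = lookup (single 0 k) a"
        using eqv_refl[OF c]
        by (auto simp: v'_def vrestr_def lookup_restr tdeg_def lookup_single when_def k_def
            simp flip: c_def)
    qed
    then have "0 = smul (single 0 k) (A l) + (\<Sum>m\<in>{..<?r} - {l}. smul (v' m) (A m))"
      using ker l by (simp add: matapp_as_sum sum.remove[of "{..<?r}" l])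
    then have eq: "smul (single 0 k) (A l) = - (\<Sum>m\<in>{..<?r} - {l}. smul (v' m) (A m))"
      by (simp add: eq_neg_iff_add_eq_0)
    let ?Y = "X - {A l}"
    let ?S = "(vec_submodule n) hull ?Y"
    have "(\<Sum>m\<in>{..<?r} - {l}. smul (v' m) (A m)) \<in> ?S"
    proof (rule vec_submodule_sum[OF vec_submodule_hull])
      fix m assume m: "m \<in> {..<?r} - {l}"
      then have "A m \<in> ?Y" using AX xs(2) l by (auto simp: A_def len nth_eq_iff_index_eq)
      then show "smul (v' m) (A m) \<in> ?S"
        using v' by (intro vec_submoduleD(3)[OF vec_submodule_hull] hull_inc) (auto dest: vecsD)
    qed
    then have "smul (single 0 (- 1 / k)) (\<Sum>m\<in>{..<?r} - {l}. smul (v' m) (A m)) \<in> ?S"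
      by (intro vec_submoduleD(3)[OF vec_submodule_hull]) auto
    also have "smul (single 0 (- 1 / k)) (\<Sum>m\<in>{..<?r} - {l}. smul (v' m) (A m)) =
        smul (single 0 (1 / k)) (smul (single 0 k) (A l))"
      unfolding eq by (auto simp: fun_eq_iff single_uminus)
    also have "\<dots> = A l"
      using nz by (auto simp: fun_eq_iff k_def mult_single simp flip: mult.assoc)
    finally have "X \<subseteq> ?S" using hull_subset[of ?Y "vec_submodule n"] by blast
    then have "N \<subseteq> ?S" using X(1) hull_minimal[of X ?S "vec_submodule n"] vec_submodule_hull[of n ?Y] by blast
    moreover have "?S \<subseteq> N" using X(1) hull_mono[of ?Y X "vec_submodule n"] by blast
    ultimately have "?gens ?Y" using X(1) by blast
    then have "s \<le> card ?Y" by (rule least)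
    moreover have "card ?Y < card X" using X(1) AX[OF l] by (intro psubset_card_mono) auto
    ultimately show False using X(2) by simp
  qed
  then show ?thesis using bs' gm img by blast
qed

text \<open>\<open>minimal_presentation\<close> is iterated on kernels. The rows of
  \<open>A (Suc i)\<close> lie in the kernel of \<open>A i\<close>, whose vectors have no constant
  terms by the choice of \<open>A i\<close>; for the rows of \<open>A 0\<close> this is the
  assumption \<open>proper\<close>.\<close>

lemma minimal_graded_resolution_exists:
  fixes J :: "'k::field vec set"
  assumes J: "J \<subseteq> vecs n 1" "vec_submodule n J"
    and closed: "\<And>c v. v \<in> J \<Longrightarrow> vrestr (tdeg [0] c) v \<in> J"
    and proper: "\<forall>v\<in>J. \<forall>l. lookup (v l) 0 = 0"
  obtains bs A where "bs 0 = [0]" and "\<And>i. set (bs i) \<subseteq> monomials n"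
    and "\<And>i. gmat (bs i) (bs (Suc i)) (A i)"
    and "J = matapp (length (bs 1)) (A 0) ` vecs n (length (bs 1))"
    and "\<And>i. {v \<in> vecs n (length (bs (Suc i))). matapp (length (bs (Suc i))) (A i) v = 0} =
        matapp (length (bs (Suc (Suc i)))) (A (Suc i)) ` vecs n (length (bs (Suc (Suc i))))"
    and "\<And>i l m. l < length (bs (Suc i)) \<Longrightarrow> lookup (A i l m) 0 = 0"
proof -
  \<comment> \<open>A state consists of the shifts \<open>bs\<close>, a submodule \<open>N\<close>
    free of constant terms, and a minimal presentation of \<open>N\<close> by \<open>bs'\<close> and
    \<open>A\<close>.\<close>
  define P where "P = (\<lambda>(bs, N, bs', A). set bs \<subseteq> monomials n \<and> set bs' \<subseteq> monomials n \<and>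
     gmat bs bs' A \<and> N = matapp (length bs') A ` vecs n (length bs') \<and>
     (\<forall>v\<in>vecs n (length bs'). matapp (length bs') A v = 0 \<longrightarrow> (\<forall>l. lookup (v l) 0 = 0)) \<and>
     (\<forall>v\<in>N. \<forall>l. lookup (v l :: 'k mpoly) 0 = 0))"
  define R where "R = (\<lambda>(bs :: mon list, N :: 'k vec set, bs', A :: nat \<Rightarrow> 'k vec) (cs, M, cs' :: mon list, B :: nat \<Rightarrow> 'k vec).
     cs = (bs' :: mon list) \<and> M = {v \<in> vecs n (length bs'). matapp (length bs') A v = 0})"
  \<comment> \<open>The clause for \<open>i = 0\<close> fixes the initial state, which dependent
    choice would otherwise leave open.\<close>
  have "\<exists>f. \<forall>i::nat. (P (f i) \<and> (i = 0 \<longrightarrow> (\<exists>cs B. f i = ([0], J, cs, B)))) \<and> R (f i) (f (Suc i))"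
  proof (rule dependent_nat_choice)
    have "J \<subseteq> vecs n (length [0 :: mon])" "set [0 :: mon] \<subseteq> monomials n" using J by auto
    from minimal_presentation[OF this(1) J(2) closed this(2)] obtain bs' A where
      "set bs' \<subseteq> monomials n" "gmat [0] bs' A" "J = matapp (length bs') A ` vecs n (length bs')"
      "\<forall>v\<in>vecs n (length bs'). matapp (length bs') A v = 0 \<longrightarrow> (\<forall>l. lookup (v l) 0 = 0)"
      by blast
    then have "P ([0], J, bs', A)" using proper by (auto simp: P_def)
    then show "\<exists>x. P x \<and> (0 = 0 \<longrightarrow> (\<exists>cs B. x = ([0], J, cs, B)))" by blast
    fix x and i :: nat assume "P x \<and> (i = 0 \<longrightarrow> (\<exists>cs B. x = ([0], J, cs, B)))"
    obtain bs N bs' A where x: "x = (bs, N, bs', A)" using prod_cases4 by blast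
    have px: "set bs' \<subseteq> monomials n" "gmat bs bs' A"
      "\<And>v l. v\<in>vecs n (length bs') \<Longrightarrow> matapp (length bs') A v = 0 \<Longrightarrow> lookup (v l) 0 = 0"
      using \<open>P x \<and> _\<close> by (auto simp: P_def x)
    let ?M = "{v \<in> vecs n (length bs'). matapp (length bs') A v = 0}"
    have "\<exists>cs' B. set cs' \<subseteq> monomials n \<and> gmat bs' cs' B \<and>
       ?M = matapp (length cs') B ` vecs n (length cs') \<and>
       (\<forall>v\<in>vecs n (length cs'). matapp (length cs') B v = 0 \<longrightarrow> (\<forall>l. lookup (v l) 0 = 0))"
    proof (rule minimal_presentation[OF _ vec_submodule_kernel _ px(1)])
      show "vrestr (tdeg bs' c) v \<in> ?M" if "v \<in> ?M" for c v
        using that vrestr_gmat[OF px(2), of v c] by simp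
    qed auto
    then obtain cs' B where cs: "set cs' \<subseteq> monomials n" "gmat bs' cs' B"
       "?M = matapp (length cs') B ` vecs n (length cs')"
       "\<forall>v\<in>vecs n (length cs'). matapp (length cs') B v = 0 \<longrightarrow> (\<forall>l. lookup (v l) 0 = 0)" by blast
    have "\<forall>v\<in>?M. \<forall>l. lookup (v l) 0 = 0" using px(3) by blast
    then have "P (bs', ?M, cs', B) \<and> R x (bs', ?M, cs', B)"
      unfolding P_def R_def x prod.case using px(1) cs by blast
    then show "\<exists>y. (P y \<and> (Suc i = 0 \<longrightarrow> (\<exists>cs B. y = ([0], J, cs, B)))) \<and> R x y" by blast
  qed
  then obtain f where f: "\<And>i. P (f i)" "\<exists>cs B. f 0 = ([0], J, cs, B)" "\<And>i. R (f i) (f (Suc i))"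
    by blast
  define bs where "bs i = fst (f i)" for i
  define N where "N i = fst (snd (f i))" for i
  define A where "A i = snd (snd (snd (f i)))" for i
  have feq: "f i = (bs i, N i, bs (Suc i), A i)" for i
    using f(3)[of i] by (auto simp: R_def bs_def N_def A_def split: prod.splits)
  have 1: "set (bs i) \<subseteq> monomials n" "gmat (bs i) (bs (Suc i)) (A i)"
     "N i = matapp (length (bs (Suc i))) (A i) ` vecs n (length (bs (Suc i)))"
     "\<And>v l. v \<in> N i \<Longrightarrow> lookup (v l) 0 = 0" for i
    using f(1)[of i] by (auto simp: P_def feq)
  have 2: "N (Suc i) = {v \<in> vecs n (length (bs (Suc i))). matapp (length (bs (Suc i))) (A i) v = 0}" for i
    using f(3)[of i] by (auto simp: R_def feq)
  have 3: "bs 0 = [0]" "N 0 = J" using f(2) by (auto simp: feq)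
  have 4: "A i l \<in> N i" if "l < length (bs (Suc i))" for i l
    unfolding 1(3) using that by (intro image_eqI[of _ _ "unit_vec l"]) auto
  show ?thesis
  proof (rule that[of bs A])
    show "J = matapp (length (bs 1)) (A 0) ` vecs n (length (bs 1))" using 1(3)[of 0] 3 by simp
    show "lookup (A i l m) 0 = 0" if "l < length (bs (Suc i))" for i l m
      using 1(4)[OF 4[OF that]] .
    show "{v \<in> vecs n (length (bs (Suc i))). matapp (length (bs (Suc i))) (A i) v = 0} =
        matapp (length (bs (Suc (Suc i)))) (A (Suc i)) ` vecs n (length (bs (Suc (Suc i))))" for i
      using 1(3)[of "Suc i"] 2[of i] by simp
  qed (rule 3 1)+
qed

end

section \<open>Lifting a graded resolution\<close>

context graded_preorder
begin

section \<open>Terms of smaller class and bounds by a class\<close>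

definition leq :: "mon \<Rightarrow> mon \<Rightarrow> bool" where
  "leq a c \<longleftrightarrow> low a c \<or> eqv a c"

definition lowv :: "mon list \<Rightarrow> mon \<Rightarrow> 'k::field vec \<Rightarrow> bool" where
  "lowv bs c v \<longleftrightarrow> (\<forall>l a. a \<in> keys (v l) \<longrightarrow> low (a + bs ! l) c)"

definition leqv :: "mon list \<Rightarrow> mon \<Rightarrow> 'k::field vec \<Rightarrow> bool" where
  "leqv bs c v \<longleftrightarrow> (\<forall>l a. a \<in> keys (v l) \<longrightarrow> leq (a + bs ! l) c)"

definition degv :: "mon list \<Rightarrow> nat \<Rightarrow> mon \<Rightarrow> nat \<Rightarrow> bool" where
  "degv bs d a l \<longleftrightarrow> mon_deg (a + bs ! l) = d"

lemma leq_low_trans: "leq a b \<Longrightarrow> low b c \<Longrightarrow> low a c"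
  unfolding leq_def using low_trans eqv_low_trans by blast

lemma low_leq_trans: "low a b \<Longrightarrow> leq b c \<Longrightarrow> low a c"
  unfolding leq_def using low_trans low_eqv_trans by blast

lemma leq_trans: "leq a b \<Longrightarrow> leq b c \<Longrightarrow> leq a c"
  using leq_low_trans low_leq_trans eqv_trans unfolding leq_def by blast

lemma leq_add: "d \<in> monomials n \<Longrightarrow> leq (d + a) (d + c) \<longleftrightarrow> leq a c"
  by (simp add: leq_def low_add eqv_add)

lemma leq_refl: "a \<in> monomials n \<Longrightarrow> leq a a"
  by (simp add: leq_def eqv_refl)

lemma leq_deg: "leq a c \<Longrightarrow> mon_deg a = mon_deg c"
  by (auto simp: leq_def low_def eqv_def)

text \<open>The monomials \<open>low\<close> below \<open>c\<close> share its degree, so they are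
  finitely many, and their number drops along \<open>low\<close>.\<close>

lemma wf_low: "wfp low"
proof -
  have "{(a, c). low a c} \<subseteq> measure (\<lambda>c. card {a. low a c})"
  proof clarsimp
    fix a c assume ac: "low a c"
    show "card {x. low x a} < card {x. low x c}"
    proof (rule psubset_card_mono)
      show "finite {x. low x c}"
        by (rule finite_subset[OF _ finite_monomials_of_degree[of n "mon_deg c"]])
          (auto simp: low_def)
      show "{x. low x a} \<subset> {x. low x c}"
        using ac low_trans low_irrefl by blast
    qed
  qed
  then show ?thesis unfolding wfp_def by (rule wf_subset[rotated]) simp
qed

lemma leq_max_exists:
  assumes "finite S" "S \<noteq> {}" "S \<subseteq> monomials n" "\<And>a. a \<in> S \<Longrightarrow> mon_deg a = d"
  shows "\<exists>c\<in>S. \<forall>a\<in>S. leq a c"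
  using assms
proof (induction S rule: finite_ne_induct)
  case (singleton x)
  then show ?case using leq_refl by auto
next
  case (insert x S)
  then obtain c where c: "c \<in> S" "\<forall>a\<in>S. leq a c" by auto
  have x: "leq x x" using insert.prems leq_refl by blast
  have "leq x c \<or> low c x" using low_cases[of x c] c(1) insert.prems by (auto simp: leq_def)
  then show ?case
  proof
    assume "leq x c"
    then show ?thesis using c by blast
  next
    assume "low c x"
    then have "leq c x" by (simp add: leq_def)
    then have "leq a x" if "a \<in> S" for a using c(2) that leq_trans by blast
    then show ?thesis using x by blast
  qed
qed

text \<open>Within one degree \<open>leq\<close> is total, so the finite support has a largest
  class. It is named by a monomial from the vector's own terms, so that it inherits any bound
  \<open>lowv\<close> on the vector.\<close>

lemma leading_class_exists:
  assumes v: "v \<in> vecs n (length bs)" "v \<noteq> 0" and bs: "set bs \<subseteq> monomials n"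
    and deg: "\<And>l a. a \<in> keys (v l) \<Longrightarrow> mon_deg (a + bs ! l) = d"
  shows "\<exists>l. \<exists>a\<in>keys (v l). leqv bs (a + bs ! l) v"
proof -
  define S where "S = (\<lambda>(l, a). a + bs ! l) ` supp v"
  have "a + bs ! l \<in> monomials n" if "a \<in> keys (v l)" for a l
    using vecs_keys[OF v(1) that] bs nth_mem by auto
  then have "\<exists>c\<in>S. \<forall>a\<in>S. leq a c"
    using finite_supp[OF v(1)] supp_nonempty[OF v(2)] deg
    by (intro leq_max_exists[of S d]) (auto simp: S_def supp_def)
  then show ?thesis by (fastforce simp: S_def supp_def leqv_def)
qed

lemma lowv_leqv: "lowv bs c v \<Longrightarrow> leqv bs c v"
  by (auto simp: lowv_def leqv_def leq_def)

lemma lowv_uminus: "lowv bs c (- v) \<longleftrightarrow> lowv bs c v"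
  by (auto simp: lowv_def in_keys_iff)

lemma leqv_add: "leqv bs c u \<Longrightarrow> leqv bs c v \<Longrightarrow> leqv bs c (u + v)"
  by (auto simp: leqv_def dest!: subsetD[OF keys_add])

lemma leqv_diff: "leqv bs c u \<Longrightarrow> leqv bs c v \<Longrightarrow> leqv bs c (u - v)"
  by (auto simp: leqv_def dest!: subsetD[OF keys_minus_subset])

lemma homog_leqv: "homog bs c v \<Longrightarrow> leqv bs c v"
  by (auto simp: leqv_def leq_def homog_def tdeg_def)

lemma lowv_vrestr: "lowv bs c v \<Longrightarrow> vrestr (tdeg bs c) v = 0"
  using low_not_eqv by (intro vrestr_eq_0) (auto simp: lowv_def tdeg_def)

lemma leqv_lowv:
  assumes "leqv bs c v" "vrestr (tdeg bs c) v = 0"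
  shows "lowv bs c v"
  unfolding lowv_def
proof (intro allI impI)
  fix l a assume a: "a \<in> keys (v l)"
  have "keys (vrestr (tdeg bs c) v l) = {}" using assms(2) by simp
  then have "\<not> eqv (a + bs ! l) c" using a by (auto simp: vrestr_def keys_restr tdeg_def)
  then show "low (a + bs ! l) c" using assms(1) a by (auto simp: leqv_def leq_def)
qed

lemma leqv_low_trans: "leqv bs c v \<Longrightarrow> low c d \<Longrightarrow> lowv bs d v"
  using leq_low_trans unfolding leqv_def lowv_def by blast

text \<open>Such an \<open>L\<close> is strictly triangular with respect to classes: adding it to a
  graded matrix does not change top components of images.\<close>

lemma lowv_matapp:
  assumes L: "\<And>l. l < length bs' \<Longrightarrow> lowv bs (bs' ! l) (L l)"
    and u: "u \<in> vecs n (length bs')" "leqv bs' c u"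
  shows "lowv bs c (matapp (length bs') L u)"
  unfolding lowv_def
proof (intro allI impI)
  fix m a assume "a \<in> keys (matapp (length bs') L u m)"
  then obtain l b e where b: "l < length bs'" "b \<in> keys (u l)" "e \<in> keys (L l m)" "a = b + e"
    using keys_matapp by blast
  have "low (b + (e + bs ! m)) (b + bs' ! l)"
    using L b vecs_keys[OF u(1) b(2)] by (auto simp: low_add lowv_def)
  moreover have "leq (b + bs' ! l) c" using u(2) b by (auto simp: leqv_def)
  ultimately show "low (a + bs ! m) c" using low_leq_trans b by (auto simp: add.assoc)
qed

lemma leqv_matapp:
  assumes A: "gmat bs bs' A"
    and u: "u \<in> vecs n (length bs')" "leqv bs' c u"
  shows "leqv bs c (matapp (length bs') A u)"
  unfolding leqv_def
proof (intro allI impI)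
  fix m a assume "a \<in> keys (matapp (length bs') A u m)"
  then obtain l b e where b: "l < length bs'" "b \<in> keys (u l)" "e \<in> keys (A l m)" "a = b + e"
    using keys_matapp by blast
  have "leq (e + bs ! m) (bs' ! l)"
    using A b homogD[of bs "bs' ! l" "A l" e m] by (auto simp: gmat_def leq_def)
  then have "leq (b + (e + bs ! m)) (b + bs' ! l)"
    using vecs_keys[OF u(1) b(2)] by (auto simp: leq_add)
  moreover have "leq (b + bs' ! l) c" using u(2) b by (auto simp: leqv_def)
  ultimately show "leq (a + bs ! m) c" using leq_trans b by (auto simp: add.assoc)
qed

text \<open>\<open>N'\<close> plays the role of the ideal \<open>I\<close> and \<open>N\<close> that of its leading ideal.\<close>

definition degenerates :: "mon list \<Rightarrow> 'k::field vec set \<Rightarrow> 'k vec set \<Rightarrow> bool" where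
  "degenerates bs N' N \<longleftrightarrow> N' \<subseteq> vecs n (length bs) \<and> vec_submodule n N' \<and>
     (\<forall>d. \<forall>v\<in>N'. vrestr (degv bs d) v \<in> N') \<and>
     (\<forall>c. \<forall>u\<in>N. homog bs c u \<longrightarrow> (\<exists>w\<in>vecs n (length bs). lowv bs c w \<and> u + w \<in> N')) \<and>
     (\<forall>c. \<forall>v\<in>N'. leqv bs c v \<longrightarrow> vrestr (tdeg bs c) v \<in> N)"

definition lifts :: "mon list \<Rightarrow> mon list \<Rightarrow> (nat \<Rightarrow> 'k::field vec) \<Rightarrow> (nat \<Rightarrow> 'k vec) \<Rightarrow> bool" where
  "lifts bs bs' B A \<longleftrightarrow> (\<forall>l<length bs'. \<exists>w\<in>vecs n (length bs). lowv bs (bs' ! l) w \<and> B l = A l + w)"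

lemma lifts_vecs:
  assumes "gmat bs bs' A" "lifts bs bs' B A" "l < length bs'"
  shows "B l \<in> vecs n (length bs)"
  using assms by (auto simp: gmat_def lifts_def)

text \<open>\<open>low\<close> and \<open>eqv\<close> both fix the degree, so the deformed matrix
  has the integer shifts of \<open>A\<close>.\<close>

lemma lifts_degree:
  assumes "gmat bs bs' A" "lifts bs bs' B A" "l < length bs'" "a \<in> keys (B l m)"
  shows "mon_deg (a + bs ! m) = mon_deg (bs' ! l)"
proof -
  obtain w where w: "lowv bs (bs' ! l) w" "B l = A l + w" using assms by (auto simp: lifts_def)
  then have "a \<in> keys (A l m) \<or> a \<in> keys (w m)" using assms(4) keys_add[of "A l m" "w m"] by auto
  then have "leq (a + bs ! m) (bs' ! l)"
    using w(1) assms(1,3) homogD[of bs "bs' ! l" "A l" a m] by (auto simp: lowv_def leq_def gmat_def)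
  then show ?thesis by (rule leq_deg)
qed

lemma vrestr_degv_matapp:
  assumes "\<And>l m a. l < length bs' \<Longrightarrow> a \<in> keys (B l m) \<Longrightarrow> mon_deg (a + bs ! m) = mon_deg (bs' ! l)"
  shows "vrestr (degv bs d) (matapp (length bs') B v) = matapp (length bs') B (vrestr (degv bs' d) v)"
  using assms by (intro vrestr_matapp) (auto simp: degv_def mon_deg_add add.assoc)

text \<open>The rows of \<open>A\<close> are homogeneous elements of its image;
  \<open>degenerates\<close> completes them by lower terms to rows of \<open>B\<close> in
  \<open>N'\<close>. These generate \<open>N'\<close> by successive approximation from the top class
  downwards, and the kernels of \<open>B\<close> and \<open>A\<close> again satisfy
  \<open>degenerates\<close>, so the step can be repeated.\<close>

lemma lift_step:
  fixes N' :: "'k::field vec set"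
  assumes bs: "set bs \<subseteq> monomials n" "set bs' \<subseteq> monomials n"
    and gm: "gmat bs bs' A"
    and deg: "degenerates bs N' (matapp (length bs') A ` vecs n (length bs'))"
  shows "\<exists>B. lifts bs bs' B A \<and> N' = matapp (length bs') B ` vecs n (length bs') \<and>
     degenerates bs' {v \<in> vecs n (length bs'). matapp (length bs') B v = 0}
                     {v \<in> vecs n (length bs'). matapp (length bs') A v = 0}"
proof -
  let ?r = "length bs" and ?r' = "length bs'"
  let ?N = "matapp ?r' A ` vecs n ?r'"
  have N': "N' \<subseteq> vecs n ?r" "vec_submodule n N'"
    and dcl: "\<And>d v. v \<in> N' \<Longrightarrow> vrestr (degv bs d) v \<in> N'"
    and P1: "\<And>c u. u \<in> ?N \<Longrightarrow> homog bs c u \<Longrightarrow> \<exists>w\<in>vecs n ?r. lowv bs c w \<and> u + w \<in> N'"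
    and P2: "\<And>c v. v \<in> N' \<Longrightarrow> leqv bs c v \<Longrightarrow> vrestr (tdeg bs c) v \<in> ?N"
    using deg unfolding degenerates_def by auto
  have "\<exists>w\<in>vecs n ?r. lowv bs (bs' ! l) w \<and> A l + w \<in> N'" if "l < ?r'" for l
    using that gm by (intro P1 image_eqI[of _ _ "unit_vec l"]) (auto simp: gmat_def)
  then obtain L where L: "\<And>l. l < ?r' \<Longrightarrow> L l \<in> vecs n ?r \<and> lowv bs (bs' ! l) (L l) \<and> A l + L l \<in> N'"
    by metis
  define B where "B l = A l + L l" for l
  have lift: "lifts bs bs' B A" using L by (auto simp: lifts_def B_def)
  have B_in: "B l \<in> N'" if "l < ?r'" for l using L that by (simp add: B_def)
  have B_app: "matapp ?r' B u = matapp ?r' A u + matapp ?r' L u" for u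
    unfolding B_def by (rule matapp_mat_add)
  have L_low: "lowv bs c (matapp ?r' L u)" if "u \<in> vecs n ?r'" "leqv bs' c u" for c u
    using that L by (intro lowv_matapp) auto
  have B_leq: "leqv bs c (matapp ?r' B u)" if "u \<in> vecs n ?r'" "leqv bs' c u" for c u
    using leqv_add[OF leqv_matapp[OF gm that] lowv_leqv[OF L_low[OF that]]] by (simp add: B_app)
  have B_restr: "vrestr (tdeg bs c) (matapp ?r' B u) = matapp ?r' A (vrestr (tdeg bs' c) u)"
    if "u \<in> vecs n ?r'" "leqv bs' c u" for c u
    using that L_low by (simp add: B_app vrestr_add lowv_vrestr vrestr_gmat[OF gm])
  \<comment> \<open>The bound on the class of the preimage matters as much as its existence: the
    kernel can only be corrected by lower terms because of it. Each round matches the top component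
    of \<open>v\<close> through \<open>A\<close> and leaves a strictly lower remainder.\<close>
  have exact: "\<exists>u\<in>vecs n ?r'. leqv bs' c u \<and> matapp ?r' B u = v" if "v \<in> N'" "leqv bs c v" for c v
    using that
  proof (induction c arbitrary: v rule: wfp_induct_rule[OF wf_low])
    case (1 c)
    have vv: "v \<in> vecs n ?r" using 1 N' by blast
    obtain u0' where u0': "u0' \<in> vecs n ?r'" "vrestr (tdeg bs c) v = matapp ?r' A u0'"
      using P2[OF 1(2,3)] by blast
    \<comment> \<open>The preimage \<open>u0'\<close> may have components of other classes; its
      component of class \<open>c\<close> has the same image because \<open>A\<close> is
      graded.\<close>
    define u0 where "u0 = vrestr (tdeg bs' c) u0'"
    have u0: "u0 \<in> vecs n ?r'" "homog bs' c u0" using u0' by (auto simp: u0_def homog_vrestr)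
    note u0l = homog_leqv[OF u0(2)]
    have Au0: "matapp ?r' A u0 = vrestr (tdeg bs c) v"
      using vrestr_gmat[OF gm u0'(1), of c] u0'(2) vrestr_homog[OF homog_vrestr, of bs c v]
      by (simp add: u0_def)
    define v1 where "v1 = v - matapp ?r' B u0"
    have v1: "v1 \<in> N'" unfolding v1_def
      by (intro vec_submodule_diff[OF N'(2)] 1 vec_submodule_matapp[OF N'(2)] B_in u0)
    then have v1v: "v1 \<in> vecs n ?r" using N' by blast
    have "leqv bs c v1" unfolding v1_def using 1 B_leq u0 u0l by (intro leqv_diff) auto
    moreover have "vrestr (tdeg bs c) v1 = 0"
      using B_restr[OF u0(1) u0l] Au0 vrestr_homog[OF u0(2)] by (simp add: v1_def vrestr_diff)
    ultimately have v1l: "lowv bs c v1" by (rule leqv_lowv)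
    show ?case
    proof (cases "v1 = 0")
      case True
      then show ?thesis using u0 u0l by (auto simp: v1_def)
    next
      case False
      have "mon_deg (a + bs ! l) = mon_deg c" if "a \<in> keys (v1 l)" for a l
        using v1l that by (auto simp: lowv_def low_def)
      then obtain l a where la: "a \<in> keys (v1 l)" "leqv bs (a + bs ! l) v1"
        using leading_class_exists[OF v1v False bs(1)] by blast
      have lc: "low (a + bs ! l) c" using v1l la by (auto simp: lowv_def)
      then obtain u1 where u1: "u1 \<in> vecs n ?r'" "leqv bs' (a + bs ! l) u1" "matapp ?r' B u1 = v1"
        using 1(1)[OF _ v1 la(2)] by auto
      have "leqv bs' c u1" using leqv_low_trans[OF u1(2) lc] lowv_leqv by blast
      then have "leqv bs' c (u0 + u1)" using u0l by (intro leqv_add)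
      moreover have "matapp ?r' B (u0 + u1) = v" unfolding matapp_add u1(3) v1_def by simp
      ultimately show ?thesis using u0(1) u1(1) vecs_add by blast
    qed
  qed
  \<comment> \<open>The strict form of the bound, from \<open>exact\<close> at the leading class of
    \<open>v\<close>, which lies below \<open>c\<close>.\<close>
  have exact_deg: "\<exists>u\<in>vecs n ?r'. lowv bs' c u \<and> matapp ?r' B u = v" if "v \<in> N'" "lowv bs c v" for c v
  proof (cases "v = 0")
    case True then show ?thesis by (intro bexI[of _ 0]) (auto simp: lowv_def)
  next
    case False
    have vv: "v \<in> vecs n ?r" using that N' by blast
    have "mon_deg (a + bs ! l) = mon_deg c" if "a \<in> keys (v l)" for a l
      using \<open>lowv bs c v\<close> that by (auto simp: lowv_def low_def)
    then obtain l a where la: "a \<in> keys (v l)" "leqv bs (a + bs ! l) v"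
      using leading_class_exists[OF vv False bs(1)] by blast
    then show ?thesis using exact[OF that(1) la(2)] that(2) leqv_low_trans
      unfolding lowv_def by blast
  qed
  have img: "N' = matapp ?r' B ` vecs n ?r'"
  proof
    show "matapp ?r' B ` vecs n ?r' \<subseteq> N'" using vec_submodule_matapp[OF N'(2)] B_in by blast
    show "N' \<subseteq> matapp ?r' B ` vecs n ?r'"
    proof
      fix v assume v: "v \<in> N'"
      show "v \<in> matapp ?r' B ` vecs n ?r'"
      \<comment> \<open>A leading class exists only within one degree, so \<open>v\<close> is split
        into degree components first.\<close>
      proof (rule component_induct[OF v _ N'(2), where Q = "degv bs" and P = "\<lambda>v. v \<in> matapp ?r' B ` vecs n ?r'"])
        show "vrestr (degv bs d) u \<in> matapp ?r' B ` vecs n ?r'" if u: "u \<in> N'" for d u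
        proof (cases "vrestr (degv bs d) u = 0")
          case True then show ?thesis using vec_submoduleD(1)[OF vec_submodule_image] by simp
        next
          case False
          have u': "vrestr (degv bs d) u \<in> N'" using dcl u by blast
          have "mon_deg (a + bs ! l) = d" if "a \<in> keys (vrestr (degv bs d) u l)" for a l
            using that by (auto simp: vrestr_def keys_restr degv_def)
          then obtain c where "leqv bs c (vrestr (degv bs d) u)"
            using leading_class_exists[OF _ False bs(1)] u' N'(1) by blast
          then obtain w where w: "w \<in> vecs n ?r'" "matapp ?r' B w = vrestr (degv bs d) u"
            using exact[OF u'] by blast
          show ?thesis unfolding w(2)[symmetric] using w(1) by (rule imageI)
        qed
        show "u + w \<in> matapp ?r' B ` vecs n ?r'"
          if "u \<in> matapp ?r' B ` vecs n ?r'" "w \<in> matapp ?r' B ` vecs n ?r'" for u w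
          using vec_submoduleD(2)[OF vec_submodule_image that] .
        show "0 \<in> matapp ?r' B ` vecs n ?r'" by (rule vec_submoduleD(1)[OF vec_submodule_image])
      qed (use v N' dcl in \<open>auto simp: degv_def\<close>)
    qed
  qed
  have "degenerates bs' {v \<in> vecs n ?r'. matapp ?r' B v = 0} {v \<in> vecs n ?r'. matapp ?r' A v = 0}"
    unfolding degenerates_def
  proof (intro conjI allI ballI impI)
    show "vec_submodule n {v \<in> vecs n ?r'. matapp ?r' B v = 0}" by (rule vec_submodule_kernel)
    show "vrestr (degv bs' d) v \<in> {v \<in> vecs n ?r'. matapp ?r' B v = 0}"
      if "v \<in> {v \<in> vecs n ?r'. matapp ?r' B v = 0}" for d v
      using that lifts_degree[OF gm lift] vrestr_degv_matapp[of bs' B bs d v] by auto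
    show "vrestr (tdeg bs' c) v \<in> {v \<in> vecs n ?r'. matapp ?r' A v = 0}"
      if "v \<in> {v \<in> vecs n ?r'. matapp ?r' B v = 0}" "leqv bs' c v" for c v
      using that B_restr[of v c] by auto
    \<comment> \<open>\<open>A u = 0\<close> makes \<open>B u\<close> strictly lower, hence the
      image under \<open>B\<close> of a strictly lower \<open>u'\<close>; then \<open>u - u'\<close>
      is the required kernel element.\<close>
    show "\<exists>w\<in>vecs n ?r'. lowv bs' c w \<and> u + w \<in> {v \<in> vecs n ?r'. matapp ?r' B v = 0}"
      if u: "u \<in> {v \<in> vecs n ?r'. matapp ?r' A v = 0}" "homog bs' c u" for c u
    proof -
      have "lowv bs c (matapp ?r' B u)" using L_low[OF _ homog_leqv[OF u(2)]] u(1) by (simp add: B_app)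
      moreover have "matapp ?r' B u \<in> N'" using img u(1) by blast
      ultimately obtain u' where u': "u' \<in> vecs n ?r'" "lowv bs' c u'" "matapp ?r' B u' = matapp ?r' B u"
        using exact_deg by blast
      have "- u' = 0 - u'" by simp
      then have "- u' \<in> vecs n ?r'" using u' vecs_diff vecs_0 by metis
      moreover have "matapp ?r' B (u - u') = 0" using u' by (simp add: matapp_diff)
      ultimately show ?thesis using u' u(1) by (intro bexI[of _ "- u'"]) (auto simp: lowv_uminus)
    qed
  qed auto
  then show ?thesis using lift img by blast
qed

text \<open>The invariant is that the kernel of \<open>B i\<close> degenerates to that of
  \<open>A i\<close>. By exactness the latter is the image of \<open>A (Suc i)\<close>, which is the
  form that \<open>lift_step\<close> requires.\<close>

lemma lifted_resolution_exists:
  fixes J :: "'k::field vec set"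
  assumes bs: "\<And>i. set (bs i) \<subseteq> monomials n"
    and gm: "\<And>i. gmat (bs i) (bs (Suc i)) (A i)"
    and base: "degenerates (bs 0) J (matapp (length (bs 1)) (A 0) ` vecs n (length (bs 1)))"
    and exact: "\<And>i. {v \<in> vecs n (length (bs (Suc i))). matapp (length (bs (Suc i))) (A i) v = 0} =
        matapp (length (bs (Suc (Suc i)))) (A (Suc i)) ` vecs n (length (bs (Suc (Suc i))))"
  obtains B where "\<And>i. lifts (bs i) (bs (Suc i)) (B i) (A i)"
    and "J = matapp (length (bs 1)) (B 0) ` vecs n (length (bs 1))"
    and "\<And>i. {v \<in> vecs n (length (bs (Suc i))). matapp (length (bs (Suc i))) (B i) v = 0} =
        matapp (length (bs (Suc (Suc i)))) (B (Suc i)) ` vecs n (length (bs (Suc (Suc i))))"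
proof -
  let ?r = "\<lambda>i. length (bs i)"
  let ?K = "\<lambda>i B. {v \<in> vecs n (?r (Suc i)). matapp (?r (Suc i)) B v = 0}"
  define P where "P i B \<longleftrightarrow> lifts (bs i) (bs (Suc i)) B (A i) \<and>
     degenerates (bs (Suc i)) (?K i B) (?K i (A i)) \<and>
     (i = 0 \<longrightarrow> J = matapp (?r 1) B ` vecs n (?r 1))" for i and B :: "nat \<Rightarrow> 'k vec"
  have "\<exists>B. \<forall>i. P i (B i) \<and> ?K i (B i) = matapp (?r (Suc (Suc i))) (B (Suc i)) ` vecs n (?r (Suc (Suc i)))"
  proof (rule dependent_nat_choice)
    show "\<exists>B. P 0 B"
      using lift_step[OF bs bs gm base[unfolded One_nat_def]] by (auto simp: P_def)
    fix B i assume B: "P i B"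
    then have "degenerates (bs (Suc i)) (?K i B)
       (matapp (?r (Suc (Suc i))) (A (Suc i)) ` vecs n (?r (Suc (Suc i))))"
      by (simp add: P_def exact)
    from lift_step[OF bs bs gm this] obtain C where "P (Suc i) C"
      "?K i B = matapp (?r (Suc (Suc i))) C ` vecs n (?r (Suc (Suc i)))"
      by (auto simp: P_def)
    then show "\<exists>C. P (Suc i) C \<and> ?K i B = matapp (?r (Suc (Suc i))) C ` vecs n (?r (Suc (Suc i)))"
      by blast
  qed
  then obtain B where B: "\<And>i. P i (B i)"
    "\<And>i. ?K i (B i) = matapp (?r (Suc (Suc i))) (B (Suc i)) ` vecs n (?r (Suc (Suc i)))" by blast
  show ?thesis
  proof (rule that[of B])
    show "lifts (bs i) (bs (Suc i)) (B i) (A i)" for i using B(1)[of i] by (simp add: P_def)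
    show "J = matapp (?r 1) (B 0) ` vecs n (?r 1)" using B(1)[of 0] by (simp add: P_def)
  qed (rule B(2))
qed

end

section \<open>Homogeneous ideals and leading ideals\<close>

lemma mpoly_ring_simps:
  "mult (mpoly_ring n) = (*)" "one (mpoly_ring n) = 1" "zero (mpoly_ring n) = 0"
  "add (mpoly_ring n) = (+)"
  by (auto simp: mpoly_ring_def)

lemma cring_mpoly_ring: "cring (mpoly_ring n :: 'k::field mpoly ring)"
proof (rule cringI)
  show "abelian_group (mpoly_ring n :: 'k mpoly ring)"
  proof (rule abelian_groupI)
    fix x :: "'k mpoly" assume "x \<in> carrier (mpoly_ring n)"
    then show "\<exists>y\<in>carrier (mpoly_ring n). y \<oplus>\<^bsub>mpoly_ring n\<^esub> x = \<zero>\<^bsub>mpoly_ring n\<^esub>"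
      by (intro bexI[of _ "- x"]) (auto simp: mpoly_ring_simps)
  qed (auto simp: mpoly_ring_simps algebra_simps)
  show "comm_monoid (mpoly_ring n :: 'k mpoly ring)"
    by (rule comm_monoidI) (auto simp: mpoly_ring_simps algebra_simps)
qed (auto simp: mpoly_ring_simps algebra_simps)

lemma ideal_mpoly_ring_iff:
  "ideal I (mpoly_ring n) \<longleftrightarrow> I \<subseteq> polys n \<and> 0 \<in> I \<and> (\<forall>f\<in>I. \<forall>g\<in>I. f + g \<in> I) \<and>
     (\<forall>f\<in>polys n. \<forall>g\<in>I. f * g \<in> (I :: 'k::field mpoly set))"
proof
  assume "ideal I (mpoly_ring n)"
  then interpret ideal I "mpoly_ring n" .
  show "I \<subseteq> polys n \<and> 0 \<in> I \<and> (\<forall>f\<in>I. \<forall>g\<in>I. f + g \<in> I) \<and> (\<forall>f\<in>polys n. \<forall>g\<in>I. f * g \<in> I)"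
    using Icarr I_l_closed additive_subgroup.a_closed[OF additive_subgroup_axioms]
      additive_subgroup.zero_closed[OF additive_subgroup_axioms] by (auto simp: mpoly_ring_simps)
next
  assume I: "I \<subseteq> polys n \<and> 0 \<in> I \<and> (\<forall>f\<in>I. \<forall>g\<in>I. f + g \<in> I) \<and>
     (\<forall>f\<in>polys n. \<forall>g\<in>I. f * g \<in> I)"
  interpret cring "mpoly_ring n :: 'k mpoly ring" by (rule cring_mpoly_ring)
  show "ideal I (mpoly_ring n)"
  proof (rule idealI)
    show "subgroup I (add_monoid (mpoly_ring n))"
    proof
      fix x assume x: "x \<in> I"
      have "- x = (- 1) * x" by simp
      then have "- x \<in> I" using I x polys_uminus[OF polys_1] by metis
      moreover have "inv\<^bsub>add_monoid (mpoly_ring n)\<^esub> x = - x"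
      proof -
        have "\<ominus>\<^bsub>mpoly_ring n\<^esub> x = - x"
          using x I by (intro minus_equality) (auto simp: mpoly_ring_simps)
        then show ?thesis by (simp add: a_inv_def)
      qed
      ultimately show "inv\<^bsub>add_monoid (mpoly_ring n)\<^esub> x \<in> I" by simp
    qed (use I in \<open>auto simp: mpoly_ring_simps\<close>)
    show "x \<otimes>\<^bsub>mpoly_ring n\<^esub> a \<in> I" "a \<otimes>\<^bsub>mpoly_ring n\<^esub> x \<in> I"
      if "a \<in> I" "x \<in> carrier (mpoly_ring n)" for a x
      using I that by (simp_all add: mpoly_ring_simps mult.commute[of a x])
  qed (rule ring_axioms)
qed

lemma idealD:
  assumes "ideal I (mpoly_ring n)"
  shows "f \<in> I \<Longrightarrow> f \<in> polys n" "0 \<in> I" "f \<in> I \<Longrightarrow> g \<in> I \<Longrightarrow> f + g \<in> I"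
    "f \<in> polys n \<Longrightarrow> g \<in> I \<Longrightarrow> f * g \<in> I" "f \<in> I \<Longrightarrow> g \<in> I \<Longrightarrow> f - g \<in> I"
proof -
  have *: "I \<subseteq> polys n \<and> 0 \<in> I \<and> (\<forall>f\<in>I. \<forall>g\<in>I. f + g \<in> I) \<and> (\<forall>f\<in>polys n. \<forall>g\<in>I. f * g \<in> I)"
    using assms by (simp add: ideal_mpoly_ring_iff)
  then show "f \<in> I \<Longrightarrow> f \<in> polys n" "0 \<in> I" "f \<in> I \<Longrightarrow> g \<in> I \<Longrightarrow> f + g \<in> I"
    "f \<in> polys n \<Longrightarrow> g \<in> I \<Longrightarrow> f * g \<in> I" by auto
  show "f - g \<in> I" if "f \<in> I" "g \<in> I"
  proof -
    have "(- 1) * g \<in> I" using * that polys_uminus[OF polys_1] by blast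
    then have "f + (- 1) * g \<in> I" using * that by blast
    then show ?thesis by simp
  qed
qed

definition ideal_vecs :: "nat \<Rightarrow> 'k::field mpoly set \<Rightarrow> 'k vec set" where
  "ideal_vecs n I = {v \<in> vecs n 1. v 0 \<in> I}"

lemma vec_submodule_ideal_vecs: "ideal I (mpoly_ring n) \<Longrightarrow> vec_submodule n (ideal_vecs n I)"
  using idealD[of I n] by (auto simp: vec_submodule_def ideal_vecs_def)

lemma homogeneous_component_restr:
  "homogeneous_component j f = restr (\<lambda>a. int (mon_deg a) = j) f"
  by (simp add: homogeneous_component_def restr_def)

lemma leading_part_restr:
  "leading_part lt f = restr (\<lambda>a. \<not> (\<exists>b\<in>keys f. lt a b)) f"
  by (simp add: leading_part_def restr_def)

text \<open>The component of degree 0 lies in \<open>I\<close> and would be a unit if it were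
  nonzero.\<close>

lemma proper_homogeneous_ideal:
  assumes I: "homogeneous_ideal n I" "I \<noteq> polys n" and f: "f \<in> I"
  shows "lookup f 0 = 0"
proof (rule ccontr)
  assume nz: "lookup f 0 \<noteq> 0"
  have id: "ideal I (mpoly_ring n)" using I by (simp add: homogeneous_ideal_def)
  have "homogeneous_component 0 f \<in> I" using I f by (auto simp: homogeneous_ideal_def)
  also have "homogeneous_component 0 f = single 0 (lookup f 0)"
    by (rule poly_mapping_eqI)
      (auto simp: homogeneous_component_restr lookup_restr lookup_single when_def)
  finally have "single 0 (1 / lookup f 0) * single 0 (lookup f 0) \<in> I"
    using idealD(4)[OF id] by auto
  then have "1 \<in> I" using nz by (simp add: mult_single)
  then have "polys n \<subseteq> I" using idealD(4)[OF id, of _ 1] by auto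
  then show False using idealD(1)[OF id] I(2) by blast
qed

section \<open>Leading ideals and the grading by classes\<close>

context graded_preorder
begin

text \<open>The counterpart of \<open>eqv_low_trans\<close> across degrees:
  \<open>leading_part\<close> compares all terms of a polynomial, whatever their degrees.\<close>

lemma incomparable_lt:
  assumes "a \<in> monomials n" "b \<in> monomials n" "c \<in> monomials n"
    "\<not> lt a b" "\<not> lt b a" "lt b c"
  shows "lt a c"
proof (rule ccontr)
  let ?E = "{(a, b). a \<in> monomials n \<and> b \<in> monomials n \<and> \<not> lt a b \<and> \<not> lt b a}"
  assume "\<not> lt a c"
  moreover have "\<not> lt c a" using lt_trans[of b c a] assms by blast
  moreover have "trans ?E" using weak by (auto simp: weak_order_on_def equiv_def)
  ultimately have "(b, c) \<in> ?E" using assms by (intro transD[of ?E b a c]) auto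
  then show False using assms by auto
qed

lemma leading_ideal_ideal:
  assumes I: "ideal I (mpoly_ring n)"
  shows "ideal (leading_ideal n lt I) (mpoly_ring n)"
proof -
  interpret cring "mpoly_ring n :: 'a mpoly ring" by (rule cring_mpoly_ring)
  show ?thesis unfolding leading_ideal_def
    using idealD(1)[OF I] by (intro genideal_ideal) (auto simp: leading_part_restr)
qed

lemma leading_part_in_leading_ideal:
  assumes I: "ideal I (mpoly_ring n)" and f: "f \<in> I"
  shows "leading_part lt f \<in> leading_ideal n lt I"
proof -
  interpret cring "mpoly_ring n :: 'a mpoly ring" by (rule cring_mpoly_ring)
  have "leading_part lt ` I \<subseteq> carrier (mpoly_ring n)"
    using idealD(1)[OF I] by (auto simp: leading_part_restr)
  then show ?thesis unfolding leading_ideal_def using genideal_self f by blast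
qed

text \<open>The bound puts \<open>f\<close> into a single degree. If class \<open>c\<close> occurs
  in \<open>f\<close>, its terms are exactly the leading ones; otherwise the component is
  zero.\<close>

lemma top_class_in_leading_ideal:
  assumes I: "ideal I (mpoly_ring n)" and f: "f \<in> I" and le: "\<And>a. a \<in> keys f \<Longrightarrow> leq a c"
  shows "restr (\<lambda>a. eqv a c) f \<in> leading_ideal n lt I"
proof (cases "\<exists>a\<in>keys f. eqv a c")
  case False
  then have "restr (\<lambda>a. eqv a c) f = 0" by (intro restr_eq_0) auto
  then show ?thesis using idealD(2)[OF leading_ideal_ideal[OF I]] by simp
next
  case True
  then obtain a where a: "a \<in> keys f" "eqv a c" by blast
  have mon: "b \<in> monomials n \<and> mon_deg b = mon_deg c" if "b \<in> keys f" for b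
    using le[OF that] by (auto simp: leq_def low_def eqv_def)
  have "restr (\<lambda>a. eqv a c) f = leading_part lt f"
    unfolding leading_part_restr
  proof (rule restr_cong)
    fix b assume b: "b \<in> keys f"
    show "eqv b c \<longleftrightarrow> \<not> (\<exists>d\<in>keys f. lt b d)"
    proof
      assume bc: "eqv b c"
      show "\<not> (\<exists>d\<in>keys f. lt b d)"
      proof
        assume "\<exists>d\<in>keys f. lt b d"
        then obtain d where d: "d \<in> keys f" "lt b d" by blast
        then have "low b d" using mon[OF b] mon[of d] by (auto simp: low_def)
        then have "low b c" using low_leq_trans le d by blast
        then show False using low_not_eqv bc by blast
      qed
    next
      assume *: "\<not> (\<exists>d\<in>keys f. lt b d)"
      have "\<not> low b c"
      proof
        assume "low b c"
        then have "low b a" using a(2) eqv_sym low_eqv_trans by blast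
        then show False using * a by (auto simp: low_def)
      qed
      then show "eqv b c" using le[OF b] by (simp add: leq_def)
    qed
  qed
  then show ?thesis using leading_part_in_leading_ideal[OF I f] by simp
qed

text \<open>The polynomials all of whose class components can be completed by lower terms to
  elements of \<open>I\<close> form an ideal, and this ideal contains the leading parts. A leading
  part may mix degrees, so one class is treated at a time.\<close>

lemma leading_ideal_lift:
  fixes I :: "'k::field mpoly set"
  assumes hI: "homogeneous_ideal n I" and g: "g \<in> leading_ideal n lt I"
  shows "\<exists>w\<in>polys n. (\<forall>a\<in>keys w. low a c) \<and> restr (\<lambda>a. eqv a c) g + w \<in> I"
proof -
  have I: "ideal I (mpoly_ring n)" using hI by (simp add: homogeneous_ideal_def)
  define liftable where "liftable g c \<longleftrightarrow>
     (\<exists>w\<in>polys n. (\<forall>a\<in>keys w. low a c) \<and> restr (\<lambda>a. eqv a c) g + w \<in> I)" for g c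
  define G where "G = {g \<in> polys n. \<forall>c. liftable g c}"
  have triv: "liftable g c" if "\<And>a. a \<in> keys g \<Longrightarrow> \<not> eqv a c" for g c
    unfolding liftable_def using that idealD(2)[OF I]
    by (intro bexI[of _ 0]) (auto simp: restr_eq_0)
  have add: "g + h \<in> G" if gh: "g \<in> G" "h \<in> G" for g h
  proof -
    have "liftable (g + h) c" for c
    proof -
      obtain w1 where w1: "w1 \<in> polys n" "\<forall>a\<in>keys w1. low a c" "restr (\<lambda>a. eqv a c) g + w1 \<in> I"
        using gh unfolding G_def liftable_def by blast
      obtain w2 where w2: "w2 \<in> polys n" "\<forall>a\<in>keys w2. low a c" "restr (\<lambda>a. eqv a c) h + w2 \<in> I"
        using gh unfolding G_def liftable_def by blast
      have "restr (\<lambda>a. eqv a c) (g + h) + (w1 + w2) \<in> I"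
        using idealD(3)[OF I w1(3) w2(3)] by (simp add: restr_add algebra_simps)
      then show ?thesis unfolding liftable_def using w1 w2 keys_add[of w1 w2]
        by (intro bexI[of _ "w1 + w2"]) auto
    qed
    then show ?thesis using gh by (auto simp: G_def)
  qed
  have zero: "0 \<in> G" using triv[of 0] by (auto simp: G_def)
  have mono: "single d k * g \<in> G" if g: "g \<in> G" and d: "d \<in> monomials n" for g d k
  proof -
    have "liftable (g * single d k) c" for c
    proof (cases "\<exists>b\<in>keys g. eqv (b + d) c")
      case False
      show ?thesis
      proof (rule triv)
        fix a assume "a \<in> keys (g * single d k)"
        then obtain b where "b \<in> keys g" "a = b + d"
          using keys_mult_subset[of a g "single d k"] by (auto split: if_splits)
        then show "\<not> eqv a c" using False by blast
      qed
    next
      case True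
      \<comment> \<open>By cancellation, all terms of \<open>g\<close> that the monomial
        \<open>d\<close> moves into class \<open>c\<close> belong to the class of \<open>b\<close>;
        so lift that class and multiply.\<close>
      then obtain b where b: "b \<in> keys g" "eqv (b + d) c" by blast
      obtain w where w: "w \<in> polys n" "\<forall>a\<in>keys w. low a b" "restr (\<lambda>a. eqv a b) g + w \<in> I"
        using g by (auto simp: G_def liftable_def)
      have "restr (\<lambda>a. eqv a c) (g * single d k) = restr (\<lambda>a. eqv a b) g * single d k"
      proof (rule restr_mult)
        fix a e assume "a \<in> keys g" "e \<in> keys (single d k)"
        then have e: "e = d" by (auto split: if_splits)
        have "eqv (a + d) c \<longleftrightarrow> eqv (a + d) (b + d)" using b(2) eqv_trans eqv_sym by blast
        also have "\<dots> \<longleftrightarrow> eqv a b" using eqv_add[OF d] by (simp add: add.commute[of _ d])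
        finally show "eqv (a + e) c \<longleftrightarrow> eqv a b" using e by simp
      qed
      then have eq: "restr (\<lambda>a. eqv a c) (g * single d k) + w * single d k
          = single d k * (restr (\<lambda>a. eqv a b) g + w)" by (simp add: algebra_simps)
      have "low a c" if a: "a \<in> keys (w * single d k)" for a
      proof -
        obtain e where "e \<in> keys w" "a = e + d"
          using a keys_mult_subset[of a w "single d k"] by (auto split: if_splits)
        then have "low a (b + d)" using w(2) low_add[OF d] by (simp add: add.commute[of _ d])
        then show ?thesis using b(2) low_eqv_trans by blast
      qed
      then show ?thesis unfolding liftable_def
        using w d idealD(4)[OF I _ w(3), of "single d k"] eq
        by (intro bexI[of _ "w * single d k"]) auto
    qed
    then show ?thesis using g d by (auto simp: G_def mult.commute)
  qed
  have mul: "f * g \<in> G" if g: "g \<in> G" and f: "f \<in> polys n" for f g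
  proof -
    have "(\<Sum>a\<in>S. single a (lookup f a) * g) \<in> G" if "finite S" "S \<subseteq> monomials n" for S
      using that by (induction S rule: finite_induct) (auto intro: zero add mono g)
    then have "(\<Sum>a\<in>keys f. single a (lookup f a) * g) \<in> G" using f by (simp add: polys_def)
    then show ?thesis using poly_expand[of f] by (simp flip: sum_distrib_right)
  qed
  have lead: "leading_part lt f \<in> G" if f: "f \<in> I" for f
  proof -
    have fp: "f \<in> polys n" using idealD(1)[OF I f] .
    have "liftable (leading_part lt f) c" for c
    proof (cases "\<exists>a\<in>keys (leading_part lt f). eqv a c")
      case False then show ?thesis using triv by blast
    next
      case True
      then obtain a where a: "a \<in> keys f" "\<And>b. b \<in> keys f \<Longrightarrow> \<not> lt a b" "eqv a c"
        by (auto simp: leading_part_restr keys_restr)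
      define w where "w = restr (\<lambda>b. low b c) f"
      \<comment> \<open>Class \<open>c\<close> contains a leading term of \<open>f\<close>, so in
        its degree \<open>f\<close> has only terms of class \<open>c\<close>, all of them leading,
        and lower ones. The homogeneous component of \<open>f\<close> is therefore the lift.\<close>
      have "restr (\<lambda>a. eqv a c) (leading_part lt f) + w = homogeneous_component (int (mon_deg c)) f"
      proof (rule poly_mapping_eqI)
        fix b
        show "lookup (restr (\<lambda>a. eqv a c) (leading_part lt f) + w) b =
              lookup (homogeneous_component (int (mon_deg c)) f) b"
        proof (cases "b \<in> keys f \<and> mon_deg b = mon_deg c")
          case False
          then show ?thesis
            by (auto simp: lookup_add lookup_restr leading_part_restr w_def
                homogeneous_component_restr low_def eqv_def in_keys_iff)
        next
          case True
          then have b: "b \<in> monomials n" using polysD fp by blast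
          have "low b c \<or> eqv b c"
          proof (rule ccontr)
            assume "\<not> (low b c \<or> eqv b c)"
            then have "low c b" using low_cases[of b c] b True a(3) by (auto simp: eqv_def)
            then have "low a b" using a(3) eqv_low_trans by blast
            then show False using a(2)[of b] True by (auto simp: low_def)
          qed
          moreover have "\<not> (\<exists>d\<in>keys f. lt b d)" if "eqv b c"
          proof
            assume "\<exists>d\<in>keys f. lt b d"
            then obtain d where d: "d \<in> keys f" "lt b d" by blast
            have "eqv a b" using a(3) that eqv_trans eqv_sym by blast
            then have "lt a d" using d polysD[OF fp] by (intro incomparable_lt[of a b d]) (auto simp: eqv_def)
            then show False using a(2) d by blast
          qed
          ultimately show ?thesis using True low_not_eqv[of b c]
            by (auto simp: lookup_add lookup_restr leading_part_restr w_def
                homogeneous_component_restr)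
        qed
      qed
      moreover have "homogeneous_component (int (mon_deg c)) f \<in> I"
        using hI f by (auto simp: homogeneous_ideal_def)
      ultimately show ?thesis unfolding liftable_def using fp
        by (intro bexI[of _ w]) (auto simp: w_def keys_restr)
    qed
    then show ?thesis using fp by (auto simp: G_def leading_part_restr)
  qed
  have "ideal G (mpoly_ring n)"
    unfolding ideal_mpoly_ring_iff using zero add mul by (auto simp: G_def)
  then have "leading_ideal n lt I \<subseteq> G"
    unfolding leading_ideal_def
    using lead cring_mpoly_ring[of n]
    by (intro ring.genideal_minimal) (auto simp: cring_def)
  then show ?thesis using g by (auto simp: G_def liftable_def)
qed

text \<open>Lift the component to an element of \<open>I\<close>; its top class is the component
  itself.\<close>

lemma leading_ideal_component:
  assumes hI: "homogeneous_ideal n I" and g: "g \<in> leading_ideal n lt I"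
  shows "restr (\<lambda>a. eqv a c) g \<in> leading_ideal n lt I"
proof -
  have I: "ideal I (mpoly_ring n)" using hI by (simp add: homogeneous_ideal_def)
  obtain w where w: "\<forall>a\<in>keys w. low a c" "restr (\<lambda>a. eqv a c) g + w \<in> I"
    using leading_ideal_lift[OF assms] by blast
  have "restr (\<lambda>a. eqv a c) (restr (\<lambda>a. eqv a c) g + w) \<in> leading_ideal n lt I"
  proof (rule top_class_in_leading_ideal[OF I w(2)])
    fix a assume "a \<in> keys (restr (\<lambda>a. eqv a c) g + w)"
    then show "leq a c" using w(1) keys_add[of "restr (\<lambda>a. eqv a c) g" w]
      by (auto simp: keys_restr leq_def)
  qed
  also have "restr (\<lambda>a. eqv a c) (restr (\<lambda>a. eqv a c) g + w) = restr (\<lambda>a. eqv a c) g"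
    using w(1) low_not_eqv by (auto simp: restr_add restr_restr restr_eq_0)
  finally show ?thesis .
qed

lemma leading_ideal_closed:
  assumes "homogeneous_ideal n I" "v \<in> ideal_vecs n (leading_ideal n lt I)"
  shows "vrestr (tdeg [0] c) v \<in> ideal_vecs n (leading_ideal n lt I)"
  using assms leading_ideal_component[OF assms(1), of "v 0" c]
  by (auto simp: ideal_vecs_def vrestr_apply tdeg_def)

lemma degenerates_leading_ideal:
  assumes hI: "homogeneous_ideal n I"
  shows "degenerates [0] (ideal_vecs n I) (ideal_vecs n (leading_ideal n lt I))"
proof -
  have I: "ideal I (mpoly_ring n)" using hI by (simp add: homogeneous_ideal_def)
  show ?thesis unfolding degenerates_def
  proof (intro conjI allI ballI impI)
    show "ideal_vecs n I \<subseteq> vecs n (length [0 :: mon])" by (auto simp: ideal_vecs_def)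
    show "vec_submodule n (ideal_vecs n I)" by (rule vec_submodule_ideal_vecs[OF I])
    show "vrestr (degv [0] d) v \<in> ideal_vecs n I" if v: "v \<in> ideal_vecs n I" for d v
    proof -
      have "homogeneous_component (int d) (v 0) \<in> I"
        using v hI by (auto simp: ideal_vecs_def homogeneous_ideal_def)
      then show ?thesis using v
        by (auto simp: ideal_vecs_def vrestr_apply degv_def homogeneous_component_restr)
    qed
    show "\<exists>w\<in>vecs n (length [0 :: mon]). lowv [0] c w \<and> u + w \<in> ideal_vecs n I"
      if u: "u \<in> ideal_vecs n (leading_ideal n lt I)" "homog [0] c u" for c u
    proof -
      obtain w where w: "w \<in> polys n" "\<forall>a\<in>keys w. low a c" "restr (\<lambda>a. eqv a c) (u 0) + w \<in> I"
        using leading_ideal_lift[OF hI, of "u 0" c] u(1) by (auto simp: ideal_vecs_def)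
      have "restr (\<lambda>a. eqv a c) (u 0) = u 0"
        using u(2) by (intro restr_eq_self) (auto dest: homogD)
      then show ?thesis using w u(1)
        by (intro bexI[of _ "\<lambda>l. if l = 0 then w else 0"])
          (auto simp: ideal_vecs_def vecs_def lowv_def split: if_splits)
    qed
    show "vrestr (tdeg [0] c) v \<in> ideal_vecs n (leading_ideal n lt I)"
      if v: "v \<in> ideal_vecs n I" "leqv [0] c v" for c v
    proof -
      have "leq a c" if "a \<in> keys (v 0)" for a
      proof -
        have "leq (a + [0] ! 0) c" using v(2) that unfolding leqv_def by blast
        then show ?thesis by simp
      qed
      then have "restr (\<lambda>a. eqv a c) (v 0) \<in> leading_ideal n lt I"
        using v(1) by (intro top_class_in_leading_ideal[OF I]) (auto simp: ideal_vecs_def)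
      then show ?thesis using v(1) by (auto simp: ideal_vecs_def vrestr_apply tdeg_def)
    qed
  qed
qed

text \<open>Each class lies in one degree, so a degree component is a sum of class
  components.\<close>

lemma homogeneous_leading_ideal:
  fixes I :: "'k::field mpoly set"
  assumes hI: "homogeneous_ideal n I"
  shows "homogeneous_ideal n (leading_ideal n lt I)"
proof -
  have I: "ideal I (mpoly_ring n)" using hI by (simp add: homogeneous_ideal_def)
  let ?L = "leading_ideal n lt I"
  have L: "ideal ?L (mpoly_ring n)" by (rule leading_ideal_ideal[OF I])
  have "homogeneous_component j f \<in> ?L" if f: "f \<in> ?L" for f j
  proof -
    define v where "v = (\<lambda>l::nat. if l = 0 then f else 0)"
    have v: "v \<in> ideal_vecs n ?L" using f idealD(1)[OF L]
      by (auto simp: v_def ideal_vecs_def vecs_def)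
    have "homogeneous_component j (v 0) \<in> ?L"
    proof (rule component_induct[OF v, where r = 1 and Q = "tdeg [0]"])
      show "v \<in> vecs n 1" using v by (simp add: ideal_vecs_def)
      show "vec_submodule n (ideal_vecs n ?L)" by (rule vec_submodule_ideal_vecs[OF L])
      show "\<exists>c. tdeg [0] c a l" if "a \<in> monomials n" "l < 1" for a l
        using that by (auto simp: tdeg_def intro!: exI[of _ a] eqv_refl)
      show "homogeneous_component j (vrestr (tdeg [0] c) u 0) \<in> ?L"
        if u: "u \<in> ideal_vecs n ?L" for c u
      proof -
        have "vrestr (tdeg [0] c) u 0 \<in> ?L"
          using leading_ideal_closed[OF hI u] by (simp add: ideal_vecs_def)
        moreover have "homogeneous_component j (vrestr (tdeg [0] c) u 0) =
            (if int (mon_deg c) = j then vrestr (tdeg [0] c) u 0 else 0)"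
          by (auto simp: homogeneous_component_restr vrestr_apply keys_restr tdeg_def eqv_def
              intro!: restr_eq_self restr_eq_0)
        ultimately show ?thesis using idealD(2)[OF L] by simp
      qed
    qed (auto simp: leading_ideal_closed[OF hI] homogeneous_component_restr restr_add
          idealD(2)[OF L] intro: idealD(3)[OF L])
    then show ?thesis by (simp add: v_def)
  qed
  then show ?thesis using L by (simp add: homogeneous_ideal_def)
qed

text \<open>Nothing lies \<open>low\<close> below the monomial \<open>0\<close>, so the constant
  term of \<open>g\<close> lifts without correction and already belongs to \<open>I\<close>.\<close>

lemma leading_ideal_proper:
  assumes hI: "homogeneous_ideal n I" "I \<noteq> polys n" and g: "g \<in> leading_ideal n lt I"
  shows "lookup g 0 = 0"
proof -
  obtain w where w: "\<forall>a\<in>keys w. low a 0" "restr (\<lambda>a. eqv a 0) g + w \<in> I"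
    using leading_ideal_lift[OF hI(1) g] by blast
  have "\<not> low a 0" for a using low_irrefl[of 0] by (cases "a = 0") (auto simp: low_def)
  then have "w = 0" using w(1) by (auto simp flip: keys_eq_empty)
  then have "restr (\<lambda>a. eqv a 0) g \<in> I" using w(2) by simp
  then have "lookup (restr (\<lambda>a. eqv a 0) g) 0 = 0" by (rule proper_homogeneous_ideal[OF hI])
  then show ?thesis by (simp add: lookup_restr eqv_refl)
qed

end

section \<open>Comparison of a minimal resolution with an arbitrary one\<close>

text \<open>The identity of \<open>k^S\<close> factors through \<open>k^T\<close>. In terms of
  spans: the unit vectors indexed by \<open>S\<close> are independent and lie in the span of the
  rows of \<beta>.\<close>

lemma card_le_if_factors:
  fixes \<alpha> \<beta> :: "nat \<Rightarrow> nat \<Rightarrow> 'k::field"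
  assumes fin: "finite S" "finite T"
    and fact: "\<And>l m. l \<in> S \<Longrightarrow> m \<in> S \<Longrightarrow> (\<Sum>p\<in>T. \<alpha> l p * \<beta> p m) = (if l = m then 1 else 0)"
  shows "card S \<le> card T"
proof -
  interpret vs: vector_space "\<lambda>(c::'k) (f :: nat \<Rightarrow> 'k) x. c * f x"
    by unfold_locales (auto simp: fun_eq_iff algebra_simps)
  define \<delta> :: "nat \<Rightarrow> nat \<Rightarrow> 'k" where "\<delta> l m = (if l = m then 1 else 0)" for l m
  \<comment> \<open>Truncated outside \<open>S\<close>, since the factorisation is known only for
    indices in \<open>S\<close>.\<close>
  define b where "b p m = (if m \<in> S then \<beta> p m else 0)" for p m
  have inj: "inj_on \<delta> S" by (auto simp: inj_on_def \<delta>_def fun_eq_iff)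
  have "vs.independent (\<delta> ` S)"
  proof
    assume "vs.dependent (\<delta> ` S)"
    then obtain u l where u: "l \<in> S" "u (\<delta> l) \<noteq> 0" "(\<Sum>v\<in>\<delta> ` S. (\<lambda>x. u v * v x)) = 0"
      using vs.dependent_finite[of "\<delta> ` S"] fin by auto
    have "0 = (\<Sum>v\<in>\<delta> ` S. (\<lambda>x. u v * v x)) l" using u by simp
    also have "\<dots> = (\<Sum>m\<in>S. u (\<delta> m) * \<delta> m l)" by (simp add: sum_vec_apply sum.reindex[OF inj])
    also have "\<dots> = (\<Sum>m\<in>S. if m = l then u (\<delta> l) else 0)" by (intro sum.cong) (auto simp: \<delta>_def)
    also have "\<dots> = u (\<delta> l)" using fin u by simp
    finally show False using u by simp
  qed
  moreover have "\<delta> ` S \<subseteq> vs.span (b ` T)"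
  proof
    fix x assume "x \<in> \<delta> ` S"
    then obtain l where l: "l \<in> S" "x = \<delta> l" by blast
    have "(\<Sum>p\<in>T. (\<lambda>m. \<alpha> l p * b p m)) m = x m" for m
      using l fact[of l m] by (cases "m \<in> S") (auto simp: sum_vec_apply b_def \<delta>_def)
    then have "x = (\<Sum>p\<in>T. (\<lambda>m. \<alpha> l p * b p m))" by (intro ext) simp
    also have "\<dots> \<in> vs.span (b ` T)" by (intro vs.span_sum vs.span_scale vs.span_base) auto
    finally show "x \<in> vs.span (b ` T)" .
  qed
  ultimately have "card (\<delta> ` S) \<le> card (b ` T)"
    using vs.independent_span_bound[of "b ` T" "\<delta> ` S"] fin by simp
  also have "\<dots> \<le> card T" using fin(2) by (rule card_image_le)
  finally show ?thesis using card_image[OF inj] by simp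
qed

lemma lookup_matapp_0:
  "lookup (matapp r A v m :: 'k::field mpoly) 0 = (\<Sum>l<r. lookup (v l) 0 * lookup (A l m) 0)"
  by (simp add: matapp_def lookup_sum lookup_mult_0)

section \<open>Free modules with integer shifts: the coarse counterparts of \<open>tdeg\<close>,
  \<open>homog\<close> and \<open>gmat\<close>\<close>

definition hdeg :: "int list \<Rightarrow> int \<Rightarrow> mon \<Rightarrow> nat \<Rightarrow> bool" where
  "hdeg ds j a l \<longleftrightarrow> int (mon_deg a) + ds ! l = j"

definition hvecs :: "nat \<Rightarrow> int list \<Rightarrow> int \<Rightarrow> 'k::field vec set" where
  "hvecs n ds j = {v \<in> vecs n (length ds). \<forall>l a. a \<in> keys (v l) \<longrightarrow> hdeg ds j a l}"

definition dmat :: "nat \<Rightarrow> int list \<Rightarrow> int list \<Rightarrow> (nat \<Rightarrow> 'k::field vec) \<Rightarrow> bool" where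
  "dmat n ds ds' A \<longleftrightarrow> (\<forall>l<length ds'. A l \<in> hvecs n ds (ds' ! l))"

lemma hvecs_vecs: "v \<in> hvecs n ds j \<Longrightarrow> v \<in> vecs n (length ds)"
  by (simp add: hvecs_def)

lemma hvecs_diff: "u \<in> hvecs n ds j \<Longrightarrow> v \<in> hvecs n ds j \<Longrightarrow> u - v \<in> hvecs n ds j"
  by (auto simp: hvecs_def dest!: subsetD[OF keys_minus_subset])

lemma hvecs_0 [simp]: "0 \<in> hvecs n ds j"
  by (auto simp: hvecs_def)

lemma hvecs_unit: "l < length ds \<Longrightarrow> unit_vec l \<in> hvecs n ds (ds ! l)"
  by (auto simp: hvecs_def hdeg_def) (auto simp: unit_vec_def split: if_splits)

lemma vrestr_hvecs: "v \<in> vecs n (length ds) \<Longrightarrow> vrestr (hdeg ds j) v \<in> hvecs n ds j"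
  by (auto simp: hvecs_def) (auto simp: vrestr_apply keys_restr)

lemma vrestr_hvecs_self: "v \<in> hvecs n ds j \<Longrightarrow> vrestr (hdeg ds j) v = v"
  by (rule vrestr_eq_self) (auto simp: hvecs_def)

lemma dmat_vecs: "dmat n ds ds' A \<Longrightarrow> l < length ds' \<Longrightarrow> A l \<in> vecs n (length ds)"
  by (auto simp: dmat_def hvecs_def)

lemma dmat_matapp_vecs:
  "dmat n ds ds' A \<Longrightarrow> v \<in> vecs n (length ds') \<Longrightarrow> matapp (length ds') A v \<in> vecs n (length ds)"
  by (rule matapp_vecs) (auto intro: dmat_vecs)

lemma vrestr_dmat:
  assumes "dmat n ds ds' A"
  shows "vrestr (hdeg ds j) (matapp (length ds') A v) = matapp (length ds') A (vrestr (hdeg ds' j) v)"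
proof (rule vrestr_matapp)
  fix l m a b assume "l < length ds'" "b \<in> keys (A l m)"
  then have "int (mon_deg b) + ds ! m = ds' ! l" using assms by (auto simp: dmat_def hvecs_def hdeg_def)
  then show "hdeg ds j (a + b) m \<longleftrightarrow> hdeg ds' j a l" by (auto simp: hdeg_def mon_deg_add)
qed

lemma dmat_matapp_hvecs:
  assumes "dmat n ds ds' A" "v \<in> hvecs n ds' j"
  shows "matapp (length ds') A v \<in> hvecs n ds j"
  using vrestr_hvecs[OF dmat_matapp_vecs[OF assms(1) hvecs_vecs[OF assms(2)]], of j]
  by (simp add: vrestr_dmat[OF assms(1)] vrestr_hvecs_self[OF assms(2)])

text \<open>Constants have degree 0 and thus connect only basis vectors of equal shift; this allows
  counting each shift \<open>j\<close> separately.\<close>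

lemma dmat_constant:
  assumes "dmat n ds ds' A" "l < length ds'" "lookup (A l m) 0 \<noteq> 0"
  shows "m < length ds \<and> ds ! m = ds' ! l"
proof -
  have A: "A l \<in> hvecs n ds (ds' ! l)" using assms by (simp add: dmat_def)
  have "0 \<in> keys (A l m)" using assms by (simp add: in_keys_iff)
  moreover from this have "int (mon_deg 0) + ds ! m = ds' ! l"
    using A unfolding hvecs_def hdeg_def by blast
  ultimately show ?thesis using vecs_keys[OF hvecs_vecs[OF A]] by simp
qed

text \<open>A graded free resolution of \<open>k[X]/I\<close> is treated as an augmented complex with \<open>k[X]\<close> itself
  in position \<open>0\<close> and all indices shifted by one; equality in the quotient becomes congruence
  modulo \<open>I\<close>. With \<open>slack 0 = I\<close> and \<open>slack i = 0\<close> otherwise, exactness reads the same everywhere: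
  \<open>cycles\<close> are boundaries up to \<open>slack\<close>.\<close>

definition slack :: "nat \<Rightarrow> 'k::field mpoly set \<Rightarrow> nat \<Rightarrow> 'k vec set" where
  "slack n I i = (if i = 0 then ideal_vecs n I else {0})"

definition diff_map :: "(nat \<Rightarrow> int list) \<Rightarrow> (nat \<Rightarrow> nat \<Rightarrow> 'k::field vec) \<Rightarrow> nat \<Rightarrow> 'k vec \<Rightarrow> 'k vec" where
  "diff_map ds A i v = matapp (length (ds (Suc i))) (A i) v"

text \<open>Position 0 imposes no condition, so exactness there means surjectivity onto
  \<open>k[X]/I\<close>; at position 1 the image has to lie in \<open>I\<close>.\<close>

definition cycles :: "nat \<Rightarrow> 'k::field mpoly set \<Rightarrow> (nat \<Rightarrow> int list) \<Rightarrow> (nat \<Rightarrow> nat \<Rightarrow> 'k vec) \<Rightarrow>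
    nat \<Rightarrow> 'k vec set" where
  "cycles n I ds A i = {v \<in> vecs n (length (ds i)).
     \<forall>k. i = Suc k \<longrightarrow> diff_map ds A k v \<in> slack n I k}"

definition resolves :: "nat \<Rightarrow> 'k::field mpoly set \<Rightarrow> (nat \<Rightarrow> int list) \<Rightarrow>
    (nat \<Rightarrow> nat \<Rightarrow> 'k vec) \<Rightarrow> bool" where
  "resolves n I ds A \<longleftrightarrow> ds 0 = [0] \<and> (\<forall>i. dmat n (ds i) (ds (Suc i)) (A i)) \<and>
     (\<forall>i. \<forall>w\<in>vecs n (length (ds (Suc i))). diff_map ds A i w \<in> cycles n I ds A i) \<and>
     (\<forall>i. \<forall>v\<in>cycles n I ds A i. \<exists>w\<in>vecs n (length (ds (Suc i))). diff_map ds A i w - v \<in> slack n I i)"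

lemma vec_submodule_slack: "ideal I (mpoly_ring n) \<Longrightarrow> vec_submodule n (slack n I i)"
  using vec_submodule_ideal_vecs[of I n] by (auto simp: slack_def vec_submodule_def fun_eq_iff)

lemma vrestr_slack:
  assumes "homogeneous_ideal n I" "ds 0 = [0]" "v \<in> slack n I i"
  shows "vrestr (hdeg (ds i) j) v \<in> slack n I i"
  using assms
  by (auto simp: slack_def ideal_vecs_def vrestr_apply hdeg_def homogeneous_ideal_def
      homogeneous_component_restr split: if_splits)

section \<open>Chain maps, homotopies and the comparison of ranks\<close>

context
  fixes n :: nat and I :: "'k::field mpoly set"
  assumes hI: "homogeneous_ideal n I"
begin

lemma ideal_I: "ideal I (mpoly_ring n)"
  using hI by (simp add: homogeneous_ideal_def)

lemmas slack_sub = vec_submodule_slack[OF ideal_I]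

text \<open>Projectivity of graded free modules. Preimages of the rows are replaced by their
  components of the right degree, so that the lifted matrix is again graded.\<close>

lemma lift_through_resolution:
  assumes res: "resolves n I es B" and T: "dmat n (es i) ds' T"
    and cyc: "\<And>l. l < length ds' \<Longrightarrow> T l \<in> cycles n I es B i"
  shows "\<exists>S. dmat n (es (Suc i)) ds' S \<and> (\<forall>v\<in>vecs n (length ds').
     diff_map es B i (matapp (length ds') S v) - matapp (length ds') T v \<in> slack n I i)"
proof -
  let ?r = "length (es (Suc i))"
  have B: "dmat n (es i) (es (Suc i)) (B i)" and e0: "es 0 = [0]" using res by (auto simp: resolves_def)
  have "\<exists>w\<in>hvecs n (es (Suc i)) (ds' ! l). diff_map es B i w - T l \<in> slack n I i"
    if l: "l < length ds'" for l
  proof -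
    obtain w where w: "w \<in> vecs n ?r" "diff_map es B i w - T l \<in> slack n I i"
      using res cyc[OF l] unfolding resolves_def by blast
    have "vrestr (hdeg (es i) (ds' ! l)) (diff_map es B i w - T l) \<in> slack n I i"
      using vrestr_slack[where ds = es, OF hI e0 w(2)] .
    then have "diff_map es B i (vrestr (hdeg (es (Suc i)) (ds' ! l)) w) - T l \<in> slack n I i"
      using T l by (simp add: vrestr_diff diff_map_def vrestr_dmat[OF B] vrestr_hvecs_self[where n = n] dmat_def)
    then show ?thesis using vrestr_hvecs[OF w(1)] by blast
  qed
  then obtain S where S: "\<And>l. l < length ds' \<Longrightarrow> S l \<in> hvecs n (es (Suc i)) (ds' ! l)"
     "\<And>l. l < length ds' \<Longrightarrow> diff_map es B i (S l) - T l \<in> slack n I i" by metis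
  have "diff_map es B i (matapp (length ds') S v) - matapp (length ds') T v \<in> slack n I i"
    if "v \<in> vecs n (length ds')" for v
  proof -
    have "diff_map es B i (matapp (length ds') S v) - matapp (length ds') T v =
      matapp (length ds') (\<lambda>l. diff_map es B i (S l) - T l) v"
      by (simp add: diff_map_def matapp_matapp matapp_mat_diff)
    then show ?thesis using vec_submodule_matapp[OF slack_sub S(2) that] by simp
  qed
  then show ?thesis using S(1) by (intro exI[of _ S]) (auto simp: dmat_def)
qed

text \<open>At position 0 the second clause says that the map descends to
  \<open>k[X]/I\<close>.\<close>

definition chain_map :: "(nat \<Rightarrow> int list) \<Rightarrow> (nat \<Rightarrow> nat \<Rightarrow> 'k vec) \<Rightarrow> (nat \<Rightarrow> int list) \<Rightarrow>
    (nat \<Rightarrow> nat \<Rightarrow> 'k vec) \<Rightarrow> (nat \<Rightarrow> nat \<Rightarrow> 'k vec) \<Rightarrow> bool" where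
  "chain_map ds A es B f \<longleftrightarrow> (\<forall>i. dmat n (es i) (ds i) (f i)) \<and>
     (\<forall>i. \<forall>v\<in>slack n I i. matapp (length (ds i)) (f i) v \<in> slack n I i) \<and>
     (\<forall>i. \<forall>v\<in>vecs n (length (ds (Suc i))).
        diff_map es B i (matapp (length (ds (Suc i))) (f (Suc i)) v) -
        matapp (length (ds i)) (f i) (diff_map ds A i v) \<in> slack n I i)"

lemma slack_trans:
  assumes "u - v \<in> slack n I i" "v - w \<in> slack n I i" shows "u - w \<in> slack n I i"
  using vec_submoduleD(2)[OF slack_sub assms] by simp

lemma slack_mem:
  assumes "u - v \<in> slack n I i" "v \<in> slack n I i" shows "u \<in> slack n I i"
  using vec_submoduleD(2)[OF slack_sub assms] by simp

text \<open>Starting from the identity of \<open>k[X]\<close> at position 0 makes the chain map a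
  lift of the identity of \<open>k[X]/I\<close>.\<close>

lemma chain_map_exists:
  assumes F: "resolves n I ds A" and G: "resolves n I es B"
  shows "\<exists>f. f 0 = unit_vec \<and> chain_map ds A es B f"
proof -
  \<comment> \<open>That cycles go to cycles is what allows the next lift.\<close>
  define P where "P i fi \<longleftrightarrow> dmat n (es i) (ds i) fi \<and> (i = 0 \<longrightarrow> fi = unit_vec) \<and>
     (\<forall>v\<in>slack n I i. matapp (length (ds i)) fi v \<in> slack n I i) \<and>
     (\<forall>v\<in>cycles n I ds A i. matapp (length (ds i)) fi v \<in> cycles n I es B i)"
    for i and fi :: "nat \<Rightarrow> 'k vec"
  define R where "R i fi g \<longleftrightarrow> (\<forall>v\<in>vecs n (length (ds (Suc i))).
        diff_map es B i (matapp (length (ds (Suc i))) g v) -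
        matapp (length (ds i)) fi (diff_map ds A i v) \<in> slack n I i)"
    for i and fi g :: "nat \<Rightarrow> 'k vec"
  have A: "\<And>i. dmat n (ds i) (ds (Suc i)) (A i)" "ds 0 = [0]" "es 0 = [0]"
    and A_cyc: "\<And>i w. w \<in> vecs n (length (ds (Suc i))) \<Longrightarrow> diff_map ds A i w \<in> cycles n I ds A i"
    using F G by (auto simp: resolves_def)
  have "\<exists>f. \<forall>i. P i (f i) \<and> R i (f i) (f (Suc i))"
  proof (rule dependent_nat_choice)
    have "P 0 unit_vec"
      unfolding P_def using A(2,3) hvecs_unit[of _ "[0]" n]
      by (auto simp: dmat_def cycles_def slack_def ideal_vecs_def matapp_id)
    then show "\<exists>f. P 0 f" by blast
    fix fi i assume fi: "P i fi"
    define T where "T l = matapp (length (ds i)) fi (A i l)" for l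
    have T: "dmat n (es i) (ds (Suc i)) T"
      using fi A(1)[of i] dmat_matapp_hvecs unfolding dmat_def P_def T_def by blast
    have T_cyc: "T l \<in> cycles n I es B i" if "l < length (ds (Suc i))" for l
    proof -
      have "A i l \<in> cycles n I ds A i" using A_cyc[of "unit_vec l" i] that by (simp add: diff_map_def)
      then show ?thesis using fi by (auto simp: P_def T_def)
    qed
    obtain S where S: "dmat n (es (Suc i)) (ds (Suc i)) S"
      "\<And>v. v \<in> vecs n (length (ds (Suc i))) \<Longrightarrow> diff_map es B i (matapp (length (ds (Suc i))) S v) -
          matapp (length (ds (Suc i))) T v \<in> slack n I i"
      using lift_through_resolution[OF G T T_cyc] by blast
    have R: "R i fi S" unfolding R_def
    proof
      fix v :: "'k vec" assume v: "v \<in> vecs n (length (ds (Suc i)))"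
      have "matapp (length (ds (Suc i))) T v = matapp (length (ds i)) fi (diff_map ds A i v)"
        unfolding diff_map_def matapp_matapp T_def[abs_def] ..
      then show "diff_map es B i (matapp (length (ds (Suc i))) S v) -
        matapp (length (ds i)) fi (diff_map ds A i v) \<in> slack n I i" using S(2)[OF v] by simp
    qed
    have "matapp (length (ds (Suc i))) S v \<in> cycles n I es B (Suc i)"
      if v: "v \<in> cycles n I ds A (Suc i)" for v
    proof -
      have vv: "v \<in> vecs n (length (ds (Suc i)))" "diff_map ds A i v \<in> slack n I i"
        using v by (auto simp: cycles_def)
      then have "matapp (length (ds i)) fi (diff_map ds A i v) \<in> slack n I i"
        using fi by (auto simp: P_def)
      then have "diff_map es B i (matapp (length (ds (Suc i))) S v) \<in> slack n I i"
        using R vv(1) slack_mem unfolding R_def by blast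
      then show ?thesis using dmat_matapp_vecs[OF S(1) vv(1)] by (auto simp: cycles_def)
    qed
    then have "P (Suc i) S" using S(1) by (auto simp: P_def slack_def)
    then show "\<exists>g. P (Suc i) g \<and> R i fi g" using R by blast
  qed
  then obtain f where f: "\<And>i. P i (f i)" "\<And>i. R i (f i) (f (Suc i))" by blast
  have "f 0 = unit_vec" using f(1)[of 0] by (simp add: P_def)
  moreover have "chain_map ds A es B f"
    unfolding chain_map_def using f unfolding P_def R_def by blast
  ultimately show ?thesis by blast
qed

text \<open>\<open>D\<close> lifts the zero map, so the homotopy can start with
  \<open>h 0 = 0\<close>. The homotopy formula is an equation and not just a congruence, because
  \<open>slack\<close> vanishes from position 1 on.\<close>

lemma null_homotopy:
  assumes F: "resolves n I ds A" and D: "chain_map ds A ds A D"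
    and D0: "\<And>v. matapp (length (ds 0)) (D 0) v = 0"
  shows "\<exists>h. (\<forall>i. dmat n (ds (Suc i)) (ds i) (h i)) \<and> h 0 = (\<lambda>l. 0) \<and>
     (\<forall>i. \<forall>v\<in>vecs n (length (ds (Suc i))). matapp (length (ds (Suc i))) (D (Suc i)) v =
       diff_map ds A (Suc i) (matapp (length (ds (Suc i))) (h (Suc i)) v) +
       matapp (length (ds i)) (h i) (diff_map ds A i v))"
proof -
  let ?r = "\<lambda>i. length (ds i)"
  define P where "P i h \<longleftrightarrow> dmat n (ds (Suc i)) (ds i) h \<and> (i = 0 \<longrightarrow> h = (\<lambda>l. 0)) \<and>
     (\<forall>v\<in>cycles n I ds A i. diff_map ds A i (matapp (?r i) h v) - matapp (?r i) (D i) v \<in> slack n I i)"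
    for i and h :: "nat \<Rightarrow> 'k vec"
  define R where "R i h h' \<longleftrightarrow> (\<forall>v\<in>vecs n (?r (Suc i)). matapp (?r (Suc i)) (D (Suc i)) v =
       diff_map ds A (Suc i) (matapp (?r (Suc i)) h' v) + matapp (?r i) h (diff_map ds A i v))"
    for i and h h' :: "nat \<Rightarrow> 'k vec"
  have A: "\<And>i. dmat n (ds i) (ds (Suc i)) (A i)"
    and A_cyc: "\<And>i w. w \<in> vecs n (?r (Suc i)) \<Longrightarrow> diff_map ds A i w \<in> cycles n I ds A i"
    using F by (auto simp: resolves_def)
  have D_mat: "dmat n (ds i) (ds i) (D i)"
    and D_com: "v \<in> vecs n (?r (Suc i)) \<Longrightarrow> diff_map ds A i (matapp (?r (Suc i)) (D (Suc i)) v) -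
        matapp (?r i) (D i) (diff_map ds A i v) \<in> slack n I i" for i v
    using D by (auto simp: chain_map_def)
  have m0: "matapp r (\<lambda>l. 0) v = 0" for r and v :: "'k vec" by (auto simp: matapp_def fun_eq_iff)
  have "\<exists>h. \<forall>i. P i (h i) \<and> R i (h i) (h (Suc i))"
  proof (rule dependent_nat_choice)
    have "P 0 (\<lambda>l. 0)"
      using D0 vec_submoduleD(1)[OF slack_sub] by (auto simp: P_def dmat_def m0 diff_map_def)
    then show "\<exists>h. P 0 h" by blast
    fix h i assume h: "P i h"
    \<comment> \<open>By the homotopy property one position lower, \<open>D - h d\<close> takes
      values in cycles and can be lifted to the next \<open>h\<close>.\<close>
    define T where "T l = D (Suc i) l - matapp (?r i) h (A i l)" for l
    have T_app: "matapp (?r (Suc i)) T v =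
        matapp (?r (Suc i)) (D (Suc i)) v - matapp (?r i) h (diff_map ds A i v)" for v
      by (simp add: T_def[abs_def] matapp_mat_diff diff_map_def matapp_matapp)
    have T: "dmat n (ds (Suc i)) (ds (Suc i)) T"
      unfolding dmat_def T_def
    proof (intro allI impI hvecs_diff)
      fix l assume l: "l < ?r (Suc i)"
      show "D (Suc i) l \<in> hvecs n (ds (Suc i)) (ds (Suc i) ! l)" using D_mat l by (simp add: dmat_def)
      show "matapp (?r i) h (A i l) \<in> hvecs n (ds (Suc i)) (ds (Suc i) ! l)"
        using h A[of i] l by (intro dmat_matapp_hvecs) (auto simp: P_def dmat_def)
    qed
    have T_cyc: "T l \<in> cycles n I ds A (Suc i)" if l: "l < ?r (Suc i)" for l
    proof -
      let ?u = "unit_vec l"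
      have u: "?u \<in> vecs n (?r (Suc i))" using l by simp
      let ?d = "diff_map ds A i ?u"
      have "diff_map ds A i (matapp (?r (Suc i)) (D (Suc i)) ?u) - matapp (?r i) (D i) ?d \<in> slack n I i"
        using D_com[OF u] .
      moreover have "diff_map ds A i (matapp (?r i) h ?d) - matapp (?r i) (D i) ?d \<in> slack n I i"
        using h A_cyc[OF u] by (auto simp: P_def)
      ultimately have "(diff_map ds A i (matapp (?r (Suc i)) (D (Suc i)) ?u) - matapp (?r i) (D i) ?d) -
         (diff_map ds A i (matapp (?r i) h ?d) - matapp (?r i) (D i) ?d) \<in> slack n I i"
        by (rule vec_submodule_diff[OF slack_sub])
      moreover have "T l = matapp (?r (Suc i)) T ?u" using l by simp
      ultimately have "diff_map ds A i (T l) \<in> slack n I i"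
        by (simp add: T_app diff_map_def matapp_diff)
      then show ?thesis using dmat_vecs[OF T l] by (auto simp: cycles_def)
    qed
    obtain S where S: "dmat n (ds (Suc (Suc i))) (ds (Suc i)) S"
      "\<And>v. v \<in> vecs n (?r (Suc i)) \<Longrightarrow> diff_map ds A (Suc i) (matapp (?r (Suc i)) S v) -
          matapp (?r (Suc i)) T v \<in> slack n I (Suc i)"
      using lift_through_resolution[OF F T T_cyc] by blast
    have eq: "diff_map ds A (Suc i) (matapp (?r (Suc i)) S v) = matapp (?r (Suc i)) T v"
      if "v \<in> vecs n (?r (Suc i))" for v
      using S(2)[OF that] by (simp add: slack_def)
    have R: "R i h S" unfolding R_def
    proof
      fix v :: "'k vec" assume "v \<in> vecs n (?r (Suc i))"
      from eq[OF this] show "matapp (?r (Suc i)) (D (Suc i)) v =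
       diff_map ds A (Suc i) (matapp (?r (Suc i)) S v) + matapp (?r i) h (diff_map ds A i v)"
        unfolding T_app by simp
    qed
    have "diff_map ds A (Suc i) (matapp (?r (Suc i)) S v) - matapp (?r (Suc i)) (D (Suc i)) v = 0"
      if v: "v \<in> cycles n I ds A (Suc i)" for v
    proof -
      have vv: "v \<in> vecs n (?r (Suc i))" "diff_map ds A i v \<in> slack n I i"
        using v by (auto simp: cycles_def)
      \<comment> \<open>For \<open>i = 0\<close> the boundary of \<open>v\<close> may be a nonzero
        element of \<open>I\<close>, but \<open>h\<close> is zero; for larger \<open>i\<close> the
        boundary is zero.\<close>
      have "matapp (?r i) h (diff_map ds A i v) = 0"
        using h vv(2) m0 by (cases "i = 0") (auto simp: P_def slack_def)
      then show ?thesis using eq[OF vv(1)] by (simp add: T_app)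
    qed
    then have "P (Suc i) S" using S(1) by (auto simp: P_def slack_def)
    then show "\<exists>h'. P (Suc i) h' \<and> R i h h'" using R by blast
  qed
  then obtain h where h: "\<And>i. P i (h i)" "\<And>i. R i (h i) (h (Suc i))" by blast
  have "h 0 = (\<lambda>l. 0)" using h(1)[of 0] by (simp add: P_def)
  then show ?thesis using h unfolding P_def R_def by blast
qed

text \<open>The constant terms of \<open>g\<close> after \<open>f\<close> form the identity matrix,
  by \<open>null_homotopy\<close> and minimality. Restricted to the basis vectors of shift
  \<open>j\<close> this is the factorisation in \<open>card_le_if_factors\<close>.\<close>

lemma minimal_resolution_count_le:
  assumes F: "resolves n I ds A" and G: "resolves n I es B"
    and min: "\<And>i l m. l < length (ds (Suc (Suc i))) \<Longrightarrow> lookup (A (Suc i) l m) 0 = 0"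
  shows "count_list (ds (Suc i)) j \<le> count_list (es (Suc i)) j"
proof -
  let ?r = "\<lambda>i. length (ds i)" and ?s = "\<lambda>i. length (es i)"
  obtain f where f: "f 0 = unit_vec" "chain_map ds A es B f" using chain_map_exists[OF F G] by blast
  obtain g where g: "g 0 = unit_vec" "chain_map es B ds A g" using chain_map_exists[OF G F] by blast
  have f_mat: "dmat n (es i) (ds i) (f i)" and g_mat: "dmat n (ds i) (es i) (g i)" for i
    using f g by (auto simp: chain_map_def)
  have zero: "ds 0 = [0]" "es 0 = [0]" using F G by (auto simp: resolves_def)
  have A: "dmat n (ds i) (ds (Suc i)) (A i)" for i using F by (simp add: resolves_def)
  define D where "D i l = matapp (?s i) (g i) (f i l) - unit_vec l" for i l
  have D_app: "matapp (?r i) (D i) v = matapp (?s i) (g i) (matapp (?r i) (f i) v) - v"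
    if "v \<in> vecs n (?r i)" for i v
    using that by (simp add: D_def[abs_def] matapp_mat_diff matapp_matapp matapp_id)
  have D: "chain_map ds A ds A D"
    unfolding chain_map_def
  proof (intro conjI allI ballI)
    show "dmat n (ds i) (ds i) (D i)" for i
      unfolding dmat_def D_def
      using f_mat g_mat by (auto intro!: hvecs_diff dmat_matapp_hvecs hvecs_unit simp: dmat_def)
    show "matapp (?r i) (D i) v \<in> slack n I i" if v: "v \<in> slack n I i" for i v
    proof -
      have "v \<in> vecs n (?r i)" using v zero by (auto simp: slack_def ideal_vecs_def split: if_splits)
      moreover have "matapp (?s i) (g i) (matapp (?r i) (f i) v) \<in> slack n I i"
        using v f(2) g(2) unfolding chain_map_def by blast
      ultimately show ?thesis using D_app v vec_submodule_diff[OF slack_sub] by simp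
    qed
    show "diff_map ds A i (matapp (?r (Suc i)) (D (Suc i)) v) - matapp (?r i) (D i) (diff_map ds A i v)
      \<in> slack n I i" if v: "v \<in> vecs n (?r (Suc i))" for i v
    proof -
      let ?fv = "matapp (?r (Suc i)) (f (Suc i)) v"
      have fv: "?fv \<in> vecs n (?s (Suc i))" using dmat_matapp_vecs[OF f_mat v] .
      have dv: "diff_map ds A i v \<in> vecs n (?r i)"
        using dmat_matapp_vecs[OF A v] by (simp add: diff_map_def)
      have 1: "diff_map ds A i (matapp (?s (Suc i)) (g (Suc i)) ?fv)
           - matapp (?s i) (g i) (diff_map es B i ?fv) \<in> slack n I i"
        using g(2) fv unfolding chain_map_def by blast
      have "diff_map es B i ?fv - matapp (?r i) (f i) (diff_map ds A i v) \<in> slack n I i"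
        using f(2) v unfolding chain_map_def by blast
      then have "matapp (?s i) (g i) (diff_map es B i ?fv - matapp (?r i) (f i) (diff_map ds A i v))
         \<in> slack n I i"
        using g(2) unfolding chain_map_def by blast
      then have "matapp (?s i) (g i) (diff_map es B i ?fv) -
         matapp (?s i) (g i) (matapp (?r i) (f i) (diff_map ds A i v)) \<in> slack n I i"
        by (simp add: matapp_diff)
      from slack_trans[OF 1 this] show ?thesis
        using D_app[OF v] D_app[OF dv] by (simp add: diff_map_def matapp_diff)
    qed
  qed
  have "D 0 l = 0" if "l < 1" for l
    using that zero f(1) g(1) by (simp add: D_def)
  then have D0: "matapp (?r 0) (D 0) v = 0" for v
    using zero by (auto simp: matapp_def fun_eq_iff)
  obtain h where h: "\<And>i. dmat n (ds (Suc i)) (ds i) (h i)" "h 0 = (\<lambda>l. 0)"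
    "\<And>i v. v \<in> vecs n (?r (Suc i)) \<Longrightarrow> matapp (?r (Suc i)) (D (Suc i)) v =
       diff_map ds A (Suc i) (matapp (?r (Suc i)) (h (Suc i)) v) + matapp (?r i) (h i) (diff_map ds A i v)"
    using null_homotopy[OF F D D0] by blast
  have D_const: "lookup (D (Suc i) l m) 0 = 0" if l: "l < ?r (Suc i)" for l m
  proof -
    have "D (Suc i) l = diff_map ds A (Suc i) (matapp (?r (Suc i)) (h (Suc i)) (unit_vec l)) +
       matapp (?r i) (h i) (A i l)"
      using h(3)[of "unit_vec l" i] l by (simp add: diff_map_def)
    moreover have "lookup (diff_map ds A (Suc i) w m) 0 = 0" for w
      using min by (simp add: diff_map_def lookup_matapp_0)
    \<comment> \<open>\<open>A 0\<close> is the augmentation and may have constant entries, so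
      minimality does not cover it; there \<open>h 0 = 0\<close> helps.\<close>
    moreover have "lookup (matapp (?r i) (h i) (A i l) m) 0 = 0"
    proof (cases i)
      case 0 then show ?thesis using h(2) by (simp add: lookup_matapp_0)
    next
      case (Suc k) then show ?thesis using min l by (simp add: lookup_matapp_0)
    qed
    ultimately show ?thesis by (simp add: lookup_add)
  qed
  define S where "S = {l. l < ?r (Suc i) \<and> ds (Suc i) ! l = j}"
  define T where "T = {l. l < ?s (Suc i) \<and> es (Suc i) ! l = j}"
  have "(\<Sum>p\<in>T. lookup (f (Suc i) l p) 0 * lookup (g (Suc i) p m) 0) = (if l = m then 1 else 0)"
    if lm: "l \<in> S" "m \<in> S" for l m
  proof -
    have "(\<Sum>p\<in>T. lookup (f (Suc i) l p) 0 * lookup (g (Suc i) p m) 0) =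
       (\<Sum>p<?s (Suc i). lookup (f (Suc i) l p) 0 * lookup (g (Suc i) p m) 0)"
      \<comment> \<open>Positions of \<open>es (Suc i)\<close> with a shift other than
        \<open>j\<close> contribute nothing.\<close>
      using lm dmat_constant[OF f_mat, of l "Suc i"]
      by (intro sum.mono_neutral_left) (auto simp: T_def S_def)
    also have "\<dots> = lookup (matapp (?s (Suc i)) (g (Suc i)) (f (Suc i) l) m) 0"
      by (simp add: lookup_matapp_0)
    also have "\<dots> = lookup (D (Suc i) l m) 0 + lookup (unit_vec l m) 0"
      by (simp add: D_def lookup_minus)
    also have "\<dots> = (if l = m then 1 else 0)"
      using D_const[of l m] lm by (simp add: S_def unit_vec_def lookup_one)
    finally show ?thesis .
  qed
  then have "card S \<le> card T"
    by (intro card_le_if_factors[where \<alpha> = "\<lambda>l p. lookup (f (Suc i) l p) 0"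
          and \<beta> = "\<lambda>p m. lookup (g (Suc i) p m) 0"]) (auto simp: S_def T_def)
  then show ?thesis
    by (simp add: S_def T_def count_list_eq_length_filter length_filter_conv_card eq_commute)
qed

end

section \<open>Resolutions as sequences of matrices\<close>

lemma gfm_simps:
  "carrier (graded_free_module n ds) = vecs n (length ds)"
  "zero (graded_free_module n ds) = 0"
  "add (graded_free_module n ds) = (+)"
  "smult (graded_free_module n ds) = smul"
  "gcomp (graded_free_module n ds) j = hvecs n ds j"
proof -
  show c: "carrier (graded_free_module n ds) = vecs n (length ds)"
    by (auto simp: graded_free_module_def vecs_def) (metis linorder_not_le polys_0)
  show "zero (graded_free_module n ds) = 0" "add (graded_free_module n ds) = (+)"
    "smult (graded_free_module n ds) = smul"
    by (auto simp: graded_free_module_def smul_def fun_eq_iff)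
  have "v \<in> gcomp (graded_free_module n ds) j \<longleftrightarrow> v \<in> hvecs n ds j" for v
  proof -
    have "v \<in> gcomp (graded_free_module n ds) j \<longleftrightarrow>
       v \<in> vecs n (length ds) \<and> (\<forall>l<length ds. v l \<in> homogeneous_polys n (j - ds ! l))"
      unfolding c[symmetric] by (auto simp: graded_free_module_def)
    also have "\<dots> \<longleftrightarrow> v \<in> hvecs n ds j"
    proof (cases "v \<in> vecs n (length ds)")
      case True
      have "(\<forall>l<length ds. v l \<in> homogeneous_polys n (j - ds ! l)) \<longleftrightarrow>
            (\<forall>l<length ds. \<forall>a\<in>keys (v l). hdeg ds j a l)"
        using vecsD(1)[OF True] by (fastforce simp: homogeneous_polys_def hdeg_def)
      also have "\<dots> \<longleftrightarrow> (\<forall>l a. a \<in> keys (v l) \<longrightarrow> hdeg ds j a l)"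
        using vecs_keys[OF True] by blast
      finally show ?thesis using True by (simp add: hvecs_def)
    qed (auto simp: hvecs_def)
    finally show ?thesis .
  qed
  then show "gcomp (graded_free_module n ds) j = hvecs n ds j" by blast
qed

text \<open>Stated for a relation \<open>R\<close> so that one induction serves two cases: maps
  between free modules, with \<open>R\<close> equality, and the augmentation, where \<open>R\<close>
  says that a coset is represented by the value of the matrix.\<close>

lemma linear_matapp:
  fixes h :: "'k::field vec \<Rightarrow> 'b"
  assumes h_add: "\<And>u v. u \<in> vecs n r \<Longrightarrow> v \<in> vecs n r \<Longrightarrow> h (u + v) = plus' (h u) (h v)"
    and h_smul: "\<And>f v. f \<in> polys n \<Longrightarrow> v \<in> vecs n r \<Longrightarrow> h (smul f v) = smul' f (h v)"
    and R0: "R (h 0) 0"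
    and R_add: "\<And>x y u v. R x u \<Longrightarrow> R y v \<Longrightarrow> R (plus' x y) (u + v)"
    and R_smul: "\<And>f x u. f \<in> polys n \<Longrightarrow> R x u \<Longrightarrow> R (smul' f x) (smul f u)"
    and R_unit: "\<And>l. l < r \<Longrightarrow> R (h (unit_vec l)) (A l)"
    and v: "v \<in> vecs n r"
  shows "R (h v) (matapp r A v)"
proof -
  have "R (h (\<Sum>l<k. smul (v l) (unit_vec l))) (\<Sum>l<k. smul (v l) (A l))" if "k \<le> r" for k
    using that
  proof (induction k)
    case 0 show ?case using R0 by (simp only: lessThan_0 sum.empty)
  next
    case (Suc k)
    have in_vecs: "(\<Sum>l<k. smul (v l) (unit_vec l)) \<in> vecs n r"
    proof -
      have "(\<Sum>l\<in>S. smul (v l) (unit_vec l)) \<in> vecs n r" if "S \<subseteq> {..<r}" for S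
        using that vecsD(1)[OF v] by (induction S rule: infinite_finite_induct) auto
      then show ?thesis using Suc.prems by (auto simp: subset_iff)
    qed
    have k: "k < r" "v k \<in> polys n" using Suc.prems vecsD(1)[OF v] by auto
    then have unit: "unit_vec k \<in> vecs n r" "smul (v k) (unit_vec k) \<in> vecs n r" by auto
    have "R (plus' (h (\<Sum>l<k. smul (v l) (unit_vec l))) (smul' (v k) (h (unit_vec k))))
       ((\<Sum>l<k. smul (v l) (A l)) + smul (v k) (A k))"
      by (intro R_add R_smul R_unit Suc.IH) (use k in auto)
    then show ?case
      by (simp only: sum.lessThan_Suc h_add[OF in_vecs unit(2)] h_smul[OF k(2) unit(1)])
  qed
  from this[of r] show ?thesis
    using matapp_id[OF v] by (simp add: matapp_as_sum)
qed

section \<open>Cosets and the quotient module\<close>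

lemma coset_eq: "I +>\<^bsub>mpoly_ring n\<^esub> f = (\<lambda>h. h + f) ` I"
  by (auto simp: a_r_coset_def' mpoly_ring_simps)

lemma coset_eq_iff:
  assumes I: "ideal I (mpoly_ring n)"
  shows "I +>\<^bsub>mpoly_ring n\<^esub> f = I +>\<^bsub>mpoly_ring n\<^esub> g \<longleftrightarrow> f - g \<in> I"
proof
  assume "I +>\<^bsub>mpoly_ring n\<^esub> f = I +>\<^bsub>mpoly_ring n\<^esub> g"
  then have "0 + f \<in> (\<lambda>h. h + g) ` I"
    using idealD(2)[OF I] unfolding coset_eq by blast
  then show "f - g \<in> I" by auto
next
  assume fg: "f - g \<in> I"
  have "h + f \<in> (\<lambda>h. h + g) ` I" if "h \<in> I" for h
    using idealD(3)[OF I that fg] by (intro image_eqI[of _ _ "h + (f - g)"]) auto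
  moreover have "h + g \<in> (\<lambda>h. h + f) ` I" if "h \<in> I" for h
    using idealD(5)[OF I that fg] by (intro image_eqI[of _ _ "h - (f - g)"]) auto
  ultimately show "I +>\<^bsub>mpoly_ring n\<^esub> f = I +>\<^bsub>mpoly_ring n\<^esub> g" unfolding coset_eq by blast
qed

lemma coset_0: "I +>\<^bsub>mpoly_ring n\<^esub> 0 = I"
  by (simp add: coset_eq)

lemma qm_simps:
  assumes I: "ideal I (mpoly_ring n)"
  shows "carrier (quotient_module n I) = (\<lambda>f. I +>\<^bsub>mpoly_ring n\<^esub> f) ` polys n"
    and "zero (quotient_module n I) = I"
    and "f \<in> polys n \<Longrightarrow> g \<in> polys n \<Longrightarrow>
      add (quotient_module n I) (I +>\<^bsub>mpoly_ring n\<^esub> f) (I +>\<^bsub>mpoly_ring n\<^esub> g) = I +>\<^bsub>mpoly_ring n\<^esub> (f + g)"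
    and "f \<in> polys n \<Longrightarrow> g \<in> polys n \<Longrightarrow>
      smult (quotient_module n I) f (I +>\<^bsub>mpoly_ring n\<^esub> g) = I +>\<^bsub>mpoly_ring n\<^esub> (f * g)"
    and "gcomp (quotient_module n I) j = (\<lambda>f. I +>\<^bsub>mpoly_ring n\<^esub> f) ` homogeneous_polys n j"
proof -
  interpret ideal I "mpoly_ring n" by fact
  interpret Q: ring_hom_ring "mpoly_ring n" "mpoly_ring n Quot I" "(+>\<^bsub>mpoly_ring n\<^esub>) I"
    by (rule rcos_ring_hom_ring)
  show "carrier (quotient_module n I) = (\<lambda>f. I +>\<^bsub>mpoly_ring n\<^esub> f) ` polys n"
    by (auto simp: quotient_module_def Let_def FactRing_def A_RCOSETS_def')
  show "zero (quotient_module n I) = I"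
    by (simp add: quotient_module_def Let_def FactRing_def)
  show "add (quotient_module n I) (I +>\<^bsub>mpoly_ring n\<^esub> f) (I +>\<^bsub>mpoly_ring n\<^esub> g) = I +>\<^bsub>mpoly_ring n\<^esub> (f + g)"
    if "f \<in> polys n" "g \<in> polys n"
    using Q.hom_add[of f g] that by (simp add: quotient_module_def Let_def mpoly_ring_simps)
  show "smult (quotient_module n I) f (I +>\<^bsub>mpoly_ring n\<^esub> g) = I +>\<^bsub>mpoly_ring n\<^esub> (f * g)"
    if "f \<in> polys n" "g \<in> polys n"
    using Q.hom_mult[of f g] that by (simp add: quotient_module_def Let_def mpoly_ring_simps)
  show "gcomp (quotient_module n I) j = (\<lambda>f. I +>\<^bsub>mpoly_ring n\<^esub> f) ` homogeneous_polys n j"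
    by (simp add: quotient_module_def Let_def)
qed

section \<open>Translation between graded free resolutions and matrices\<close>

definition augmented :: "(nat \<Rightarrow> int list) \<Rightarrow> nat \<Rightarrow> int list" where
  "augmented ds i = (case i of 0 \<Rightarrow> [0] | Suc k \<Rightarrow> ds k)"

lemma augmented_simps [simp]: "augmented ds 0 = [0]" "augmented ds (Suc i) = ds i"
  by (auto simp: augmented_def)

text \<open>The maps \<phi> have matrices outright; the augmentation gets one by lifting it from
  \<open>k[X]/I\<close> to \<open>k[X]\<close>, which turns its kernel condition into membership in
  \<open>I\<close>.\<close>

lemma resolution_to_matrices:
  fixes I :: "'k::field mpoly set"
  assumes I: "ideal I (mpoly_ring n)"
    and res: "graded_free_resolution n (quotient_module n I) ds \<phi> \<epsilon>"
  shows "\<exists>A. resolves n I (augmented ds) A \<and> (\<forall>i l. l < length (ds (Suc i)) \<longrightarrow> A (Suc i) l = \<phi> i (unit_vec l))"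
proof -
  let ?cos = "\<lambda>f. I +>\<^bsub>mpoly_ring n\<^esub> f"
  let ?r = "\<lambda>i. length (ds i)"
  note simps = gfm_simps qm_simps[OF I]
  have eps: "\<epsilon> \<in> graded_hom n (graded_free_module n (ds 0)) (quotient_module n I)"
    and phi: "\<And>i. \<phi> i \<in> graded_hom n (graded_free_module n (ds (Suc i))) (graded_free_module n (ds i))"
    and surj: "\<epsilon> ` vecs n (?r 0) = ?cos ` polys n"
    and ex0: "\<phi> 0 ` vecs n (?r 1) = {v \<in> vecs n (?r 0). \<epsilon> v = I}"
    and ex: "\<And>i. \<phi> (Suc i) ` vecs n (?r (Suc (Suc i))) = {v \<in> vecs n (?r (Suc i)). \<phi> i v = 0}"
    using res by (auto simp: graded_free_resolution_def Let_def simps a_kernel_def')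
  have eps_add: "\<epsilon> (u + v) = \<epsilon> u \<oplus>\<^bsub>quotient_module n I\<^esub> \<epsilon> v"
    if "u \<in> vecs n (?r 0)" "v \<in> vecs n (?r 0)" for u v
    using eps that by (auto simp: graded_hom_def hom_def simps)
  have eps_smul: "\<epsilon> (smul f v) = f \<odot>\<^bsub>quotient_module n I\<^esub> \<epsilon> v"
    if "f \<in> polys n" "v \<in> vecs n (?r 0)" for f v
    using eps that by (auto simp: graded_hom_def simps)
  have phi_add: "\<phi> i (u + v) = \<phi> i u + \<phi> i v"
    if "u \<in> vecs n (?r (Suc i))" "v \<in> vecs n (?r (Suc i))" for i u v
    using phi[of i] that by (auto simp: graded_hom_def hom_def simps)
  have phi_smul: "\<phi> i (smul f v) = smul f (\<phi> i v)"
    if "f \<in> polys n" "v \<in> vecs n (?r (Suc i))" for i f v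
    using phi[of i] that by (auto simp: graded_hom_def simps)
  have phi_deg: "\<phi> i v \<in> hvecs n (ds i) j" if "v \<in> hvecs n (ds (Suc i)) j" for i v j
    using phi[of i] that unfolding graded_hom_def simps by blast
  have "\<exists>f\<in>homogeneous_polys n (ds 0 ! l). \<epsilon> (unit_vec l) = ?cos f" if "l < ?r 0" for l
  proof -
    have "\<epsilon> (unit_vec l) \<in> ?cos ` homogeneous_polys n (ds 0 ! l)"
      using eps hvecs_unit[OF that, of n] unfolding graded_hom_def simps by blast
    then show ?thesis by blast
  qed
  \<comment> \<open>Homogeneous representatives of the images of the basis vectors; they become the
    matrix at position 0.\<close>
  then obtain p where p: "\<And>l. l < ?r 0 \<Longrightarrow> p l \<in> homogeneous_polys n (ds 0 ! l)"
    "\<And>l. l < ?r 0 \<Longrightarrow> \<epsilon> (unit_vec l) = ?cos (p l)" by metis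
  define A where "A i l = (case i of 0 \<Rightarrow> (\<lambda>m::nat. if m = 0 then p l else 0) | Suc k \<Rightarrow> \<phi> k (unit_vec l))" for i l
  \<comment> \<open>The zero of the quotient is reached through scalar multiplication by 0, computed
    on a representative.\<close>
  have eps_0: "\<epsilon> 0 = I"
  proof -
    have "\<epsilon> 0 \<in> ?cos ` polys n" using surj vecs_0 by blast
    then obtain f where f: "f \<in> polys n" "\<epsilon> 0 = ?cos f" by blast
    have "\<epsilon> (smul 0 0) = 0 \<odot>\<^bsub>quotient_module n I\<^esub> \<epsilon> 0" by (rule eps_smul) auto
    moreover have "smul 0 0 = (0 :: 'k vec)" by (auto simp: fun_eq_iff)
    ultimately show ?thesis using f by (simp add: simps coset_0)
  qed
  define R where "R x w \<longleftrightarrow> w 0 \<in> polys n \<and> x = ?cos (w 0)" for x and w :: "'k vec"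
  have eps_A: "diff_map (augmented ds) A 0 v 0 \<in> polys n \<and> \<epsilon> v = ?cos (diff_map (augmented ds) A 0 v 0)"
    if "v \<in> vecs n (?r 0)" for v
  proof -
    have "R (\<epsilon> v) (matapp (?r 0) (A 0) v)"
    proof (rule linear_matapp[where plus' = "add (quotient_module n I)" and
          smul' = "smult (quotient_module n I)" and n = n])
      show "R (\<epsilon> (unit_vec l)) (A 0 l)" if "l < ?r 0" for l
        using p[OF that] by (auto simp: R_def A_def homogeneous_polys_def)
      show "R (\<epsilon> 0) 0" unfolding R_def eps_0 by (simp add: coset_0)
    qed (use that in \<open>simp_all only: eps_add eps_smul, auto simp: R_def simps\<close>)
    then show ?thesis by (simp add: R_def diff_map_def)
  qed
  have phi_A: "\<phi> i v = diff_map (augmented ds) A (Suc i) v" if "v \<in> vecs n (?r (Suc i))" for i v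
  proof -
    have "\<phi> i 0 = 0" using phi_add[of 0 i 0] by simp
    then have "\<phi> i v = matapp (?r (Suc i)) (A (Suc i)) v"
      using that
      by (intro linear_matapp[where R = "(=)" and plus' = "(+)" and smul' = smul and n = n])
        (simp_all only: phi_add phi_smul, simp_all add: A_def)
    then show ?thesis by (simp add: diff_map_def)
  qed
  have mat: "dmat n (augmented ds i) (augmented ds (Suc i)) (A i)" for i
  proof (cases i)
    case 0
    then show ?thesis using p(1)
      by (auto simp: dmat_def A_def hvecs_def vecs_def homogeneous_polys_def hdeg_def split: if_splits)
  next
    case (Suc k)
    then show ?thesis using phi_deg[OF hvecs_unit] by (simp add: dmat_def A_def)
  qed
  have vec1: "diff_map (augmented ds) A 0 v \<in> vecs n 1" if "v \<in> vecs n (?r 0)" for v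
    using dmat_matapp_vecs[OF mat[of 0], of v] that by (simp add: diff_map_def)
  have eps_I: "\<epsilon> v = I \<longleftrightarrow> diff_map (augmented ds) A 0 v \<in> slack n I 0" if v: "v \<in> vecs n (?r 0)" for v
  proof -
    have "\<epsilon> v = I \<longleftrightarrow> ?cos (diff_map (augmented ds) A 0 v 0) = ?cos 0"
      using eps_A[OF v] by (simp add: coset_0)
    also have "\<dots> \<longleftrightarrow> diff_map (augmented ds) A 0 v 0 \<in> I" by (simp add: coset_eq_iff[OF I])
    finally show ?thesis using vec1[OF v] by (simp add: slack_def ideal_vecs_def)
  qed
  have cyc: "cycles n I (augmented ds) A (Suc (Suc i)) = \<phi> (Suc i) ` vecs n (?r (Suc (Suc i)))" for i
    unfolding ex by (auto simp: cycles_def phi_A slack_def)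
  have cyc1: "cycles n I (augmented ds) A (Suc 0) = \<phi> 0 ` vecs n (?r 1)"
    unfolding ex0 by (simp add: cycles_def eps_I cong: conj_cong)
  have "resolves n I (augmented ds) A"
    unfolding resolves_def
  proof (intro conjI allI ballI)
    show "augmented ds 0 = [0]" by simp
    show "dmat n (augmented ds i) (augmented ds (Suc i)) (A i)" for i by (rule mat)
    show "diff_map (augmented ds) A i w \<in> cycles n I (augmented ds) A i"
      if w: "w \<in> vecs n (length (augmented ds (Suc i)))" for i w
    proof (cases i)
      case 0
      then show ?thesis using vec1 w by (simp add: cycles_def)
    next
      case (Suc k)
      then have "diff_map (augmented ds) A i w = \<phi> k w" using phi_A[of w k] w by simp
      then show ?thesis using cyc cyc1 Suc w by (cases k) auto
    qed
    show "\<exists>w\<in>vecs n (length (augmented ds (Suc i))). diff_map (augmented ds) A i w - v \<in> slack n I i"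
      if v: "v \<in> cycles n I (augmented ds) A i" for i v
    proof (cases i)
      case 0
      then have v1: "v \<in> vecs n 1" using v by (simp add: cycles_def)
      then have "?cos (v 0) \<in> \<epsilon> ` vecs n (?r 0)" unfolding surj using vecsD(1) by blast
      then obtain w where w: "w \<in> vecs n (?r 0)" "\<epsilon> w = ?cos (v 0)" by auto
      then have "diff_map (augmented ds) A 0 w 0 - v 0 \<in> I"
        using eps_A[OF w(1)] by (simp add: coset_eq_iff[OF I])
      then show ?thesis using 0 w vec1[OF w(1)] v1
        by (intro bexI[of _ w]) (auto simp: slack_def ideal_vecs_def)
    next
      case (Suc k)
      then have "v \<in> \<phi> k ` vecs n (?r (Suc k))" using v cyc cyc1 by (cases k) auto
      then obtain w where "w \<in> vecs n (?r (Suc k))" "v = \<phi> k w" by blast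
      then show ?thesis using Suc phi_A[of w k]
        by (intro bexI[of _ w]) (auto simp: slack_def)
    qed
  qed
  then show ?thesis by (auto simp: A_def intro!: exI[of _ A])
qed

lemma matrices_to_resolution:
  fixes I :: "'k::field mpoly set"
  assumes I: "ideal I (mpoly_ring n)" and res: "resolves n I (augmented ds) A"
  shows "graded_free_resolution n (quotient_module n I) ds (\<lambda>i. diff_map (augmented ds) A (Suc i))
     (\<lambda>v. I +>\<^bsub>mpoly_ring n\<^esub> (diff_map (augmented ds) A 0 v 0))"
proof -
  let ?cos = "\<lambda>f. I +>\<^bsub>mpoly_ring n\<^esub> f"
  let ?r = "\<lambda>i. length (ds i)"
  let ?d = "diff_map (augmented ds) A"
  note simps = gfm_simps qm_simps[OF I]
  have mat: "\<And>i. dmat n (augmented ds i) (augmented ds (Suc i)) (A i)"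
    and cyc: "\<And>i w. w \<in> vecs n (length (augmented ds (Suc i))) \<Longrightarrow> ?d i w \<in> cycles n I (augmented ds) A i"
    and ex: "\<And>i v. v \<in> cycles n I (augmented ds) A i \<Longrightarrow>
        \<exists>w\<in>vecs n (length (augmented ds (Suc i))). ?d i w - v \<in> slack n I i"
    using res by (auto simp: resolves_def)
  have add: "?d i (u + v) = ?d i u + ?d i v" for i u v by (simp add: diff_map_def matapp_add)
  have smul: "?d i (smul f v) = smul f (?d i v)" for i f v by (simp add: diff_map_def matapp_smul)
  have dv: "?d i v \<in> vecs n (length (augmented ds i))" if "v \<in> vecs n (?r i)" for i v
    using dmat_matapp_vecs[OF mat[of i], of v] that by (simp add: diff_map_def)
  have dh: "?d i v \<in> hvecs n (augmented ds i) j" if "v \<in> hvecs n (ds i) j" for i v j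
    using dmat_matapp_hvecs[OF mat[of i], of v] that by (simp add: diff_map_def)
  have d0: "?d 0 v 0 \<in> polys n" "?d 0 v \<in> vecs n 1" if "v \<in> vecs n (?r 0)" for v
    using dv[OF that] vecsD(1) by (auto simp: vecs_def)
  have 1: "(\<lambda>v. ?cos (?d 0 v 0)) \<in> graded_hom n (graded_free_module n (ds 0)) (quotient_module n I)"
    unfolding graded_hom_def hom_def
  proof (intro CollectI conjI Pi_I ballI allI subsetI)
    fix j x assume "x \<in> (\<lambda>v. ?cos (?d 0 v 0)) ` gcomp (graded_free_module n (ds 0)) j"
    then obtain v where v: "v \<in> hvecs n (ds 0) j" "x = ?cos (?d 0 v 0)"
      by (auto simp: simps)
    have "?d 0 v 0 \<in> homogeneous_polys n j"
    proof -
      have "int (mon_deg a) = j" if "a \<in> keys (?d 0 v 0)" for a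
        using dh[OF v(1)] that unfolding hvecs_def hdeg_def by fastforce
      then show ?thesis using d0[OF hvecs_vecs[OF v(1)]] by (simp add: homogeneous_polys_def)
    qed
    then show "x \<in> gcomp (quotient_module n I) j" using v by (simp add: simps)
  qed (auto simp: simps add smul d0)
  have 2: "?d (Suc i) \<in> graded_hom n (graded_free_module n (ds (Suc i))) (graded_free_module n (ds i))" for i
    unfolding graded_hom_def hom_def using dv[of _ "Suc i"] dh[of _ "Suc i"] by (auto simp: simps add smul)
  have 3: "(\<lambda>v. ?cos (?d 0 v 0)) ` vecs n (?r 0) = ?cos ` polys n"
  proof
    show "(\<lambda>v. ?cos (?d 0 v 0)) ` vecs n (?r 0) \<subseteq> ?cos ` polys n" using d0 by blast
    show "?cos ` polys n \<subseteq> (\<lambda>v. ?cos (?d 0 v 0)) ` vecs n (?r 0)"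
    proof
      fix x assume "x \<in> ?cos ` polys n"
      then obtain f where f: "f \<in> polys n" "x = ?cos f" by blast
      define v where "v = (\<lambda>l::nat. if l = 0 then f else 0)"
      have "v \<in> cycles n I (augmented ds) A 0" using f by (auto simp: v_def cycles_def vecs_def)
      from ex[OF this] obtain w where w: "w \<in> vecs n (?r 0)" "?d 0 w - v \<in> slack n I 0" by auto
      then have "?d 0 w 0 - f \<in> I" by (auto simp: slack_def ideal_vecs_def v_def)
      then have "x = ?cos (?d 0 w 0)" using f coset_eq_iff[OF I] by metis
      then show "x \<in> (\<lambda>v. ?cos (?d 0 v 0)) ` vecs n (?r 0)" using w by blast
    qed
  qed
  have img: "?d (Suc i) ` vecs n (?r (Suc i)) = cycles n I (augmented ds) A (Suc i)" for i
  proof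
    show "?d (Suc i) ` vecs n (?r (Suc i)) \<subseteq> cycles n I (augmented ds) A (Suc i)"
      using cyc[of _ "Suc i"] by auto
    show "cycles n I (augmented ds) A (Suc i) \<subseteq> ?d (Suc i) ` vecs n (?r (Suc i))"
      using ex[of _ "Suc i"] by (fastforce simp: slack_def)
  qed
  have 4: "?d (Suc 0) ` vecs n (?r 1) = {v \<in> vecs n (?r 0). ?cos (?d 0 v 0) = I}"
  proof -
    have "?cos (?d 0 v 0) = I \<longleftrightarrow> ?d 0 v \<in> slack n I 0" if "v \<in> vecs n (?r 0)" for v
      using coset_eq_iff[OF I, of "?d 0 v 0" 0] d0[OF that]
      by (simp add: coset_0 slack_def ideal_vecs_def)
    then show ?thesis using img[of 0] by (auto simp: cycles_def)
  qed
  have 5: "?d (Suc (Suc i)) ` vecs n (?r (Suc (Suc i))) = {v \<in> vecs n (?r (Suc i)). ?d (Suc i) v = 0}" for i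
    unfolding img by (auto simp: cycles_def slack_def)
  show ?thesis
    unfolding graded_free_resolution_def Let_def a_kernel_def'
    using 1 2 3 4 5 by (simp add: simps)
qed

section \<open>The irrelevant ideal in terms of constant coefficients\<close>

lemma irrelevant_ideal_constant:
  assumes "f \<in> irrelevant_ideal n"
  shows "lookup (f :: 'k::field mpoly) 0 = 0"
proof -
  interpret cring "mpoly_ring n :: 'k mpoly ring" by (rule cring_mpoly_ring)
  have "irrelevant_ideal n \<subseteq> {f \<in> polys n. lookup (f :: 'k mpoly) 0 = 0}"
    unfolding irrelevant_ideal_def
  proof (rule genideal_minimal)
    show "ideal {f \<in> polys n. lookup (f :: 'k mpoly) 0 = 0} (mpoly_ring n)"
      by (auto simp: ideal_mpoly_ring_iff lookup_add lookup_mult_0)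
    have "single i (1::nat) \<noteq> 0" for i :: nat
      by (metis inj_single injD single_zero zero_neq_one lookup_single_eq lookup_zero)
    then show "{single (single i 1) 1 |i. i < n} \<subseteq> {f \<in> polys n. lookup (f :: 'k mpoly) 0 = 0}"
      by (auto simp: polys_def monomials_def lookup_single when_def)
  qed
  then show ?thesis using assms by blast
qed

lemma irrelevant_idealI:
  assumes f: "f \<in> polys n" "lookup f 0 = 0"
  shows "(f :: 'k::field mpoly) \<in> irrelevant_ideal n"
proof -
  interpret cring "mpoly_ring n :: 'k mpoly ring" by (rule cring_mpoly_ring)
  let ?X = "{single (single i 1) (1::'k) |i. i < n}"
  have X: "?X \<subseteq> carrier (mpoly_ring n)" by (auto simp: polys_def monomials_def)
  have id: "ideal (irrelevant_ideal n :: 'k mpoly set) (mpoly_ring n)"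
    unfolding irrelevant_ideal_def using X by (rule genideal_ideal)
  have terms: "single a (lookup f a) \<in> irrelevant_ideal n" if a: "a \<in> keys f" for a
  proof -
    have "a \<noteq> 0" using a f(2) by (auto simp: in_keys_iff)
    then obtain i where i: "i \<in> keys a" by (auto simp flip: keys_eq_empty)
    have am: "a \<in> monomials n" using a f by (rule_tac polysD)
    define b where "b = a - single i 1"
    have ab: "a = b + single i 1"
      using i by (intro poly_mapping_eqI) (auto simp: b_def lookup_add lookup_minus lookup_single when_def in_keys_iff)
    have "i < n" using i am by (auto simp: monomials_def)
    then have "single (single i 1) (1::'k) \<in> irrelevant_ideal n"
      unfolding irrelevant_ideal_def using genideal_self[OF X] by blast
    moreover have "b \<in> monomials n" using am ab by simp
    ultimately have "single b (lookup f a) * single (single i 1) 1 \<in> irrelevant_ideal n"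
      using idealD(4)[OF id] by auto
    then show ?thesis unfolding mult_single ab[symmetric] by simp
  qed
  have "(\<Sum>a\<in>S. single a (lookup f a)) \<in> irrelevant_ideal n" if "finite S" "S \<subseteq> keys f" for S
    using that by (induction S rule: finite_induct) (auto intro: idealD(2,3)[OF id] terms)
  then have "(\<Sum>a\<in>keys f. single a (lookup f a)) \<in> irrelevant_ideal n" by simp
  then show ?thesis using poly_expand[of f] by simp
qed

lemma minimal_resolution_count_le_resolution:
  assumes hI: "homogeneous_ideal n I"
    and F: "minimal_graded_free_resolution n (quotient_module n I) ds \<phi> \<epsilon>"
    and G: "graded_free_resolution n (quotient_module n I) es \<psi> \<eta>"
  shows "count_list (ds i) j \<le> count_list (es i) j"
proof -
  note I = ideal_I[OF hI]
  have F': "graded_free_resolution n (quotient_module n I) ds \<phi> \<epsilon>"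
    using F by (simp add: minimal_graded_free_resolution_def)
  obtain A where A: "resolves n I (augmented ds) A"
    "\<And>i l. l < length (ds (Suc i)) \<Longrightarrow> A (Suc i) l = \<phi> i (unit_vec l)"
    using resolution_to_matrices[OF I F'] by blast
  obtain B where B: "resolves n I (augmented es) B"
    using resolution_to_matrices[OF I G] by blast
  have "lookup (A (Suc i) l m) 0 = 0" if l: "l < length (augmented ds (Suc (Suc i)))" for i l m
  proof (cases "m < length (ds i)")
    case True
    have "\<phi> i (unit_vec l) m \<in> irrelevant_ideal n"
      using F l True by (auto simp: minimal_graded_free_resolution_def gfm_simps)
    then show ?thesis using A(2)[of l i] l irrelevant_ideal_constant by auto
  next
    case False
    have "dmat n (ds i) (ds (Suc i)) (A (Suc i))"
      using A(1) unfolding resolves_def by (metis augmented_simps(2))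
    then have "A (Suc i) l \<in> vecs n (length (ds i))" using l by (intro dmat_vecs) auto
    then show ?thesis using False by (simp add: vecsD(2))
  qed
  from minimal_resolution_count_le[OF hI A(1) B this, of i j] show ?thesis by simp
qed

lemma betti_eq:
  assumes hI: "homogeneous_ideal n I"
    and F: "minimal_graded_free_resolution n (quotient_module n I) ds \<phi> \<epsilon>"
  shows "betti n (quotient_module n I) i j = count_list (ds i) j"
  unfolding betti_def
proof (rule the_equality)
  show "\<exists>ds' \<phi> \<epsilon>. minimal_graded_free_resolution n (quotient_module n I) ds' \<phi> \<epsilon> \<and>
     count_list (ds i) j = count_list (ds' i) j" using F by blast
  fix b assume "\<exists>ds \<phi> \<epsilon>. minimal_graded_free_resolution n (quotient_module n I) ds \<phi> \<epsilon> \<and> b = count_list (ds i) j"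
  then obtain ds' \<phi>' \<epsilon>' where G: "minimal_graded_free_resolution n (quotient_module n I) ds' \<phi>' \<epsilon>'"
    "b = count_list (ds' i) j" by blast
  have "count_list (ds i) j = count_list (ds' i) j"
    using minimal_resolution_count_le_resolution[OF hI F, of ds'] G(1)
      minimal_resolution_count_le_resolution[OF hI G(1), of ds] F
    by (intro antisym) (auto simp: minimal_graded_free_resolution_def)
  then show "b = count_list (ds i) j" using G by simp
qed

text \<open>Here \<open>F_0 = k[X]\<close> and the augmentation lifts to the identity, so positions
  0 and 1 of the augmented complex coincide and the cycles at position 1 are
  \<open>I\<close>.\<close>

lemma resolves_from_exact_sequence:
  fixes I :: "'k::field mpoly set"
  assumes ds0: "ds 0 = [0]" and mat: "\<And>i. dmat n (ds i) (ds (Suc i)) (C i)"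
    and img: "ideal_vecs n I = matapp (length (ds 1)) (C 0) ` vecs n (length (ds 1))"
    and exact: "\<And>i. {v \<in> vecs n (length (ds (Suc i))). matapp (length (ds (Suc i))) (C i) v = 0} =
        matapp (length (ds (Suc (Suc i)))) (C (Suc i)) ` vecs n (length (ds (Suc (Suc i))))"
    and I: "ideal I (mpoly_ring n)"
  shows "resolves n I (augmented ds) (case_nat unit_vec C)"
proof -
  let ?A = "case_nat unit_vec C"
  have d0: "diff_map (augmented ds) ?A 0 v = v" if "v \<in> vecs n 1" for v :: "'k vec"
    using that ds0 by (simp add: diff_map_def matapp_id)
  have dS: "diff_map (augmented ds) ?A (Suc i) = matapp (length (ds (Suc i))) (C i)" for i
    by (simp add: diff_map_def fun_eq_iff)
  have cyc: "cycles n I (augmented ds) ?A (Suc i) =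
      matapp (length (ds (Suc i))) (C i) ` vecs n (length (ds (Suc i)))" for i
  proof (cases i)
    case 0
    have "cycles n I (augmented ds) ?A (Suc 0) = ideal_vecs n I"
      using d0 ds0 by (auto simp: cycles_def slack_def ideal_vecs_def)
    then show ?thesis using img 0 by simp
  next
    case (Suc k)
    then show ?thesis unfolding Suc exact[symmetric] by (auto simp: cycles_def slack_def dS)
  qed
  show ?thesis
    unfolding resolves_def
  proof (intro conjI allI ballI)
    show "dmat n (augmented ds i) (augmented ds (Suc i)) (?A i)" for i
      using mat ds0 hvecs_unit[of _ "[0]" n] by (cases i) (auto simp: dmat_def)
    show "diff_map (augmented ds) ?A i w \<in> cycles n I (augmented ds) ?A i"
      if w: "w \<in> vecs n (length (augmented ds (Suc i)))" for i w
    proof (cases i)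
      case 0 then show ?thesis using w ds0 d0 by (simp add: cycles_def)
    next
      case (Suc k) then show ?thesis using w by (auto simp: cyc dS)
    qed
    show "\<exists>w\<in>vecs n (length (augmented ds (Suc i))). diff_map (augmented ds) ?A i w - v \<in> slack n I i"
      if v: "v \<in> cycles n I (augmented ds) ?A i" for i v
    proof (cases i)
      case 0
      then show ?thesis using v ds0 d0 vec_submoduleD(1)[OF vec_submodule_slack[OF I]]
        by (intro bexI[of _ v]) (auto simp: cycles_def)
    next
      case (Suc k)
      then obtain w where "w \<in> vecs n (length (ds (Suc k)))" "v = matapp (length (ds (Suc k))) (C k) w"
        using v cyc by auto
      then show ?thesis using Suc by (intro bexI[of _ w]) (auto simp: dS slack_def)
    qed
  qed simp
qed

text \<open>The quotient is zero and all modules of the resolution are zero; at position 0 this is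
  exact because \<open>slack\<close> is all of \<open>k[X]\<close>.\<close>

lemma unit_ideal_minimal_resolution:
  "\<exists>\<phi> \<epsilon>. minimal_graded_free_resolution n (quotient_module n (polys n :: 'k::field mpoly set)) (\<lambda>i. []) \<phi> \<epsilon>"
proof -
  have I: "ideal (polys n :: 'k mpoly set) (mpoly_ring n)" by (auto simp: ideal_mpoly_ring_iff)
  have "resolves n (polys n :: 'k mpoly set) (augmented (\<lambda>i. [])) (\<lambda>i l. 0)"
    unfolding resolves_def
  proof (intro conjI allI ballI)
    have d: "diff_map (augmented (\<lambda>i. [])) (\<lambda>i l. 0) i w = (0 :: 'k vec)" for i w
      by (simp add: diff_map_def matapp_as_sum)
    show "dmat n (augmented (\<lambda>i. []) i) (augmented (\<lambda>i. []) (Suc i)) (\<lambda>l. 0)" for i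
      by (simp add: dmat_def)
    show "diff_map (augmented (\<lambda>i. [])) (\<lambda>i l. 0) i w \<in> cycles n (polys n) (augmented (\<lambda>i. [])) (\<lambda>i l. 0 :: 'k vec) i"
      for i and w :: "'k vec"
      using vec_submoduleD(1)[OF vec_submodule_slack[OF I]] unfolding d by (simp add: cycles_def d)
    show "\<exists>w\<in>vecs n (length (augmented (\<lambda>i. []) (Suc i))).
        diff_map (augmented (\<lambda>i. [])) (\<lambda>i l. 0) i w - v \<in> slack n (polys n) i"
      if "v \<in> cycles n (polys n) (augmented (\<lambda>i. [])) (\<lambda>i l. 0 :: 'k vec) i" for i and v :: "'k vec"
    proof (rule bexI[of _ 0])
      have v: "v \<in> vecs n (length (augmented (\<lambda>i. []) i))" using that by (simp add: cycles_def)
      have "- v \<in> slack n (polys n) i"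
      proof (cases i)
        case 0
        then show ?thesis using v by (auto simp: slack_def ideal_vecs_def vecs_def)
      next
        case (Suc k)
        then have "v = 0" using v by (auto simp: vecs_def fun_eq_iff)
        then show ?thesis using Suc by (simp add: slack_def)
      qed
      then show "diff_map (augmented (\<lambda>i. [])) (\<lambda>i l. 0) i 0 - v \<in> slack n (polys n) i" unfolding d by simp
    qed simp
  qed simp
  from matrices_to_resolution[OF I this] show ?thesis
    unfolding minimal_graded_free_resolution_def by auto
qed

section \<open>Resolutions of \<open>L_<(I)\<close> and of \<open>I\<close> with common
  shifts\<close>

context graded_preorder
begin

abbreviation shifts :: "(nat \<Rightarrow> mon list) \<Rightarrow> nat \<Rightarrow> int list" where
  "shifts bs i \<equiv> map (\<lambda>b. int (mon_deg b)) (bs i)"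

lemma dmat_shifts:
  assumes "\<And>l. l < length (bs (Suc i)) \<Longrightarrow> A l \<in> vecs n (length (bs i))"
    and "\<And>l m a. l < length (bs (Suc i)) \<Longrightarrow> a \<in> keys (A l m) \<Longrightarrow>
        mon_deg (a + bs i ! m) = mon_deg (bs (Suc i) ! l)"
  shows "dmat n (shifts bs i) (shifts bs (Suc i)) A"
  unfolding dmat_def hvecs_def
proof (clarsimp, intro conjI allI impI)
  fix l assume l: "l < length (bs (Suc i))"
  show "A l \<in> vecs n (length (bs i))" using assms(1) l .
  fix m a assume a: "a \<in> keys (A l m)"
  have "m < length (bs i)" using vecs_keys[OF assms(1)[OF l] a] by simp
  then show "hdeg (shifts bs i) (int (mon_deg (bs (Suc i) ! l))) a m"
    using assms(2)[OF l a] by (simp add: hdeg_def mon_deg_add)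
qed

lemma gmat_dmat: "gmat (bs i) (bs (Suc i)) A \<Longrightarrow> dmat n (shifts bs i) (shifts bs (Suc i)) A"
proof (rule dmat_shifts)
  assume gm: "gmat (bs i) (bs (Suc i)) A"
  show "mon_deg (a + bs i ! m) = mon_deg (bs (Suc i) ! l)"
    if "l < length (bs (Suc i))" "a \<in> keys (A l m)" for l m a
    using gm that homogD[of "bs i" "bs (Suc i) ! l" "A l" a m] by (simp add: gmat_def eqv_def)
qed (simp add: gmat_def)

lemma minimal_resolution_from_matrices:
  fixes K :: "'k::field mpoly set"
  assumes K: "ideal K (mpoly_ring n)"
    and bs0: "bs 0 = [0]" and gm: "\<And>i. gmat (bs i) (bs (Suc i)) (A i)"
    and img: "ideal_vecs n K = matapp (length (bs 1)) (A 0) ` vecs n (length (bs 1))"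
    and exact: "\<And>i. {v \<in> vecs n (length (bs (Suc i))). matapp (length (bs (Suc i))) (A i) v = 0} =
        matapp (length (bs (Suc (Suc i)))) (A (Suc i)) ` vecs n (length (bs (Suc (Suc i))))"
    and const: "\<And>i l m. l < length (bs (Suc i)) \<Longrightarrow> lookup (A i l m) 0 = 0"
  shows "\<exists>\<phi> \<epsilon>. minimal_graded_free_resolution n (quotient_module n K) (shifts bs) \<phi> \<epsilon>"
proof -
  let ?A = "case_nat unit_vec A"
  let ?d = "\<lambda>i. diff_map (augmented (shifts bs)) ?A (Suc i)"
  have "resolves n K (augmented (shifts bs)) ?A"
    by (rule resolves_from_exact_sequence) (use bs0 gm gmat_dmat img exact K in auto)
  from matrices_to_resolution[OF K this] have "graded_free_resolution n (quotient_module n K) (shifts bs)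
     ?d (\<lambda>v. K +>\<^bsub>mpoly_ring n\<^esub> (diff_map (augmented (shifts bs)) ?A 0 v 0))" .
  moreover have "?d i v l \<in> irrelevant_ideal n"
    if v: "v \<in> carrier (graded_free_module n (shifts bs (Suc i)))" for i v l
  proof (rule irrelevant_idealI)
    have "?d i v = matapp (length (bs (Suc i))) (A i) v" by (simp add: diff_map_def)
    moreover have "\<dots> \<in> vecs n (length (bs i))"
      using gmat_matapp_vecs[OF gm] v by (simp add: gfm_simps)
    ultimately show "?d i v l \<in> polys n" using vecsD(1) by metis
    show "lookup (?d i v l) 0 = 0" using const by (simp add: diff_map_def lookup_matapp_0)
  qed
  ultimately show ?thesis unfolding minimal_graded_free_resolution_def by blast
qed

text \<open>Properness of \<open>I\<close> passes to the leading ideal, which then has no constant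
  terms; so \<open>F_0 = k[X]\<close> is compatible with minimality.\<close>

lemma resolution_of_leading_ideal_lifts:
  fixes I :: "'k::field mpoly set"
  assumes hI: "homogeneous_ideal n I" and proper: "I \<noteq> polys n"
  shows "\<exists>ds \<phi> \<epsilon> \<psi> \<eta>.
     minimal_graded_free_resolution n (quotient_module n (leading_ideal n lt I)) ds \<phi> \<epsilon> \<and>
     graded_free_resolution n (quotient_module n I) ds \<psi> \<eta>"
proof -
  have I: "ideal I (mpoly_ring n)" using hI by (simp add: homogeneous_ideal_def)
  let ?L = "leading_ideal n lt I"
  have L: "ideal ?L (mpoly_ring n)" by (rule leading_ideal_ideal[OF I])
  have "lookup (v l) 0 = 0" if "v \<in> ideal_vecs n ?L" for v l
    using that leading_ideal_proper[OF hI proper, of "v 0"] vecsD(2)[of v n 1 l]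
    by (cases "l = 0") (auto simp: ideal_vecs_def)
  then have const: "\<forall>v\<in>ideal_vecs n ?L. \<forall>l. lookup (v l) 0 = 0" by blast
  have sub: "ideal_vecs n ?L \<subseteq> vecs n 1" by (auto simp: ideal_vecs_def)
  obtain bs A where bs: "bs 0 = [0]" "\<And>i. set (bs i) \<subseteq> monomials n"
    and A: "\<And>i. gmat (bs i) (bs (Suc i)) (A i)"
    "ideal_vecs n ?L = matapp (length (bs 1)) (A 0) ` vecs n (length (bs 1))"
    "\<And>i. {v \<in> vecs n (length (bs (Suc i))). matapp (length (bs (Suc i))) (A i) v = 0} =
        matapp (length (bs (Suc (Suc i)))) (A (Suc i)) ` vecs n (length (bs (Suc (Suc i))))"
    "\<And>i l m. l < length (bs (Suc i)) \<Longrightarrow> lookup (A i l m) 0 = 0"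
    using minimal_graded_resolution_exists[where J = "ideal_vecs n ?L",
          OF sub vec_submodule_ideal_vecs[OF L] leading_ideal_closed[OF hI] const] by blast
  have "degenerates (bs 0) (ideal_vecs n I) (matapp (length (bs 1)) (A 0) ` vecs n (length (bs 1)))"
    using degenerates_leading_ideal[OF hI] bs(1) A(2) by simp
  from lifted_resolution_exists[OF bs(2) A(1) this A(3)] obtain B
    where B: "\<And>i. lifts (bs i) (bs (Suc i)) (B i) (A i)"
      "ideal_vecs n I = matapp (length (bs 1)) (B 0) ` vecs n (length (bs 1))"
      "\<And>i. {v \<in> vecs n (length (bs (Suc i))). matapp (length (bs (Suc i))) (B i) v = 0} =
        matapp (length (bs (Suc (Suc i)))) (B (Suc i)) ` vecs n (length (bs (Suc (Suc i))))"
    by blast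
  have "dmat n (shifts bs i) (shifts bs (Suc i)) (B i)" for i
    using lifts_vecs[OF A(1) B(1)] lifts_degree[OF A(1) B(1)] by (rule dmat_shifts)
  then have "resolves n I (augmented (shifts bs)) (case_nat unit_vec B)"
    by (intro resolves_from_exact_sequence) (use bs B I in auto)
  from matrices_to_resolution[OF I this] obtain \<psi> \<eta> where
    "graded_free_resolution n (quotient_module n I) (shifts bs) \<psi> \<eta>" by blast
  moreover obtain \<phi> \<epsilon> where "minimal_graded_free_resolution n (quotient_module n ?L) (shifts bs) \<phi> \<epsilon>"
    using minimal_resolution_from_matrices[OF L bs(1) A] by blast
  ultimately show ?thesis by blast
qed

end

text \<open>When no two monomials are comparable, every term is leading, so a proper
  \<open>I\<close> equals its leading ideal and receives the minimal resolution constructed for the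
  latter.\<close>

lemma minimal_graded_free_resolution_exists:
  fixes I :: "'k::field mpoly set"
  assumes hI: "homogeneous_ideal n I"
  shows "\<exists>ds \<phi> \<epsilon>. minimal_graded_free_resolution n (quotient_module n I) ds \<phi> \<epsilon>"
proof (cases "I = polys n")
  case True
  then show ?thesis using unit_ideal_minimal_resolution by blast
next
  case False
  interpret graded_preorder n "\<lambda>_ _. False"
    by unfold_locales
      (auto simp: monomial_preorder_def weak_order_on_def irreflp_on_def transp_on_def
        intro!: equivI refl_onI symI transI)
  have I: "ideal I (mpoly_ring n)" using hI by (simp add: homogeneous_ideal_def)
  have "leading_part (\<lambda>_ _. False) f = f" for f :: "'k mpoly"
    by (simp add: leading_part_restr restr_eq_self)
  then have "leading_ideal n (\<lambda>_ _. False) I = genideal (mpoly_ring n) I"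
    by (simp add: leading_ideal_def)
  also have "\<dots> = I"
    using I unfolding genideal_def by auto
  finally show ?thesis using resolution_of_leading_ideal_lifts[OF hI False] by auto
qed

theorem proposition4p12:
  fixes n :: nat and lt :: "mon \<Rightarrow> mon \<Rightarrow> bool" and I :: "'k::field mpoly set"
  assumes "monomial_preorder n lt"
    and "homogeneous_ideal n I"
  shows "\<forall>(i::nat) (j::int).
    betti n (quotient_module n I) i j \<le> betti n (quotient_module n (leading_ideal n lt I)) i j"
proof (intro allI)
  fix i :: nat and j :: int
  interpret graded_preorder n lt using assms(1) by unfold_locales
  show "betti n (quotient_module n I) i j \<le> betti n (quotient_module n (leading_ideal n lt I)) i j"
  proof (cases "I = polys n")
    case True
    \<comment> \<open>All Betti numbers of the zero module vanish, so nothing has to be known about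
      the leading ideal.\<close>
    obtain \<phi> \<epsilon> where "minimal_graded_free_resolution n (quotient_module n I) (\<lambda>i. []) \<phi> \<epsilon>"
      using unit_ideal_minimal_resolution True by blast
    then show ?thesis using betti_eq[OF assms(2)] by simp
  next
    case False
    obtain ds \<phi> \<epsilon> \<psi> \<eta> where
      L: "minimal_graded_free_resolution n (quotient_module n (leading_ideal n lt I)) ds \<phi> \<epsilon>"
      and I: "graded_free_resolution n (quotient_module n I) ds \<psi> \<eta>"
      using resolution_of_leading_ideal_lifts[OF assms(2) False] by blast
    obtain es \<phi>' \<epsilon>' where F: "minimal_graded_free_resolution n (quotient_module n I) es \<phi>' \<epsilon>'"
      using minimal_graded_free_resolution_exists[OF assms(2)] by blast
    show ?thesis
      unfolding betti_eq[OF assms(2) F] betti_eq[OF homogeneous_leading_ideal[OF assms(2)] L]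
      by (rule minimal_resolution_count_le_resolution[OF assms(2) F I])
  qed
qed

end
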